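(* The variety $\mathcal{T}_3$ of complex $3$-dimensional transposed Poisson algebras has exactly five irreducible components. They are: the closures $\overline{O({\rm T}_{01})}$ and $\overline{O({\rm T}_{20})}$ of the orbits of the rigid algebras ${\rm T}_{01}$ and ${\rm T}_{20}$, and the closures $$\overline{\bigcup_{\alpha,\beta\in\mathbb{C}}O({\rm T}_{09}^{\alpha,\beta})},\qquad \overline{\bigcup_{\beta\in\mathbb{C}}O({\rm T}_{12}^{\beta})},\qquad \overline{\bigcup_{\beta\in\mathbb{C}}O({\rm T}_{17}^{\beta})}$$ corresponding to three parametric families, where (in a basis $e_1,e_2,e_3$) - ${\rm T}_{01}$: $[e_1,e_2]=e_3$, $[e_1,e_3]=-e_2$, $[e_2,e_3]=e_1$ (zero product $\cdot$); - ${\rm T}_{20}$: $e_1\cdot e_1=e_1$, $e_2\cdot e_2=e_2$, $e_3\cdot e_3=e_3$ (zero bracket); - ${\rm T}_{09}^{\alpha,\beta}$: $e_1\cdot e_3=\beta e_1$, $e_2\cdot e_3=\beta e_2$, $e_3\cdot e_3=\beta e_3$; $[e_1,e_3]=e_1+e_2$, $[e_2,e_3]=\alpha e_2$; - ${\rm T}_{12}^{\beta}$: $e_1\cdot e_1=e_2$, $e_1\cdot e_3=\beta e_1$, $e_2\cdot e_3=\beta e_2$, $e_3\cdot e_3=\beta e_3$; $[e_1,e_3]=e_1+e_2$, $[e_2,e_3]=2e_2$; - ${\rm T}_{17}^{\beta}$: $e_1\cdot e_1=e_2$, $e_1\cdot e_2=-e_2$, $e_1\cdot e_3=\beta e_1$,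 $e_2\cdot e_2=e_2$, $e_2\cdot e_3=\beta e_2$, $e_3\cdot e_3=\beta e_3$; $[e_1,e_3]=e_1+e_2$.
   Context: All vector spaces are over $\mathbb{C}$. A transposed Poisson algebra is a triple $(\mathfrak{L},\cdot,[\cdot,\cdot])$, where $\mathfrak{L}$ is a vector space, $(\mathfrak{L},\cdot)$ is a commutative associative algebra (not necessarily unital), $(\mathfrak{L},[\cdot,\cdot])$ is a Lie algebra, and $2z\cdot[x,y]=[z\cdot x,y]+[x,z\cdot y]$ for all $x,y,z\in\mathfrak{L}$. Either operation is allowed to be zero. In multiplication tables, products $e_i\cdot e_j$ and brackets $[e_i,e_j]$ not determined by the listed ones via commutativity of $\cdot$ and anticommutativity of $[\cdot,\cdot]$ are zero. Let $\mathbb{V}$ be a complex vector space of dimension $n$ with a fixed basis $e_1,\dots,e_n$. A pair $(\mu,\mu')$ of bilinear maps $\mathbb{V}\times\mathbb{V}\to\mathbb{V}$ is identified with its structure constants $c_{ij}^k,c_{ij}'^k$, given by $\mu(e_i,e_j)=\sum_k c_{ij}^ke_k$ and $\mu'(e_i,e_j)=\sum_k c_{ij}'^ke_k$, i.e. with a point of the affine space $\mathbb{C}^{2n^3}$. $\mathcal{T}_n\subset\mathbb{C}^{2n^3}$ is the Zariski closed set of those pairs $(\mu,\mu')$ for which $(\mathbb{V},\mu,\mu')$ is a transposed Poisson algebra with $\cdot=\mu$ and $[\cdot,\cdot]=\mu'$. The group ${\rm GL}(\mathbb{V})$ acts on $\mathcal{T}_n$ by $(g*(\mu,\mu'))(x,y)=(g\mu(g^{-1}x,g^{-1}y),\,g\mu'(g^{-1}x,g^{-1}y))$.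 For an $n$-dimensional transposed Poisson algebra ${\rm T}$ represented by $(\mu,\mu')$, $O({\rm T})$ is the ${\rm GL}(\mathbb{V})$-orbit of $(\mu,\mu')$, i.e. the set of all structures on $\mathbb{V}$ isomorphic to ${\rm T}$. Closures are in the Zariski topology. An algebra is rigid in $\mathcal{T}_n$ if its orbit is open in $\mathcal{T}_n$; equivalently, the closure of its orbit is an irreducible component. *)

theory Defs
  imports "HOL-Analysis.Analysis"
begin

section \<open>Transposed Poisson algebras\<close>

locale commutative_associative_algebra = vector_space scale
  for scale :: "complex \<Rightarrow> 'v::ab_group_add \<Rightarrow> 'v"  (infixr \<open>*\<^sub>S\<close> 75) +
  fixes mult :: "'v \<Rightarrow> 'v \<Rightarrow> 'v"  (infixl \<open>\<bullet>\<^sub>A\<close> 70)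
  assumes mult_linear_right: "Vector_Spaces.linear scale scale (\<lambda>y. x \<bullet>\<^sub>A y)"
    and mult_linear_left: "Vector_Spaces.linear scale scale (\<lambda>x. x \<bullet>\<^sub>A y)"
    and mult_commute: "x \<bullet>\<^sub>A y = y \<bullet>\<^sub>A x"
    and mult_assoc: "(x \<bullet>\<^sub>A y) \<bullet>\<^sub>A z = x \<bullet>\<^sub>A (y \<bullet>\<^sub>A z)"

locale lie_algebra = vector_space scale
  for scale :: "complex \<Rightarrow> 'v::ab_group_add \<Rightarrow> 'v"  (infixr \<open>*\<^sub>S\<close> 75) +
  fixes bracket :: "'v \<Rightarrow> 'v \<Rightarrow> 'v"
  assumes bracket_linear_right: "Vector_Spaces.linear scale scale (\<lambda>y. bracket x y)"
    and bracket_linear_left: "Vector_Spaces.linear scale scale (\<lambda>x. bracket x y)"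
    and bracket_self: "bracket x x = 0"
    and jacobi: "bracket x (bracket y z) + bracket y (bracket z x) + bracket z (bracket x y) = 0"

locale transposed_poisson_algebra =
  commutative_associative_algebra scale mult + lie_algebra scale bracket
  for scale :: "complex \<Rightarrow> 'v::ab_group_add \<Rightarrow> 'v"  (infixr \<open>*\<^sub>S\<close> 75)
    and mult :: "'v \<Rightarrow> 'v \<Rightarrow> 'v"  (infixl \<open>\<bullet>\<^sub>A\<close> 70)
    and bracket :: "'v \<Rightarrow> 'v \<Rightarrow> 'v" +
  assumes transposed_leibniz: "2 *\<^sub>S (z \<bullet>\<^sub>A bracket x y) = bracket (z \<bullet>\<^sub>A x) y + bracket x (z \<bullet>\<^sub>A y)"

section \<open>The Zariski topology on affine space\<close>

inductive complex_polynomial_fun :: "(complex ^ 'm \<Rightarrow> complex) \<Rightarrow> bool" where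
  const: "complex_polynomial_fun (\<lambda>x. c)"
| coord: "complex_polynomial_fun (\<lambda>x. x $ i)"
| add: "complex_polynomial_fun p \<Longrightarrow> complex_polynomial_fun q \<Longrightarrow> complex_polynomial_fun (\<lambda>x. p x + q x)"
| mult: "complex_polynomial_fun p \<Longrightarrow> complex_polynomial_fun q \<Longrightarrow> complex_polynomial_fun (\<lambda>x. p x * q x)"

definition zero_locus :: "(complex ^ 'm \<Rightarrow> complex) set \<Rightarrow> (complex ^ 'm) set" where
  "zero_locus P = {x. \<forall>p\<in>P. p x = 0}"

definition zariski_closed :: "(complex ^ 'm) set \<Rightarrow> bool" where
  "zariski_closed S \<longleftrightarrow> (\<exists>P. (\<forall>p\<in>P. complex_polynomial_fun p) \<and> S = zero_locus P)"

definition zariski :: "(complex ^ 'm) topology" where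
  "zariski = topology (\<lambda>U. zariski_closed (- U))"

lemma zariski_closed_Inter:
  assumes "\<And>S. S \<in> \<S> \<Longrightarrow> zariski_closed S"
  shows "zariski_closed (\<Inter>\<S>)"
proof -
  obtain P where P: "\<And>S. S \<in> \<S> \<Longrightarrow> (\<forall>p\<in>P S. complex_polynomial_fun p) \<and> S = zero_locus (P S)"
    using assms unfolding zariski_closed_def by metis
  have "\<Inter>\<S> = zero_locus (\<Union>S\<in>\<S>. P S)"
  proof (intro set_eqI iffI)
    fix x assume "x \<in> \<Inter>\<S>"
    then have "x \<in> zero_locus (P S)" if "S \<in> \<S>" for S
      using P that by blast
    then show "x \<in> zero_locus (\<Union>S\<in>\<S>. P S)"
      by (auto simp: zero_locus_def)
  next
    fix x assume "x \<in> zero_locus (\<Union>S\<in>\<S>. P S)"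
    then have "x \<in> zero_locus (P S)" if "S \<in> \<S>" for S
      using that by (auto simp: zero_locus_def)
    then show "x \<in> \<Inter>\<S>"
      using P by blast
  qed
  then show ?thesis
    using P unfolding zariski_closed_def by blast
qed

lemma zariski_closed_Un:
  assumes "zariski_closed S" "zariski_closed T"
  shows "zariski_closed (S \<union> T)"
proof -
  obtain P Q where P: "\<forall>p\<in>P. complex_polynomial_fun p" "S = zero_locus P"
    and Q: "\<forall>q\<in>Q. complex_polynomial_fun q" "T = zero_locus Q"
    using assms unfolding zariski_closed_def by blast
  let ?R = "{\<lambda>x. p x * q x |p q. p \<in> P \<and> q \<in> Q}"
  have "\<forall>r\<in>?R. complex_polynomial_fun r"
    using P(1) Q(1) by (auto intro: complex_polynomial_fun.mult)
  moreover have "S \<union> T = zero_locus ?R"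
    unfolding P(2) Q(2) zero_locus_def by fastforce
  ultimately show ?thesis
    unfolding zariski_closed_def by blast
qed

lemma istopology_zariski: "istopology (\<lambda>U. zariski_closed (- U :: (complex ^ 'm) set))"
  unfolding istopology_def
proof safe
  fix U V :: "(complex ^ 'm) set"
  assume "zariski_closed (- U)" "zariski_closed (- V)"
  then show "zariski_closed (- (U \<inter> V))"
    using zariski_closed_Un[of "- U" "- V"] by simp
next
  fix \<K> :: "(complex ^ 'm) set set"
  assume "\<forall>K\<in>\<K>. zariski_closed (- K)"
  then show "zariski_closed (- \<Union>\<K>)"
    using zariski_closed_Inter[of "uminus ` \<K>"] by (auto simp: uminus_Sup)
qed

lemma openin_zariski: "openin zariski U \<longleftrightarrow> zariski_closed (- U)"
  by (simp add: zariski_def istopology_zariski)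

lemma topspace_zariski [simp]: "topspace zariski = UNIV"
proof -
  have "zariski_closed (- UNIV :: (complex ^ 'm) set)"
    unfolding zariski_closed_def zero_locus_def
    by (rule exI[of _ "{\<lambda>x. 1}"]) (auto intro: complex_polynomial_fun.const)
  then show ?thesis
    by (metis openin_zariski openin_subset top.extremum_unique)
qed

lemma closedin_zariski: "closedin zariski S \<longleftrightarrow> zariski_closed S"
  by (simp add: closedin_def openin_zariski Compl_eq_Diff_UNIV[symmetric])

section \<open>Irreducible components\<close>

definition irreducible_space :: "'a topology \<Rightarrow> bool" where
  "irreducible_space X \<longleftrightarrow> topspace X \<noteq> {} \<and>
    (\<forall>A B. closedin X A \<and> closedin X B \<and> topspace X = A \<union> B \<longrightarrow> A = topspace X \<or> B = topspace X)"

definition irreducible_components :: "'a topology \<Rightarrow> 'a set set" where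
  "irreducible_components X =
    {Z. Z \<subseteq> topspace X \<and> irreducible_space (subtopology X Z) \<and>
        (\<forall>W. W \<subseteq> topspace X \<and> irreducible_space (subtopology X W) \<and> Z \<subseteq> W \<longrightarrow> W = Z)}"

section \<open>The variety of transposed Poisson algebra structures\<close>

text \<open>
  The index type of the basis is \<^typ>\<open>'n\<close>, and \<^term>\<open>axis i 1\<close> is the \<open>i\<close>-th basis vector.
  In a point of affine space, the coordinate \<open>Inl (i, j, k)\<close> is the coefficient at the \<open>k\<close>-th
  basis vector of the product of the \<open>i\<close>-th and \<open>j\<close>-th basis vectors; \<open>Inr (i, j, k)\<close> is the
  same for the bracket.
\<close>

type_synonym 'n structure_constants = "complex ^ (('n \<times> 'n \<times> 'n) + ('n \<times> 'n \<times> 'n))"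

definition mult_of :: "'n::finite structure_constants \<Rightarrow> complex ^ 'n \<Rightarrow> complex ^ 'n \<Rightarrow> complex ^ 'n" where
  "mult_of c x y = (\<chi> k. \<Sum>i\<in>UNIV. \<Sum>j\<in>UNIV. x $ i * y $ j * c $ Inl (i, j, k))"

definition bracket_of :: "'n::finite structure_constants \<Rightarrow> complex ^ 'n \<Rightarrow> complex ^ 'n \<Rightarrow> complex ^ 'n" where
  "bracket_of c x y = (\<chi> k. \<Sum>i\<in>UNIV. \<Sum>j\<in>UNIV. x $ i * y $ j * c $ Inr (i, j, k))"

definition structure_constants_of ::
  "(complex ^ 'n \<Rightarrow> complex ^ 'n \<Rightarrow> complex ^ 'n) \<Rightarrow> (complex ^ 'n \<Rightarrow> complex ^ 'n \<Rightarrow> complex ^ 'n)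
    \<Rightarrow> 'n::finite structure_constants" where
  "structure_constants_of \<mu> \<mu>' =
    (\<chi> s. case s of Inl (i, j, k) \<Rightarrow> \<mu> (axis i 1) (axis j 1) $ k
                 | Inr (i, j, k) \<Rightarrow> \<mu>' (axis i 1) (axis j 1) $ k)"

definition tpa_variety :: "'n::finite structure_constants set" where
  "tpa_variety = {c. transposed_poisson_algebra (*s) (mult_of c) (bracket_of c)}"

definition gl_act :: "complex ^ 'n ^ 'n \<Rightarrow> 'n::finite structure_constants \<Rightarrow> 'n structure_constants" where
  "gl_act g c = structure_constants_of
     (\<lambda>x y. g *v mult_of c (matrix_inv g *v x) (matrix_inv g *v y))
     (\<lambda>x y. g *v bracket_of c (matrix_inv g *v x) (matrix_inv g *v y))"

definition gl_orbit :: "'n::finite structure_constants \<Rightarrow> 'n structure_constants set" where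
  "gl_orbit c = {gl_act g c | g. invertible g}"

definition tpa_rigid :: "'n::finite structure_constants \<Rightarrow> bool" where
  "tpa_rigid c \<longleftrightarrow> openin (subtopology zariski tpa_variety) (gl_orbit c)"

section \<open>Multiplication tables\<close>

text \<open>
  A table lists the products of some pairs of basis vectors. Unlisted products are obtained by
  commutativity (of the product) or anticommutativity (of the bracket) if the opposite pair is
  listed, and are zero otherwise.
\<close>

type_synonym 'n product_table = "'n \<times> 'n \<rightharpoonup> complex ^ 'n"

definition table_mult :: "'n product_table \<Rightarrow> 'n \<Rightarrow> 'n \<Rightarrow> complex ^ 'n" where
  "table_mult t i j =
    (case t (i, j) of Some v \<Rightarrow> v | None \<Rightarrow> (case t (j, i) of Some v \<Rightarrow> v | None \<Rightarrow> 0))"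

definition table_bracket :: "'n product_table \<Rightarrow> 'n \<Rightarrow> 'n \<Rightarrow> complex ^ 'n" where
  "table_bracket t i j =
    (case t (i, j) of Some v \<Rightarrow> v | None \<Rightarrow> (case t (j, i) of Some v \<Rightarrow> - v | None \<Rightarrow> 0))"

definition from_tables :: "'n product_table \<Rightarrow> 'n product_table \<Rightarrow> 'n::finite structure_constants" where
  "from_tables m b =
    (\<chi> s. case s of Inl (i, j, k) \<Rightarrow> table_mult m i j $ k
                 | Inr (i, j, k) \<Rightarrow> table_bracket b i j $ k)"

text \<open>
  In the three-element type \<^typ>\<open>3\<close> the numerals 1, 2, 3 are distinct (with \<open>3 = 0\<close>), and they
  serve as the indices of the three basis vectors.
\<close>

abbreviation e :: "3 \<Rightarrow> complex ^ 3" where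
  "e i \<equiv> axis i 1"

definition T01 :: "3 structure_constants" where
  "T01 = from_tables Map.empty [(1, 2) \<mapsto> e 3, (1, 3) \<mapsto> - e 2, (2, 3) \<mapsto> e 1]"

definition T20 :: "3 structure_constants" where
  "T20 = from_tables [(1, 1) \<mapsto> e 1, (2, 2) \<mapsto> e 2, (3, 3) \<mapsto> e 3] Map.empty"

definition T09 :: "complex \<Rightarrow> complex \<Rightarrow> 3 structure_constants" where
  "T09 \<alpha> \<beta> = from_tables
     [(1, 3) \<mapsto> \<beta> *s e 1, (2, 3) \<mapsto> \<beta> *s e 2, (3, 3) \<mapsto> \<beta> *s e 3]
     [(1, 3) \<mapsto> e 1 + e 2, (2, 3) \<mapsto> \<alpha> *s e 2]"

definition T12 :: "complex \<Rightarrow> 3 structure_constants" where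
  "T12 \<beta> = from_tables
     [(1, 1) \<mapsto> e 2, (1, 3) \<mapsto> \<beta> *s e 1, (2, 3) \<mapsto> \<beta> *s e 2, (3, 3) \<mapsto> \<beta> *s e 3]
     [(1, 3) \<mapsto> e 1 + e 2, (2, 3) \<mapsto> 2 *s e 2]"

definition T17 :: "complex \<Rightarrow> 3 structure_constants" where
  "T17 \<beta> = from_tables
     [(1, 1) \<mapsto> e 2, (1, 2) \<mapsto> - e 2, (1, 3) \<mapsto> \<beta> *s e 1, (2, 2) \<mapsto> e 2, (2, 3) \<mapsto> \<beta> *s e 2,
      (3, 3) \<mapsto> \<beta> *s e 3]
     [(1, 3) \<mapsto> e 1 + e 2]"

end

theory Submission
  imports Defs "HOL-Computational_Algebra.Fundamental_Theorem_Algebra"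
begin

text \<open>
  A Zariski closed set is closed in the Euclidean topology, so a degeneration can be exhibited as a
  limit. Each orbit closure of a family is irreducible because the parameter space
  \<open>GL\<^sub>3 \<times> \<complex>\<^sup>k\<close> contains, up to finitely many points, the line through any two of its points, and a
  product of two polynomials in one variable vanishes only if one factor does.

  To see that the five closures cover everything, view the bracket as a linear map from
  \<open>\<Lambda>\<^sup>2 V\<close> to \<open>V\<close>. If it is invertible, then it is a symmetric matrix in the standard basis, an
  orthonormal basis for its adjugate form turns the algebra into \<open>so\<^sub>3\<close>, and the product vanishes
  because the half-derivations of \<open>so\<^sub>3\<close> are scalars. Otherwise there is a basis with
  \<open>[e\<^sub>1, e\<^sub>2] = 0\<close>, \<open>[e\<^sub>1, e\<^sub>3] = m\<^sub>1 e\<^sub>1 + n e\<^sub>2\<close> and \<open>[e\<^sub>2, e\<^sub>3] = m\<^sub>2 e\<^sub>2\<close>. The products that are compatible with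
  this bracket form one family for generic \<open>m\<^sub>1, m\<^sub>2\<close>, and larger ones, cut out by a single
  quadric of rank-one matrices, if one eigenvalue is twice the other (or both vanish) or if exactly one eigenvalue vanishes.
  If the bracket is zero, a flag of ideals leads to these families again or to
  a degeneration of \<open>\<complex>\<^sup>3\<close>.

  The components are told apart by closed conditions: on \<open>[[x, y], [z, w]]\<close>, on the ratio of
  \<open>tr (ad x)\<^sup>2\<close> to \<open>(tr ad x)\<^sup>2\<close>, and on the eigenvalues of multiplications.
\<close>

section \<open>Change of basis\<close>

text \<open>The transposed Leibniz rule says that every multiplication L is a half-derivation: 2
  L[x, y] = [Lx, y] + [x, Ly]. This is linear in L, so the bracket is normalised first and the shape
  of all multiplications is read off by comparing coefficients. An entry of L from an eigenvector
  with eigenvalue m1 to one with eigenvalue m2 carries the factor 2 m1 - m2, and a diagonal entry is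
  tied to the action on e_3 only through a factor m1 or m2. Hence the exceptional ratio 2 and the
  exceptional eigenvalue 0, the sources of \<open>T12\<close> and \<open>T17\<close>. The obstacle
  to the limits is that the exceptional tables satisfy a quadric: changing single entries in general
  destroys associativity. Reading the quadric as a singular 2 by 2 matrix and perturbing the factors
  of its rank-one decomposition stays on it. \<open>T20\<close> is the one algebra that is not kept
  out of the other closures by a closed condition on them; its rigidity does this instead.\<close>

lemma mult_of_add_left: "mult_of c (x + x') y = mult_of c x y + mult_of c x' y"
  by (simp add: mult_of_def vec_eq_iff algebra_simps sum.distrib)

lemma mult_of_add_right: "mult_of c x (y + y') = mult_of c x y + mult_of c x y'"
  by (simp add: mult_of_def vec_eq_iff algebra_simps sum.distrib)

lemma mult_of_scale_left: "mult_of c (r *s x) y = r *s mult_of c x y"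
  by (simp add: mult_of_def vec_eq_iff algebra_simps sum_distrib_left)

lemma mult_of_scale_right: "mult_of c x (r *s y) = r *s mult_of c x y"
  by (simp add: mult_of_def vec_eq_iff algebra_simps sum_distrib_left)

lemma bracket_of_add_left: "bracket_of c (x + x') y = bracket_of c x y + bracket_of c x' y"
  by (simp add: bracket_of_def vec_eq_iff algebra_simps sum.distrib)

lemma bracket_of_add_right: "bracket_of c x (y + y') = bracket_of c x y + bracket_of c x y'"
  by (simp add: bracket_of_def vec_eq_iff algebra_simps sum.distrib)

lemma bracket_of_scale_left: "bracket_of c (r *s x) y = r *s bracket_of c x y"
  by (simp add: bracket_of_def vec_eq_iff algebra_simps sum_distrib_left)

lemma bracket_of_scale_right: "bracket_of c x (r *s y) = r *s bracket_of c x y"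
  by (simp add: bracket_of_def vec_eq_iff algebra_simps sum_distrib_left)

lemmas bilinear_simps =
  mult_of_add_left mult_of_add_right mult_of_scale_left mult_of_scale_right
  bracket_of_add_left bracket_of_add_right bracket_of_scale_left bracket_of_scale_right

lemma linear_scaleI:
  fixes f :: "complex ^ 'n \<Rightarrow> complex ^ 'm"
  assumes "\<And>x y. f (x + y) = f x + f y" "\<And>r x. f (r *s x) = r *s f x"
  shows "Vector_Spaces.linear (*s) (*s) f"
  by unfold_locales (use assms in \<open>auto simp: vec.scale_right_distrib vec.scale_left_distrib\<close>)

lemma tpa_variety_iff:
  "c \<in> tpa_variety \<longleftrightarrow>
    (\<forall>x y. mult_of c x y = mult_of c y x) \<and>
    (\<forall>x y z. mult_of c (mult_of c x y) z = mult_of c x (mult_of c y z)) \<and>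
    (\<forall>x. bracket_of c x x = 0) \<and>
    (\<forall>x y z. bracket_of c x (bracket_of c y z) + bracket_of c y (bracket_of c z x)
        + bracket_of c z (bracket_of c x y) = 0) \<and>
    (\<forall>x y z. 2 *s mult_of c z (bracket_of c x y)
        = bracket_of c (mult_of c z x) y + bracket_of c x (mult_of c z y))" (is "?L \<longleftrightarrow> ?R")
proof
  assume ?L
  then interpret transposed_poisson_algebra "(*s)" "mult_of c" "bracket_of c"
    by (simp add: tpa_variety_def)
  show ?R
    using mult_commute mult_assoc bracket_self jacobi transposed_leibniz by blast
next
  assume ?R
  then show ?L
    unfolding tpa_variety_def
    by (intro CollectI, unfold_locales)
      (auto intro!: linear_scaleI simp: bilinear_simps vec.scale_right_distrib vec.scale_left_distrib)
qed

lemma tpa_varietyD: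
  assumes "c \<in> tpa_variety"
  shows "mult_of c x y = mult_of c y x"
    and "mult_of c (mult_of c x y) z = mult_of c x (mult_of c y z)"
    and "bracket_of c x x = 0"
    and "bracket_of c x (bracket_of c y z) + bracket_of c y (bracket_of c z x)
        + bracket_of c z (bracket_of c x y) = 0"
    and "2 *s mult_of c z (bracket_of c x y)
        = bracket_of c (mult_of c z x) y + bracket_of c x (mult_of c z y)"
  using assms unfolding tpa_variety_iff by blast+

lemma tpa_bracket_swap:
  assumes "c \<in> tpa_variety"
  shows "bracket_of c y x = - bracket_of c x y"
proof -
  have "bracket_of c (x + y) (x + y) = 0"
    using assms by (rule tpa_varietyD)
  then have "bracket_of c y x + bracket_of c x y = 0"
    by (simp add: bilinear_simps tpa_varietyD(3)[OF assms])
  then show ?thesis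
    by (simp add: eq_neg_iff_add_eq_0)
qed

lemma mult_of_axis: "mult_of c (axis i 1) (axis j 1) $ k = c $ Inl (i, j, k)"
proof -
  have "mult_of c (axis i 1) (axis j 1) $ k =
      (\<Sum>i'\<in>UNIV. axis i 1 $ i' * (\<Sum>j'\<in>UNIV. axis j 1 $ j' * c $ Inl (i', j', k)))"
    by (simp add: mult_of_def sum_distrib_left mult.assoc)
  then show ?thesis
    by (simp add: axis_def if_distrib[where f="\<lambda>x. x * _"] cong: if_cong)
qed

lemma bracket_of_axis: "bracket_of c (axis i 1) (axis j 1) $ k = c $ Inr (i, j, k)"
proof -
  have "bracket_of c (axis i 1) (axis j 1) $ k =
      (\<Sum>i'\<in>UNIV. axis i 1 $ i' * (\<Sum>j'\<in>UNIV. axis j 1 $ j' * c $ Inr (i', j', k)))"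
    by (simp add: bracket_of_def sum_distrib_left mult.assoc)
  then show ?thesis
    by (simp add: axis_def if_distrib[where f="\<lambda>x. x * _"] cong: if_cong)
qed

lemma structure_constants_eqI:
  assumes "\<And>i j. mult_of c (axis i 1) (axis j 1) = mult_of d (axis i 1) (axis j 1)"
    and "\<And>i j. bracket_of c (axis i 1) (axis j 1) = bracket_of d (axis i 1) (axis j 1)"
  shows "c = d"
proof -
  have "c $ s = d $ s" for s
  proof (cases s)
    case (Inl t)
    then show ?thesis
      using assms(1) by (cases t) (metis mult_of_axis)
  next
    case (Inr t)
    then show ?thesis
      using assms(2) by (cases t) (metis bracket_of_axis)
  qed
  then show ?thesis
    by (simp add: vec_eq_iff)
qed

lemma bilinear_expand:
  fixes f :: "complex ^ 'n \<Rightarrow> complex ^ 'n \<Rightarrow> complex ^ 'n"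
  assumes "\<And>y. Vector_Spaces.linear (*s) (*s) (\<lambda>x. f x y)"
    and "\<And>x. Vector_Spaces.linear (*s) (*s) (f x)"
  shows "f x y = (\<Sum>i\<in>UNIV. \<Sum>j\<in>UNIV. (x $ i * y $ j) *s f (axis i 1) (axis j 1))"
proof -
  have "f x y = f (\<Sum>i\<in>UNIV. x $ i *s axis i 1) y"
    by (simp add: basis_expansion)
  also have "\<dots> = (\<Sum>i\<in>UNIV. x $ i *s f (axis i 1) y)"
    by (simp add: vec.linear_sum[OF assms(1)] vec.linear_scale[OF assms(1)])
  also have "\<dots> = (\<Sum>i\<in>UNIV. x $ i *s f (axis i 1) (\<Sum>j\<in>UNIV. y $ j *s axis j 1))"
    by (simp add: basis_expansion)
  also have "\<dots> = (\<Sum>i\<in>UNIV. \<Sum>j\<in>UNIV. x $ i *s (y $ j *s f (axis i 1) (axis j 1)))"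
    by (simp only: vec.linear_sum[OF assms(2)] vec.linear_scale[OF assms(2)] vec.scale_sum_right)
  finally show ?thesis
    by (simp add: vector_smult_assoc)
qed

lemma mult_of_gl_act: "mult_of (gl_act g c) x y = g *v mult_of c (matrix_inv g *v x) (matrix_inv g *v y)"
proof -
  have "mult_of (gl_act g c) x y =
      (\<Sum>i\<in>UNIV. \<Sum>j\<in>UNIV. (x $ i * y $ j) *s mult_of (gl_act g c) (axis i 1) (axis j 1))"
    by (rule bilinear_expand; rule linear_scaleI; simp add: bilinear_simps)
  also have "\<dots> = (\<Sum>i\<in>UNIV. \<Sum>j\<in>UNIV. (x $ i * y $ j) *s
      (g *v mult_of c (matrix_inv g *v axis i 1) (matrix_inv g *v axis j 1)))"
    by (intro sum.cong refl arg_cong2[where f="(*s)"])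
      (simp add: vec_eq_iff mult_of_axis, simp add: gl_act_def structure_constants_of_def)
  also have "\<dots> = g *v mult_of c (matrix_inv g *v x) (matrix_inv g *v y)"
    by (rule bilinear_expand[symmetric]; rule linear_scaleI;
        simp add: bilinear_simps matrix_vector_right_distrib vector_scalar_commute)
  finally show ?thesis .
qed

lemma bracket_of_gl_act:
  "bracket_of (gl_act g c) x y = g *v bracket_of c (matrix_inv g *v x) (matrix_inv g *v y)"
proof -
  have "bracket_of (gl_act g c) x y =
      (\<Sum>i\<in>UNIV. \<Sum>j\<in>UNIV. (x $ i * y $ j) *s bracket_of (gl_act g c) (axis i 1) (axis j 1))"
    by (rule bilinear_expand; rule linear_scaleI; simp add: bilinear_simps)
  also have "\<dots> = (\<Sum>i\<in>UNIV. \<Sum>j\<in>UNIV. (x $ i * y $ j) *s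
      (g *v bracket_of c (matrix_inv g *v axis i 1) (matrix_inv g *v axis j 1)))"
    by (intro sum.cong refl arg_cong2[where f="(*s)"])
      (simp add: vec_eq_iff bracket_of_axis, simp add: gl_act_def structure_constants_of_def)
  also have "\<dots> = g *v bracket_of c (matrix_inv g *v x) (matrix_inv g *v y)"
    by (rule bilinear_expand[symmetric]; rule linear_scaleI;
        simp add: bilinear_simps matrix_vector_right_distrib vector_scalar_commute)
  finally show ?thesis .
qed

lemma
  fixes g :: "complex ^ 'n ^ 'n"
  assumes "invertible g"
  shows matrix_inv_right: "g ** matrix_inv g = mat 1"
    and matrix_inv_left: "matrix_inv g ** g = mat 1"
  using someI_ex[OF assms[unfolded invertible_def]] unfolding matrix_inv_def by blast+

lemma invertible_mat_1: "invertible (mat 1 :: complex ^ 'n ^ 'n)"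
  unfolding invertible_def by (rule exI[of _ "mat 1"]) simp

lemma matrix_inv_vector:
  fixes g :: "complex ^ 'n ^ 'n"
  assumes "invertible g"
  shows "g *v (matrix_inv g *v x) = x" "matrix_inv g *v (g *v x) = x"
  using assms by (simp_all add: matrix_vector_mul_assoc matrix_inv_left matrix_inv_right)

lemma matrix_inv_unique':
  fixes g :: "complex ^ 'n ^ 'n"
  assumes "g ** h = mat 1"
  shows "invertible g" "matrix_inv g = h"
proof -
  have "h ** g = mat 1"
    using assms by (simp add: matrix_left_right_inverse)
  then show g: "invertible g"
    using assms invertible_def by blast
  have "matrix_inv g = matrix_inv g ** (g ** h)"
    by (simp add: assms)
  also have "\<dots> = h"
    by (simp only: matrix_mul_assoc matrix_inv_left[OF g] matrix_mul_lid)
  finally show "matrix_inv g = h" .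
qed

text \<open>By bilinearity it is enough that \<open>g\<close> intertwines the two structures on
  basis vectors. In this form an isomorphism is checked without computing
  \<open>matrix_inv g\<close>.\<close>

lemma gl_act_eqI:
  assumes g: "invertible g"
    and "\<And>i j. mult_of c (g *v axis i 1) (g *v axis j 1) = g *v mult_of d (axis i 1) (axis j 1)"
    and "\<And>i j. bracket_of c (g *v axis i 1) (g *v axis j 1) = g *v bracket_of d (axis i 1) (axis j 1)"
  shows "c = gl_act g d"
proof -
  have m: "mult_of c (g *v x) (g *v y) = g *v mult_of d x y" for x y
  proof -
    have "mult_of c (g *v x) (g *v y) =
      (\<Sum>i\<in>UNIV. \<Sum>j\<in>UNIV. (x $ i * y $ j) *s mult_of c (g *v axis i 1) (g *v axis j 1))"
      by (rule bilinear_expand[of "\<lambda>x y. mult_of c (g *v x) (g *v y)"]; rule linear_scaleI;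
          simp add: bilinear_simps matrix_vector_right_distrib vector_scalar_commute)
    also have "\<dots> = (\<Sum>i\<in>UNIV. \<Sum>j\<in>UNIV. (x $ i * y $ j) *s (g *v mult_of d (axis i 1) (axis j 1)))"
      by (simp add: assms)
    also have "\<dots> = g *v mult_of d x y"
      by (rule bilinear_expand[of "\<lambda>x y. g *v mult_of d x y", symmetric]; rule linear_scaleI;
          simp add: bilinear_simps matrix_vector_right_distrib vector_scalar_commute)
    finally show ?thesis .
  qed
  have b: "bracket_of c (g *v x) (g *v y) = g *v bracket_of d x y" for x y
  proof -
    have "bracket_of c (g *v x) (g *v y) =
      (\<Sum>i\<in>UNIV. \<Sum>j\<in>UNIV. (x $ i * y $ j) *s bracket_of c (g *v axis i 1) (g *v axis j 1))"
      by (rule bilinear_expand[of "\<lambda>x y. bracket_of c (g *v x) (g *v y)"]; rule linear_scaleI;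
          simp add: bilinear_simps matrix_vector_right_distrib vector_scalar_commute)
    also have "\<dots> = (\<Sum>i\<in>UNIV. \<Sum>j\<in>UNIV. (x $ i * y $ j) *s (g *v bracket_of d (axis i 1) (axis j 1)))"
      by (simp add: assms)
    also have "\<dots> = g *v bracket_of d x y"
      by (rule bilinear_expand[of "\<lambda>x y. g *v bracket_of d x y", symmetric]; rule linear_scaleI;
          simp add: bilinear_simps matrix_vector_right_distrib vector_scalar_commute)
    finally show ?thesis .
  qed
  show ?thesis
    using m[of "matrix_inv g *v _" "matrix_inv g *v _"] b[of "matrix_inv g *v _" "matrix_inv g *v _"]
    by (intro structure_constants_eqI)
      (simp_all only: mult_of_gl_act bracket_of_gl_act matrix_inv_vector[OF g])
qed

lemma gl_act_one [simp]: "gl_act (mat 1) c = c"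
  by (rule gl_act_eqI[symmetric]) (auto simp: invertible_mat_1)

lemma gl_act_compose:
  assumes "invertible g" "invertible h"
  shows "gl_act g (gl_act h c) = gl_act (g ** h) c"
proof -
  have "matrix_inv (g ** h) = matrix_inv h ** matrix_inv g"
    using assms by (intro matrix_inv_unique') (metis matrix_mul_assoc matrix_mul_lid matrix_inv_right)
  then show ?thesis
    by (intro structure_constants_eqI)
      (simp_all add: mult_of_gl_act bracket_of_gl_act flip: matrix_vector_mul_assoc)
qed

lemma invertible_matrix_inv: "invertible g \<Longrightarrow> invertible (matrix_inv (g :: complex ^ 'n ^ 'n))"
  by (meson invertible_def matrix_inv_left matrix_inv_right)

lemma gl_act_inverse:
  assumes "invertible g"
  shows "gl_act (matrix_inv g) (gl_act g c) = c" "gl_act g (gl_act (matrix_inv g) c) = c"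
  using assms
  by (simp_all add: gl_act_compose invertible_matrix_inv matrix_inv_left matrix_inv_right)

lemma gl_orbit_refl: "c \<in> gl_orbit c"
  unfolding gl_orbit_def by (intro CollectI exI[of _ "mat 1"]) (simp add: invertible_mat_1)

lemma gl_act_gl_orbit:
  assumes "invertible g" "d \<in> gl_orbit c"
  shows "gl_act g d \<in> gl_orbit c"
proof -
  obtain h where h: "invertible h" "d = gl_act h c"
    using assms(2) unfolding gl_orbit_def by blast
  then show ?thesis
    unfolding gl_orbit_def using assms(1)
    by (intro CollectI exI[of _ "g ** h"]) (simp add: gl_act_compose invertible_mult)
qed

lemma tpa_variety_gl_act:
  assumes "invertible g" "c \<in> tpa_variety"
  shows "gl_act g c \<in> tpa_variety"
proof -
  note c = tpa_varietyD[OF assms(2)]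
  have "bracket_of c x (bracket_of c y z) + (bracket_of c y (bracket_of c z x)
        + bracket_of c z (bracket_of c x y)) = 0" for x y z
    using c(4) by (simp only: add.assoc)
  then show ?thesis
    unfolding tpa_variety_iff mult_of_gl_act bracket_of_gl_act matrix_inv_vector[OF assms(1)]
      matrix_vector_right_distrib[symmetric] vector_scalar_commute[symmetric] c(5)[symmetric] c(2)
    by (simp add: c(1,3,4))
qed

lemma gl_orbit_subset_tpa: "c \<in> tpa_variety \<Longrightarrow> gl_orbit c \<subseteq> tpa_variety"
  unfolding gl_orbit_def by (auto intro: tpa_variety_gl_act)

section \<open>Three-dimensional structures\<close>

definition nf :: "complex ^ 3 \<Rightarrow> complex ^ 3 \<Rightarrow> complex ^ 3 \<Rightarrow> complex ^ 3 \<Rightarrow> complex ^ 3 \<Rightarrow> complex ^ 3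
    \<Rightarrow> complex ^ 3 \<Rightarrow> complex ^ 3 \<Rightarrow> complex ^ 3 \<Rightarrow> 3 structure_constants" where
  "nf a11 a12 a13 a22 a23 a33 b12 b13 b23 = from_tables
     [(1, 1) \<mapsto> a11, (1, 2) \<mapsto> a12, (1, 3) \<mapsto> a13, (2, 2) \<mapsto> a22, (2, 3) \<mapsto> a23, (3, 3) \<mapsto> a33]
     [(1, 2) \<mapsto> b12, (1, 3) \<mapsto> b13, (2, 3) \<mapsto> b23]"

definition cols :: "complex ^ 3 \<Rightarrow> complex ^ 3 \<Rightarrow> complex ^ 3 \<Rightarrow> complex ^ 3 ^ 3" where
  "cols u v w = (\<chi> i j. if j = 1 then u $ i else if j = 2 then v $ i else w $ i)"

lemma axis_component: "axis i x $ j = (if j = i then x else 0)"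
  by (simp add: axis_def)

lemma cols_mult: "cols u v w *v x = x $ 1 *s u + x $ 2 *s v + x $ 3 *s w"
  by (simp add: cols_def matrix_vector_mult_def sum_3 vec_eq_iff)

lemma cols_axis [simp]:
  "cols u v w *v axis 1 1 = u" "cols u v w *v axis 2 1 = v" "cols u v w *v axis 3 1 = w"
  by (simp_all add: cols_mult axis_def)

lemma invertible_cols_iff:
  "invertible (cols u v w) \<longleftrightarrow>
    (\<forall>a b c. a *s u + b *s v + c *s w = 0 \<longrightarrow> a = 0 \<and> b = 0 \<and> c = 0)"
proof -
  have "invertible (cols u v w) \<longleftrightarrow> (\<forall>x. cols u v w *v x = 0 \<longrightarrow> x = 0)"
    by (simp add: invertible_left_inverse matrix_left_invertible_ker)
  also have "\<dots> \<longleftrightarrow> (\<forall>a b c. a *s u + b *s v + c *s w = 0 \<longrightarrow> a = 0 \<and> b = 0 \<and> c = 0)"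
    by (simp add: forall_vector_3 cols_mult vec_eq_iff[of "vector _"] forall_3)
  finally show ?thesis .
qed

lemma det_cols:
  "det (cols u v w) = u$1 * (v$2 * w$3 - v$3 * w$2) - v$1 * (u$2 * w$3 - u$3 * w$2)
     + w$1 * (u$2 * v$3 - u$3 * v$2)"
  by (simp add: det_3 cols_def algebra_simps)

lemma mult_of_nf:
  "mult_of (nf a11 a12 a13 a22 a23 a33 b12 b13 b23) x y =
     (x$1 * y$1) *s a11 + (x$1 * y$2 + x$2 * y$1) *s a12 + (x$1 * y$3 + x$3 * y$1) *s a13
     + (x$2 * y$2) *s a22 + (x$2 * y$3 + x$3 * y$2) *s a23 + (x$3 * y$3) *s a33"
  by (simp add: vec_eq_iff mult_of_def nf_def from_tables_def table_mult_def sum_3 algebra_simps)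

lemma bracket_of_nf:
  "bracket_of (nf a11 a12 a13 a22 a23 a33 b12 b13 b23) x y =
     (x$1 * y$2 - x$2 * y$1) *s b12 + (x$1 * y$3 - x$3 * y$1) *s b13 + (x$2 * y$3 - x$3 * y$2) *s b23"
  by (simp add: vec_eq_iff bracket_of_def nf_def from_tables_def table_bracket_def sum_3 algebra_simps)

text \<open>The two symmetries suffice for a change of basis into normal form, and every \<open>nf\<close> has them by
  construction, even before it is known to satisfy the other axioms.\<close>

definition sym_alt :: "3 structure_constants \<Rightarrow> bool" where
  "sym_alt c \<longleftrightarrow> (\<forall>x y. mult_of c x y = mult_of c y x) \<and> (\<forall>x y. bracket_of c x y = - bracket_of c y x)"

lemma sym_alt_nf [simp]: "sym_alt (nf a11 a12 a13 a22 a23 a33 b12 b13 b23)"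
  by (simp add: sym_alt_def mult_of_nf bracket_of_nf vec_eq_iff algebra_simps)

lemma sym_alt_tpa: "c \<in> tpa_variety \<Longrightarrow> sym_alt c"
  unfolding sym_alt_def using tpa_varietyD(1) tpa_bracket_swap by blast

text \<open>Reads off the table of \<open>c\<close> in the basis \<open>v1\<close>,
  \<open>v2\<close>, \<open>v3\<close>: each argument of \<open>nf\<close> holds the coordinates of
  one product or bracket, and \<open>sym_alt\<close> supplies the entries not listed.\<close>

lemma gl_act_nf:
  assumes c: "sym_alt c" and inv: "invertible (cols v1 v2 v3)"
    and m: "mult_of c v1 v1 = cols v1 v2 v3 *v a11" "mult_of c v1 v2 = cols v1 v2 v3 *v a12"
      "mult_of c v1 v3 = cols v1 v2 v3 *v a13" "mult_of c v2 v2 = cols v1 v2 v3 *v a22"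
      "mult_of c v2 v3 = cols v1 v2 v3 *v a23" "mult_of c v3 v3 = cols v1 v2 v3 *v a33"
    and b: "bracket_of c v1 v2 = cols v1 v2 v3 *v b12" "bracket_of c v1 v3 = cols v1 v2 v3 *v b13"
      "bracket_of c v2 v3 = cols v1 v2 v3 *v b23"
  shows "c = gl_act (cols v1 v2 v3) (nf a11 a12 a13 a22 a23 a33 b12 b13 b23)"
proof -
  have s: "mult_of c x y = mult_of c y x" "bracket_of c x y = - bracket_of c y x" for x y
    using c unfolding sym_alt_def by blast+
  have s0: "bracket_of c x x = 0" for x
    using s(2)[of x x] by (simp add: vec_eq_iff)
  have neg: "cols v1 v2 v3 *v (- x) = - (cols v1 v2 v3 *v x)" for x
    by (simp add: cols_mult vec_eq_iff)
  show ?thesis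
  proof (rule gl_act_eqI[OF inv])
    fix i j :: 3
    have "i = 1 \<or> i = 2 \<or> i = 3" "j = 1 \<or> j = 2 \<or> j = 3"
      by (rule exhaust_3)+
    then show "mult_of c (cols v1 v2 v3 *v axis i 1) (cols v1 v2 v3 *v axis j 1) = cols v1 v2 v3 *v
        mult_of (nf a11 a12 a13 a22 a23 a33 b12 b13 b23) (axis i 1) (axis j 1)"
      by (elim disjE; simp add: mult_of_nf m axis_component s(1)[of v2 v1] s(1)[of v3 v1] s(1)[of v3 v2])
    from \<open>i = 1 \<or> i = 2 \<or> i = 3\<close> \<open>j = 1 \<or> j = 2 \<or> j = 3\<close>
    show "bracket_of c (cols v1 v2 v3 *v axis i 1) (cols v1 v2 v3 *v axis j 1) = cols v1 v2 v3 *v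
        bracket_of (nf a11 a12 a13 a22 a23 a33 b12 b13 b23) (axis i 1) (axis j 1)"
      by (elim disjE; simp add: bracket_of_nf b axis_component s0 neg
          s(2)[of v2 v1] s(2)[of v3 v1] s(2)[of v3 v2])
  qed
qed

section \<open>The five algebras of the statement as normal forms\<close>

lemma T01_nf: "T01 = nf 0 0 0 0 0 0 (vector [0,0,1]) (vector [0,-1,0]) (vector [1,0,0])"
  by (intro structure_constants_eqI; unfold mult_of_nf bracket_of_nf;
    simp add: vec_eq_iff forall_3 T01_def mult_of_def bracket_of_def sum_3 axis_component
      from_tables_def table_mult_def table_bracket_def algebra_simps)

lemma T20_nf: "T20 = nf (vector [1,0,0]) 0 0 (vector [0,1,0]) 0 (vector [0,0,1]) 0 0 0"
  by (intro structure_constants_eqI; unfold mult_of_nf bracket_of_nf;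
    simp add: vec_eq_iff forall_3 T20_def mult_of_def bracket_of_def sum_3 axis_component
      from_tables_def table_mult_def table_bracket_def algebra_simps)

lemma T09_nf: "T09 \<alpha> \<beta> = nf 0 0 (vector [\<beta>,0,0]) 0 (vector [0,\<beta>,0]) (vector [0,0,\<beta>])
    0 (vector [1,1,0]) (vector [0,\<alpha>,0])"
  by (intro structure_constants_eqI; unfold mult_of_nf bracket_of_nf;
    simp add: vec_eq_iff forall_3 T09_def mult_of_def bracket_of_def sum_3 axis_component
      from_tables_def table_mult_def table_bracket_def algebra_simps)

lemma T12_nf: "T12 \<beta> = nf (vector [0,1,0]) 0 (vector [\<beta>,0,0]) 0 (vector [0,\<beta>,0]) (vector [0,0,\<beta>])
    0 (vector [1,1,0]) (vector [0,2,0])"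
  by (intro structure_constants_eqI; unfold mult_of_nf bracket_of_nf;
    simp add: vec_eq_iff forall_3 T12_def mult_of_def bracket_of_def sum_3 axis_component
      from_tables_def table_mult_def table_bracket_def algebra_simps)

lemma T17_nf: "T17 \<beta> = nf (vector [0,1,0]) (vector [0,-1,0]) (vector [\<beta>,0,0]) (vector [0,1,0])
    (vector [0,\<beta>,0]) (vector [0,0,\<beta>]) 0 (vector [1,1,0]) 0"
  by (intro structure_constants_eqI; unfold mult_of_nf bracket_of_nf;
    simp add: vec_eq_iff forall_3 T17_def mult_of_def bracket_of_def sum_3 axis_component
      from_tables_def table_mult_def table_bracket_def algebra_simps)

lemma T01_tpa: "T01 \<in> tpa_variety"
  unfolding T01_nf tpa_variety_iff
  by (simp add: mult_of_nf bracket_of_nf vec_eq_iff forall_3 algebra_simps)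

lemma T20_tpa: "T20 \<in> tpa_variety"
  unfolding T20_nf tpa_variety_iff
  by (simp add: mult_of_nf bracket_of_nf vec_eq_iff forall_3 algebra_simps)

lemma T09_tpa: "T09 \<alpha> \<beta> \<in> tpa_variety"
  unfolding T09_nf tpa_variety_iff
  by (simp add: mult_of_nf bracket_of_nf vec_eq_iff forall_3 algebra_simps)

lemma T12_tpa: "T12 \<beta> \<in> tpa_variety"
  unfolding T12_nf tpa_variety_iff
  by (simp add: mult_of_nf bracket_of_nf vec_eq_iff forall_3 algebra_simps)

lemma T17_tpa: "T17 \<beta> \<in> tpa_variety"
  unfolding T17_nf tpa_variety_iff
  by (simp add: mult_of_nf bracket_of_nf vec_eq_iff forall_3 algebra_simps)

section \<open>Polynomial functions and irreducibility\<close>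

named_theorems poly_fun_intros

declare complex_polynomial_fun.intros [poly_fun_intros]

lemma poly_fun_minus [poly_fun_intros]:
  "complex_polynomial_fun p \<Longrightarrow> complex_polynomial_fun (\<lambda>x. - p x)"
  using complex_polynomial_fun.mult[OF complex_polynomial_fun.const[of "-1"], of p] by simp

lemma poly_fun_diff [poly_fun_intros]:
  "complex_polynomial_fun p \<Longrightarrow> complex_polynomial_fun q \<Longrightarrow> complex_polynomial_fun (\<lambda>x. p x - q x)"
  using complex_polynomial_fun.add[OF _ poly_fun_minus, of p q] by simp

lemma poly_fun_power [poly_fun_intros]:
  "complex_polynomial_fun p \<Longrightarrow> complex_polynomial_fun (\<lambda>x. p x ^ n)"
  by (induction n) (auto intro: poly_fun_intros)

lemma poly_fun_sum [poly_fun_intros]: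
  "(\<And>i. i \<in> I \<Longrightarrow> complex_polynomial_fun (p i)) \<Longrightarrow> complex_polynomial_fun (\<lambda>x. \<Sum>i\<in>I. p i x)"
  by (induction I rule: infinite_finite_induct) (auto intro: poly_fun_intros)

lemma poly_fun_vec_arith [poly_fun_intros]:
  "complex_polynomial_fun (\<lambda>c. x c $ k) \<Longrightarrow> complex_polynomial_fun (\<lambda>c. y c $ k)
    \<Longrightarrow> complex_polynomial_fun (\<lambda>c. (x c + y c) $ k)"
  "complex_polynomial_fun (\<lambda>c. x c $ k) \<Longrightarrow> complex_polynomial_fun (\<lambda>c. y c $ k)
    \<Longrightarrow> complex_polynomial_fun (\<lambda>c. (x c - y c) $ k)"
  "complex_polynomial_fun r \<Longrightarrow> complex_polynomial_fun (\<lambda>c. y c $ k)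
    \<Longrightarrow> complex_polynomial_fun (\<lambda>c. (r c *s y c) $ k)"
  by (simp_all add: poly_fun_intros)

lemma poly_fun_mult_of [poly_fun_intros]:
  "(\<And>i. complex_polynomial_fun (\<lambda>c. x c $ i)) \<Longrightarrow> (\<And>i. complex_polynomial_fun (\<lambda>c. y c $ i))
    \<Longrightarrow> complex_polynomial_fun (\<lambda>c. mult_of c (x c) (y c) $ k)"
  unfolding mult_of_def by (auto intro!: poly_fun_intros)

lemma poly_fun_bracket_of [poly_fun_intros]:
  "(\<And>i. complex_polynomial_fun (\<lambda>c. x c $ i)) \<Longrightarrow> (\<And>i. complex_polynomial_fun (\<lambda>c. y c $ i))
    \<Longrightarrow> complex_polynomial_fun (\<lambda>c. bracket_of c (x c) (y c) $ k)"
  unfolding bracket_of_def by (auto intro!: poly_fun_intros)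

text \<open>Since \<open>g\<close> is fixed, the entries of \<open>matrix_inv g\<close> are
  constants here. The dependence on \<open>g\<close>, which is only rational, is the subject of
  \<open>is_poly_gl_act\<close>.\<close>

lemma poly_fun_gl_act: "complex_polynomial_fun (\<lambda>c. gl_act g c $ s)"
proof -
  obtain i j k where "s = Inl (i, j, k) \<or> s = Inr (i, j, k)"
    by (metis obj_sumE prod_cases3)
  then show ?thesis
    by (elim disjE; simp add: gl_act_def structure_constants_of_def matrix_vector_mult_def;
      intro poly_fun_intros)
qed

lemma poly_fun_compose:
  "complex_polynomial_fun p \<Longrightarrow> (\<And>s. complex_polynomial_fun (\<lambda>x. f x $ s))
    \<Longrightarrow> complex_polynomial_fun (\<lambda>x. p (f x))"
  by (induction rule: complex_polynomial_fun.induct) (auto intro: poly_fun_intros)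

section \<open>Closed conditions, limits and closures of invariant sets\<close>

lemma zariski_closed_poly_eq:
  assumes "complex_polynomial_fun p" "complex_polynomial_fun q"
  shows "zariski_closed {c. p c = q c}"
  unfolding zariski_closed_def zero_locus_def
  by (rule exI[of _ "{\<lambda>c. p c - q c}"]) (use assms in \<open>auto intro: poly_fun_intros\<close>)

lemma zariski_closed_all:
  "(\<And>x. zariski_closed {c. P c x}) \<Longrightarrow> zariski_closed {c. \<forall>x. P c x}"
  using zariski_closed_Inter[of "range (\<lambda>x. {c. P c x})"]
  by (auto simp: Collect_all_eq image_def)

lemma zariski_closed_conj:
  "zariski_closed {c. P c} \<Longrightarrow> zariski_closed {c. Q c} \<Longrightarrow> zariski_closed {c. P c \<and> Q c}"
  using zariski_closed_Inter[of "{{c. P c}, {c. Q c}}"] by (auto simp: Collect_conj_eq)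

lemma zariski_closed_vec_eq:
  assumes "\<And>k. complex_polynomial_fun (\<lambda>c. x c $ k)" "\<And>k. complex_polynomial_fun (\<lambda>c. y c $ k)"
  shows "zariski_closed {c. x c = y c}"
  unfolding vec_eq_iff by (intro zariski_closed_all zariski_closed_poly_eq assms)

lemma zariski_closed_tpa_variety: "zariski_closed (tpa_variety :: 'n::finite structure_constants set)"
proof -
  have "zariski_closed {c :: 'n structure_constants. c \<in> tpa_variety}"
    unfolding tpa_variety_iff
    by (intro zariski_closed_conj zariski_closed_all zariski_closed_vec_eq;
        (intro poly_fun_intros)?; simp add: poly_fun_intros)
  then show ?thesis
    by simp
qed

lemma zariski_closed_imp_closed:
  assumes "zariski_closed (S :: (complex ^ 'm::finite) set)"
  shows "closed S"
proof -
  obtain P where P: "\<forall>p\<in>P. complex_polynomial_fun p" "S = zero_locus P"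
    using assms unfolding zariski_closed_def by blast
  have "continuous_on UNIV p" if "complex_polynomial_fun p" for p :: "complex ^ 'm \<Rightarrow> complex"
    using that by induction (auto intro!: continuous_intros)
  then have "closed {x. p x = 0}" if "p \<in> P" for p
    using that P(1) by (intro closed_Collect_eq continuous_on_const) auto
  moreover have "S = (\<Inter>p\<in>P. {x. p x = 0})"
    unfolding P(2) zero_locus_def by auto
  ultimately show ?thesis
    by auto
qed

text \<open>The second hypothesis concerns nonzero \<open>t\<close> near 0 only, so the curve may
  leave the orbits at 0; this certifies a degeneration.\<close>

lemma zariski_closure_limit:
  fixes f :: "complex \<Rightarrow> complex ^ 'm::finite"
  assumes "continuous (at 0) f" "eventually (\<lambda>t. f t \<in> zariski closure_of S) (at 0)"
  shows "f 0 \<in> zariski closure_of S"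
proof -
  have "closed (zariski closure_of S)"
    by (intro zariski_closed_imp_closed) (simp flip: closedin_zariski)
  then show ?thesis
    using assms by (rule_tac Lim_in_closed_set[of _ f "at 0"]) (auto simp: continuous_at isCont_def)
qed

lemma zariski_closed_vimage_gl_act:
  assumes "zariski_closed Z"
  shows "zariski_closed {c. gl_act g c \<in> Z}"
proof -
  obtain P where P: "\<forall>p\<in>P. complex_polynomial_fun p" "Z = zero_locus P"
    using assms unfolding zariski_closed_def by blast
  then show ?thesis
    unfolding zariski_closed_def
    by (intro exI[of _ "(\<lambda>p c. p (gl_act g c)) ` P"])
      (auto simp: zero_locus_def intro: poly_fun_compose poly_fun_gl_act)
qed

text \<open>The preimage of the closure under the polynomial map \<open>gl_act g\<close> is closed
  and contains \<open>S\<close>, hence contains the closure.\<close>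

lemma gl_act_closure:
  assumes "\<And>c. c \<in> S \<Longrightarrow> gl_act g c \<in> S" "c \<in> zariski closure_of S"
  shows "gl_act g c \<in> zariski closure_of S"
proof -
  have "closedin zariski {c. gl_act g c \<in> zariski closure_of S}"
    unfolding closedin_zariski
    by (intro zariski_closed_vimage_gl_act) (simp flip: closedin_zariski)
  moreover have "S \<subseteq> {c. gl_act g c \<in> zariski closure_of S}"
    using assms(1) closure_of_subset[of S zariski] by auto
  ultimately have "zariski closure_of S \<subseteq> {c. gl_act g c \<in> zariski closure_of S}"
    by (simp add: closure_of_minimal)
  then show ?thesis
    using assms(2) by blast
qed

definition gl_span :: "'n::finite structure_constants set \<Rightarrow> 'n structure_constants set" where
  "gl_span K = (\<Union>c\<in>K. gl_orbit c)"

lemma gl_act_gl_span: "invertible g \<Longrightarrow> c \<in> gl_span K \<Longrightarrow> gl_act g c \<in> gl_span K"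
  unfolding gl_span_def using gl_act_gl_orbit by blast

lemma gl_span_gl_act_iff:
  assumes "invertible g"
  shows "gl_act g c \<in> zariski closure_of gl_span K \<longleftrightarrow> c \<in> zariski closure_of gl_span K"
  using gl_act_closure[of "gl_span K" g c] gl_act_closure[of "gl_span K" "matrix_inv g" "gl_act g c"]
    gl_act_gl_span[OF assms] gl_act_gl_span[OF invertible_matrix_inv[OF assms]]
  by (auto simp: gl_act_inverse[OF assms])

section \<open>Curves in orbits and irreducibility\<close>

definition is_poly :: "(complex \<Rightarrow> complex) \<Rightarrow> bool" where
  "is_poly f \<longleftrightarrow> (\<exists>p. \<forall>t. f t = poly p t)"

lemma is_poly_const: "is_poly (\<lambda>t. c)"
  unfolding is_poly_def by (rule exI[of _ "[:c:]"]) simp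

lemma is_poly_id: "is_poly (\<lambda>t. t)"
  unfolding is_poly_def by (rule exI[of _ "[:0, 1:]"]) simp

lemma is_poly_add: "is_poly f \<Longrightarrow> is_poly g \<Longrightarrow> is_poly (\<lambda>t. f t + g t)"
  unfolding is_poly_def by (metis poly_add)

lemma is_poly_diff: "is_poly f \<Longrightarrow> is_poly g \<Longrightarrow> is_poly (\<lambda>t. f t - g t)"
  unfolding is_poly_def by (metis poly_diff)

lemma is_poly_mult: "is_poly f \<Longrightarrow> is_poly g \<Longrightarrow> is_poly (\<lambda>t. f t * g t)"
  unfolding is_poly_def by (metis poly_mult)

lemma is_poly_power: "is_poly f \<Longrightarrow> is_poly (\<lambda>t. f t ^ n)"
  unfolding is_poly_def by (metis poly_power)

lemma is_poly_sum: "(\<And>i. i \<in> I \<Longrightarrow> is_poly (f i)) \<Longrightarrow> is_poly (\<lambda>t. \<Sum>i\<in>I. f i t)"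
  by (induction I rule: infinite_finite_induct) (auto intro: is_poly_const is_poly_add)

lemma is_poly_prod: "(\<And>i. i \<in> I \<Longrightarrow> is_poly (f i)) \<Longrightarrow> is_poly (\<lambda>t. \<Prod>i\<in>I. f i t)"
  by (induction I rule: infinite_finite_induct) (auto intro: is_poly_const is_poly_mult)

lemmas is_poly_intros = is_poly_const is_poly_id is_poly_add is_poly_diff is_poly_mult is_poly_power
  is_poly_sum is_poly_prod

lemma is_poly_det: "(\<And>i j. is_poly (\<lambda>t. A t $ i $ j)) \<Longrightarrow> is_poly (\<lambda>t. det (A t))"
  unfolding det_def by (intro is_poly_intros)

lemma matrix_inv_cramer:
  fixes g :: "complex ^ 'n ^ 'n"
  assumes "det g \<noteq> 0"
  shows "(matrix_inv g *v b) $ k = det (\<chi> i j. if j = k then b $ i else g $ i $ j) / det g"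
  using cramer[OF assms, of "matrix_inv g *v b" b] assms
  by (simp add: matrix_inv_vector invertible_det_nz)

text \<open>By Cramer's rule each of the two inverse matrices inside the bilinear map contributes
  one denominator \<open>det (g t)\<close>, so its square clears them.\<close>

lemma is_poly_gl_act:
  fixes g :: "complex \<Rightarrow> complex ^ 'n ^ 'n" and c :: "complex \<Rightarrow> 'n structure_constants"
  assumes "\<And>i j. is_poly (\<lambda>t. g t $ i $ j)" "\<And>s. is_poly (\<lambda>t. c t $ s)"
  shows "\<exists>f. is_poly f \<and> (\<forall>t. det (g t) \<noteq> 0 \<longrightarrow> det (g t) ^ 2 * gl_act (g t) (c t) $ s = f t)"
proof -
  define C where "C t b = (\<chi> k. det (\<chi> i j. if j = k then b $ i else g t $ i $ j))" for t and b :: "complex ^ 'n"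
  have C_poly: "is_poly (\<lambda>t. C t b $ k)" for b k
    unfolding C_def vec_lambda_beta
  proof (rule is_poly_det)
    show "is_poly (\<lambda>t. (\<chi> i j. if j = k then b $ i else g t $ i $ j) $ i $ j)" for i j
      using assms(1) by (cases "j = k") (simp_all add: is_poly_const)
  qed
  have C: "matrix_inv (g t) *v b = (1 / det (g t)) *s C t b" if "det (g t) \<noteq> 0" for t b
    using that by (simp add: vec_eq_iff matrix_inv_cramer C_def)
  obtain i j k where "s = Inl (i, j, k) \<or> s = Inr (i, j, k)"
    by (metis obj_sumE prod_cases3)
  then show ?thesis
  proof
    assume s: "s = Inl (i, j, k)"
    let ?f = "\<lambda>t. (g t *v mult_of (c t) (C t (axis i 1)) (C t (axis j 1))) $ k"
    have "is_poly ?f"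
      unfolding mult_of_def matrix_vector_mult_def vec_lambda_beta by (intro is_poly_intros assms C_poly)
    moreover have "det (g t) ^ 2 * gl_act (g t) (c t) $ s = ?f t" if "det (g t) \<noteq> 0" for t
      using that unfolding s
      by (simp add: mult_of_gl_act bilinear_simps C vector_scalar_commute power2_eq_square flip: mult_of_axis)
    ultimately show ?thesis
      by blast
  next
    assume s: "s = Inr (i, j, k)"
    let ?f = "\<lambda>t. (g t *v bracket_of (c t) (C t (axis i 1)) (C t (axis j 1))) $ k"
    have "is_poly ?f"
      unfolding bracket_of_def matrix_vector_mult_def vec_lambda_beta by (intro is_poly_intros assms C_poly)
    moreover have "det (g t) ^ 2 * gl_act (g t) (c t) $ s = ?f t" if "det (g t) \<noteq> 0" for t
      using that unfolding s
      by (simp add: bracket_of_gl_act bilinear_simps C vector_scalar_commute power2_eq_square flip: bracket_of_axis)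
    ultimately show ?thesis
      by blast
  qed
qed

text \<open>The exponents of the denominator add up under sums and products. The equation is claimed
  only where \<open>d\<close> is nonzero: in the application \<open>matrix_inv\<close> is arbitrary
  at singular matrices.\<close>

lemma poly_fun_along_curve:
  fixes \<gamma> :: "complex \<Rightarrow> complex ^ 'm" and d :: "complex \<Rightarrow> complex"
  assumes p: "complex_polynomial_fun p" and d: "is_poly d"
    and \<gamma>: "\<And>s. \<exists>f. is_poly f \<and> (\<forall>t. d t \<noteq> 0 \<longrightarrow> d t ^ 2 * \<gamma> t $ s = f t)"
  shows "\<exists>n f. is_poly f \<and> (\<forall>t. d t \<noteq> 0 \<longrightarrow> d t ^ n * p (\<gamma> t) = f t)"
  using p
proof induction
  case (const c)
  then show ?case
    by (intro exI[of _ 0] exI[of _ "\<lambda>t. c"]) (simp add: is_poly_const)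
next
  case (coord i)
  then show ?case
    using \<gamma> by blast
next
  case (add p q)
  then obtain m f n g where f: "is_poly f" "\<And>t. d t \<noteq> 0 \<Longrightarrow> d t ^ m * p (\<gamma> t) = f t"
    and g: "is_poly g" "\<And>t. d t \<noteq> 0 \<Longrightarrow> d t ^ n * q (\<gamma> t) = g t"
    by blast
  have "d t ^ (m + n) * (p (\<gamma> t) + q (\<gamma> t)) = d t ^ n * f t + d t ^ m * g t" if "d t \<noteq> 0" for t
    unfolding f(2)[OF that, symmetric] g(2)[OF that, symmetric] by (simp add: algebra_simps power_add)
  moreover have "is_poly (\<lambda>t. d t ^ n * f t + d t ^ m * g t)"
    by (intro is_poly_intros d f g)
  ultimately show ?case
    by blast
next
  case (mult p q)
  then obtain m f n g where f: "is_poly f" "\<And>t. d t \<noteq> 0 \<Longrightarrow> d t ^ m * p (\<gamma> t) = f t"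
    and g: "is_poly g" "\<And>t. d t \<noteq> 0 \<Longrightarrow> d t ^ n * q (\<gamma> t) = g t"
    by blast
  have "d t ^ (m + n) * (p (\<gamma> t) * q (\<gamma> t)) = f t * g t" if "d t \<noteq> 0" for t
    unfolding f(2)[OF that, symmetric] g(2)[OF that, symmetric] by (simp add: algebra_simps power_add)
  moreover have "is_poly (\<lambda>t. f t * g t)"
    by (intro is_poly_intros f g)
  ultimately show ?case
    by blast
qed

text \<open>If neither of two closed sets covering the closure contains \<open>gl_span K\<close>,
  each misses a point of it; along a curve joining these points a product of nonzero polynomials
  would vanish. The hypothesis \<open>aff\<close> keeps the parameter in \<open>K\<close>.\<close>

lemma irreducible_gl_span:
  fixes K :: "'n::finite structure_constants set"
  assumes ne: "K \<noteq> {}"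
    and aff: "\<And>a b t. a \<in> K \<Longrightarrow> b \<in> K \<Longrightarrow> (1 - t) *s a + t *s b \<in> K"
  shows "irreducible_space (subtopology zariski (zariski closure_of gl_span K))"
proof -
  let ?Z = "zariski closure_of gl_span K"
  have sub: "gl_span K \<subseteq> ?Z"
    by (simp add: closure_of_subset)
  have "gl_span K \<noteq> {}"
    using ne gl_orbit_refl unfolding gl_span_def by blast
  moreover have "A \<inter> ?Z = ?Z \<or> B \<inter> ?Z = ?Z"
    if A: "zariski_closed A" and B: "zariski_closed B" and AB: "?Z = (A \<inter> ?Z) \<union> (B \<inter> ?Z)" for A B
  proof (rule ccontr)
    assume "\<not> ?thesis"
    then have "\<not> gl_span K \<subseteq> A" "\<not> gl_span K \<subseteq> B"
      using A B closure_of_minimal[of "gl_span K" A zariski] closure_of_minimal[of "gl_span K" B zariski]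
      by (auto simp: closedin_zariski)
    then obtain x y where x: "x \<in> gl_span K" "x \<notin> A" and y: "y \<in> gl_span K" "y \<notin> B"
      by blast
    obtain g a where g: "invertible g" "a \<in> K" "x = gl_act g a"
      using x(1) unfolding gl_span_def gl_orbit_def by blast
    obtain h b where h: "invertible h" "b \<in> K" "y = gl_act h b"
      using y(1) unfolding gl_span_def gl_orbit_def by blast
    obtain p where p: "complex_polynomial_fun p" "p x \<noteq> 0" "\<And>z. z \<in> A \<Longrightarrow> p z = 0"
      using A x(2) unfolding zariski_closed_def zero_locus_def by blast
    obtain q where q: "complex_polynomial_fun q" "q y \<noteq> 0" "\<And>z. z \<in> B \<Longrightarrow> q z = 0"
      using B y(2) unfolding zariski_closed_def zero_locus_def by blast
    define G where "G t = (\<chi> i j. (1 - t) * g $ i $ j + t * h $ i $ j)" for t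
    define c where "c t = (1 - t) *s a + t *s b" for t
    define \<gamma> where "\<gamma> t = gl_act (G t) (c t)" for t
    have G: "G 0 = g" "G 1 = h"
      by (simp_all add: G_def vec_eq_iff)
    have \<gamma>01: "\<gamma> 0 = x" "\<gamma> 1 = y"
      by (simp_all add: \<gamma>_def G c_def g h)
    have G_poly: "is_poly (\<lambda>t. G t $ i $ j)" for i j
      unfolding G_def vec_lambda_beta by (intro is_poly_intros)
    have d_poly: "is_poly (\<lambda>t. det (G t))"
      by (intro is_poly_det G_poly)
    have c_poly: "is_poly (\<lambda>t. c t $ s)" for s
      unfolding c_def vector_add_component vector_smult_component by (intro is_poly_intros)
    have \<gamma>: "\<exists>f. is_poly f \<and> (\<forall>t. det (G t) \<noteq> 0 \<longrightarrow> det (G t) ^ 2 * \<gamma> t $ s = f t)" for s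
      unfolding \<gamma>_def by (rule is_poly_gl_act[OF G_poly c_poly])
    obtain m P where P: "\<And>t. det (G t) \<noteq> 0 \<Longrightarrow> det (G t) ^ m * p (\<gamma> t) = poly P t"
      using poly_fun_along_curve[OF p(1) d_poly \<gamma>] unfolding is_poly_def by metis
    obtain n Q where Q: "\<And>t. det (G t) \<noteq> 0 \<Longrightarrow> det (G t) ^ n * q (\<gamma> t) = poly Q t"
      using poly_fun_along_curve[OF q(1) d_poly \<gamma>] unfolding is_poly_def by metis
    obtain D where D: "\<And>t. det (G t) = poly D t"
      using d_poly unfolding is_poly_def by blast
    \<comment> \<open>The factor \<open>D\<close> takes care of the singular \<open>G t\<close>, so
      the product vanishes for all \<open>t\<close> and therefore as a formal polynomial.\<close>
    have "poly (D * P * Q) t = 0" for t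
    proof (cases "det (G t) = 0")
      case False
      then have "invertible (G t)"
        by (simp add: invertible_det_nz)
      then have "\<gamma> t \<in> gl_span K"
        unfolding \<gamma>_def c_def gl_span_def gl_orbit_def using aff[OF g(2) h(2)] by blast
      then have "\<gamma> t \<in> A \<or> \<gamma> t \<in> B"
        using AB sub by blast
      then have "p (\<gamma> t) = 0 \<or> q (\<gamma> t) = 0"
        using p(3) q(3) by blast
      then show ?thesis
        using P[OF False] Q[OF False] by auto
    qed (simp add: D)
    then have "D * P * Q = 0"
      using poly_all_0_iff_0 by blast
    \<comment> \<open>At the two endpoints the matrices are invertible, so \<open>P\<close> and
      \<open>Q\<close> inherit the nonvanishing of \<open>p x\<close> and
      \<open>q y\<close>.\<close>
    moreover have d0: "det (G 0) \<noteq> 0" "det (G 1) \<noteq> 0"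
      using g h by (simp_all add: G invertible_det_nz)
    moreover from d0 have "poly P 0 \<noteq> 0" "poly Q 1 \<noteq> 0"
      using P[of 0] Q[of 1] p(2) q(2) by (auto simp: \<gamma>01 simp flip: P Q)
    ultimately show False
      using D by auto
  qed
  ultimately show ?thesis
    unfolding irreducible_space_def closedin_subtopology closedin_zariski
    using sub by (auto 4 4)
qed

lemma irreducible_components_eqI:
  assumes cover: "topspace X = \<Union>\<Z>" and fin: "finite \<Z>"
    and closed: "\<And>Z. Z \<in> \<Z> \<Longrightarrow> closedin X Z"
    and irr: "\<And>Z. Z \<in> \<Z> \<Longrightarrow> irreducible_space (subtopology X Z)"
    and anti: "\<And>Z Z'. Z \<in> \<Z> \<Longrightarrow> Z' \<in> \<Z> \<Longrightarrow> Z \<subseteq> Z' \<Longrightarrow> Z = Z'"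
  shows "irreducible_components X = \<Z>"
proof -
  \<comment> \<open>An irreducible set inside a finite union of closed sets lies in one of them; the
    induction splits off one closed set at a time.\<close>
  have ex: "\<exists>Z\<in>\<Z>'. W \<subseteq> Z"
    if "finite \<Z>'" "\<Z>' \<subseteq> \<Z>" "W \<subseteq> \<Union>\<Z>'" and W: "W \<subseteq> topspace X" "irreducible_space (subtopology X W)" for W \<Z>'
    using that(1-3)
  proof (induction rule: finite_induct)
    case empty
    then show ?case
      using W by (auto simp: irreducible_space_def)
  next
    case (insert Z \<Z>')
    have "closedin X (\<Union>\<Z>')"
      using insert by (intro closedin_Union) (auto intro: closed)
    then have "closedin (subtopology X W) (Z \<inter> W)" "closedin (subtopology X W) (\<Union>\<Z>' \<inter> W)"
      using closed[of Z] insert.prems by (auto simp: closedin_subtopology)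
    moreover have "topspace (subtopology X W) = (Z \<inter> W) \<union> (\<Union>\<Z>' \<inter> W)"
      using insert.prems W(1) by auto
    ultimately have "Z \<inter> W = topspace (subtopology X W) \<or> \<Union>\<Z>' \<inter> W = topspace (subtopology X W)"
      using W(2) unfolding irreducible_space_def by blast
    then have "W \<subseteq> Z \<or> W \<subseteq> \<Union>\<Z>'"
      using W(1) by auto
    then show ?case
      using insert by auto
  qed
  show ?thesis
  proof (intro set_eqI iffI)
    fix Z assume "Z \<in> irreducible_components X"
    then have Z: "Z \<subseteq> topspace X" "irreducible_space (subtopology X Z)"
      "\<And>W. W \<subseteq> topspace X \<Longrightarrow> irreducible_space (subtopology X W) \<Longrightarrow> Z \<subseteq> W \<Longrightarrow> W = Z"
      unfolding irreducible_components_def by blast+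
    then obtain Z' where "Z' \<in> \<Z>" "Z \<subseteq> Z'"
      using ex[OF fin, of Z] cover by blast
    then show "Z \<in> \<Z>"
      using Z(3)[of Z'] irr closed closedin_subset by blast
  next
    fix Z assume Z: "Z \<in> \<Z>"
    have "W = Z" if W: "W \<subseteq> topspace X" "irreducible_space (subtopology X W)" "Z \<subseteq> W" for W
    proof -
      obtain Z' where "Z' \<in> \<Z>" "W \<subseteq> Z'"
        using ex[OF fin, of W] cover W by blast
      then show ?thesis
        using anti[OF Z, of Z'] W(3) by blast
    qed
    then show "Z \<in> irreducible_components X"
      unfolding irreducible_components_def using Z irr closed closedin_subset by blast
  qed
qed

section \<open>Normal forms in the closures\<close>

lemma continuous_vec:
  fixes f :: "complex \<Rightarrow> complex ^ 'm"
  assumes "\<And>i. continuous (at a) (\<lambda>t. f t $ i)"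
  shows "continuous (at a) f"
  using assms unfolding continuous_def by (intro vec_tendstoI) auto

lemma continuous_vector_3 [continuous_intros]:
  fixes f g h :: "complex \<Rightarrow> complex"
  assumes "continuous (at a) f" "continuous (at a) g" "continuous (at a) h"
  shows "continuous (at a) (\<lambda>t. vector [f t, g t, h t] :: complex ^ 3)"
proof (rule continuous_vec)
  show "continuous (at a) (\<lambda>t. (vector [f t, g t, h t] :: complex ^ 3) $ i)" for i
    using exhaust_3[of i] assms by auto
qed

lemma continuous_nf [continuous_intros]:
  assumes "continuous (at a) a11" "continuous (at a) a12" "continuous (at a) a13"
    "continuous (at a) a22" "continuous (at a) a23" "continuous (at a) a33"
    "continuous (at a) b12" "continuous (at a) b13" "continuous (at a) b23"
  shows "continuous (at (a :: complex)) (\<lambda>t. nf (a11 t) (a12 t) (a13 t) (a22 t) (a23 t) (a33 t) (b12 t) (b13 t) (b23 t))"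
proof (rule continuous_vec)
  fix s :: "3 \<times> 3 \<times> 3 + 3 \<times> 3 \<times> 3"
  have comp: "continuous (at a) (\<lambda>t. f t $ i)" if "continuous (at a) f" for f :: "complex \<Rightarrow> complex ^ 3" and i
    using that unfolding continuous_def by (intro tendsto_vec_nth) auto
  obtain i j k where "s = Inl (i, j, k) \<or> s = Inr (i, j, k)"
    by (metis obj_sumE prod_cases3)
  then show "continuous (at a) (\<lambda>t. nf (a11 t) (a12 t) (a13 t) (a22 t) (a23 t) (a33 t) (b12 t) (b13 t) (b23 t) $ s)"
    by (elim disjE) (simp_all add: mult_of_nf bracket_of_nf continuous_intros comp assms
      flip: mult_of_axis bracket_of_axis)
qed

lemma eventually_add_neq_0: "eventually (\<lambda>t. a + t \<noteq> 0) (at (0 :: complex))"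
proof -
  have "eventually (\<lambda>t. t \<noteq> - a) (at (0 :: complex))"
    by (rule eventually_neq_at_within)
  then show ?thesis
    by (rule eventually_mono) (auto simp: add_eq_0_iff)
qed

lemma eventually_poly_neq_0:
  assumes "p \<noteq> 0"
  shows "eventually (\<lambda>t. poly p t \<noteq> 0) (at (a :: complex))"
proof -
  have "eventually (\<lambda>t. \<forall>x\<in>{x. poly p x = 0}. t \<noteq> x) (at a)"
    using poly_roots_finite[OF assms] by (intro eventually_ball_finite) (auto intro: eventually_neq_at_within)
  then show ?thesis
    by (rule eventually_mono) auto
qed

lemma gl_spanI: "g = gl_act h c \<Longrightarrow> invertible h \<Longrightarrow> c \<in> K \<Longrightarrow> g \<in> gl_span K"
  unfolding gl_span_def gl_orbit_def by blast

abbreviation K09 :: "3 structure_constants set" where "K09 \<equiv> {T09 \<alpha> \<beta> |\<alpha> \<beta>. True}"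
abbreviation K12 :: "3 structure_constants set" where "K12 \<equiv> range T12"
abbreviation K17 :: "3 structure_constants set" where "K17 \<equiv> range T17"

lemma closure_subset_zariski: "S \<subseteq> zariski closure_of S"
  by (simp add: closure_of_subset)

text \<open>For nonzero parameters the vectors e_i / d_i are orthogonal idempotents; vanishing
  parameters are reached in the limit.\<close>

lemma nf_in_closure_T20:
  "nf (vector [d1,0,0]) 0 0 (vector [0,d2,0]) 0 (vector [0,0,d3]) 0 0 0 \<in> zariski closure_of gl_span {T20}"
proof -
  let ?N = "\<lambda>d1 d2 d3. nf (vector [d1,0,0]) 0 0 (vector [0,d2,0]) 0 (vector [0,0,d3]) 0 0 0"
  have gen: "?N d1 d2 d3 \<in> gl_span {T20}" if "d1 \<noteq> 0" "d2 \<noteq> 0" "d3 \<noteq> 0" for d1 d2 d3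
  proof -
    let ?v = "vector [1/d1,0,0] :: complex ^ 3" and ?w = "vector [0,1/d2,0] :: complex ^ 3"
      and ?u = "vector [0,0,1/d3] :: complex ^ 3"
    have inv: "invertible (cols ?v ?w ?u)"
      using that by (simp add: invertible_det_nz det_cols)
    have "?N d1 d2 d3 = gl_act (cols ?v ?w ?u) T20"
      unfolding T20_nf using that
      by (intro gl_act_nf inv sym_alt_nf)
        (simp_all add: mult_of_nf bracket_of_nf cols_mult vec_eq_iff forall_3)
    then show ?thesis
      using inv by (intro gl_spanI) auto
  qed
  have "\<forall>\<^sub>F t in at 0. ?N (d1 + t) (d2 + t) (d3 + t) \<in> zariski closure_of gl_span {T20}"
    using eventually_add_neq_0[of d1] eventually_add_neq_0[of d2] eventually_add_neq_0[of d3]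
    by eventually_elim (use gen closure_subset_zariski in blast)
  moreover have "continuous (at 0) (\<lambda>t. ?N (d1 + t) (d2 + t) (d3 + t))"
    by (intro continuous_intros)
  ultimately show ?thesis
    using zariski_closure_limit[of "\<lambda>t. ?N (d1 + t) (d2 + t) (d3 + t)"]
    by simp
qed

lemma nf_in_closure_T09:
  "nf 0 0 (vector [l,0,0]) 0 (vector [0,l,0]) (vector [w1,w2,l]) 0 (vector [m1,n,0]) (vector [0,m2,0])
    \<in> zariski closure_of gl_span K09"
proof -
  let ?N = "\<lambda>l m1 n. nf 0 0 (vector [l,0,0]) 0 (vector [0,l,0]) (vector [w1,w2,l])
    0 (vector [m1,n,0]) (vector [0,m2,0])"
  have gen: "?N l m1 n \<in> gl_span K09" if "l \<noteq> 0" "m1 \<noteq> 0" "n \<noteq> 0" for l m1 n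
  proof -
    \<comment> \<open>The vector e_3 - (w1/l) e_1 - (w2/l) e_2 has square \<open>l\<close> times
      itself; dividing it by \<open>m1\<close> normalises the first eigenvalue of the bracket to
      1.\<close>
    let ?v1 = "vector [1,0,0] :: complex ^ 3" and ?v2 = "vector [0,n/m1,0] :: complex ^ 3"
      and ?v3 = "vector [-w1/(l*m1), -w2/(l*m1), 1/m1] :: complex ^ 3"
    have inv: "invertible (cols ?v1 ?v2 ?v3)"
      using that by (simp add: invertible_det_nz det_cols)
    have "?N l m1 n = gl_act (cols ?v1 ?v2 ?v3) (T09 (m2/m1) (l/m1))"
      unfolding T09_nf using that
      by (intro gl_act_nf inv sym_alt_nf)
        (simp_all add: mult_of_nf bracket_of_nf cols_mult vec_eq_iff forall_3 field_simps)
    then show ?thesis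
      using inv by (intro gl_spanI) auto
  qed
  have "\<forall>\<^sub>F t in at 0. ?N (l + t) (m1 + t) (n + t) \<in> zariski closure_of gl_span K09"
    using eventually_add_neq_0[of l] eventually_add_neq_0[of m1] eventually_add_neq_0[of n]
    by eventually_elim (use gen closure_subset_zariski in blast)
  moreover have "continuous (at 0) (\<lambda>t. ?N (l + t) (m1 + t) (n + t))"
    by (intro continuous_intros)
  ultimately show ?thesis
    using zariski_closure_limit[of "\<lambda>t. ?N (l + t) (m1 + t) (n + t)"]
    by simp
qed

text \<open>A singular 2 by 2 matrix is a column (p, s) times a row (q, r). The factors vary freely,
  so they can be perturbed without leaving the quadric of singular matrices.\<close>

lemma rank_one_2:
  assumes "x * w = y * (z :: complex)"
  obtains p q r s where "x = p * q" "y = p * r" "z = s * q" "w = s * r"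
proof (cases "x = 0 \<and> z = 0")
  case True
  then show ?thesis
    using that[of y 0 1 w] by simp
next
  case False
  then show ?thesis
  proof (cases "x = 0")
    case True
    then have "y = 0"
      using assms False by auto
    then show ?thesis
      using that[of 0 z w 1] True by simp
  next
    case x: False
    then show ?thesis
      using that[of x 1 "y / x" z] assms by (simp add: field_simps)
  qed
qed

lemma nf_in_closure_T12:
  assumes "w1 * a = b * l"
  shows "nf (vector [0,a,0]) 0 (vector [l,b,0]) 0 (vector [0,l,0]) (vector [w1,w2,l])
    0 (vector [m,n,0]) (vector [0,2*m,0]) \<in> zariski closure_of gl_span K12"
proof -
  obtain p q r s where pqrs: "w1 = p * q" "b = p * r" "l = s * q" "a = s * r"
    using rank_one_2 assms by blast
  \<comment> \<open>The singular matrix has rows (w1, b) and (l, a). Perturbing \<open>q\<close>,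
    \<open>r\<close>, \<open>s\<close> makes \<open>a\<close> and \<open>l\<close> nonzero;
    \<open>p\<close> stays fixed.\<close>
  let ?N = "\<lambda>q r s m. nf (vector [0,s*r,0]) 0 (vector [s*q,p*r,0]) 0 (vector [0,s*q,0]) (vector [p*q,w2,s*q])
    0 (vector [m,n,0]) (vector [0,2*m,0])"
  have gen: "?N q r s m \<in> gl_span K12" if "q \<noteq> 0" "r \<noteq> 0" "s \<noteq> 0" "m \<noteq> 0" for q r s m
  proof -
    \<comment> \<open>With \<open>?u1\<close> for u1, both u1 a + b = 0 and u1 l + w1 = 0 hold,
      compatible because of the quadric. Then \<open>?u2\<close> is chosen so that the square of
      \<open>?v3\<close> is a multiple of \<open>?v3\<close>.\<close>
    let ?u1 = "- p / s"
    let ?u2 = "- (w2 + ?u1 * (p * r)) / (s * q)"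
    \<comment> \<open>The shift by e_2 turns [v1, v3] into v1 + v2, using that e_2 has twice the
      eigenvalue of e_1.\<close>
    let ?v1 = "vector [1, s*r - n/m, 0] :: complex ^ 3" and ?v2 = "vector [0, s*r, 0] :: complex ^ 3"
      and ?v3 = "vector [?u1/m, ?u2/m, 1/m] :: complex ^ 3"
    have inv: "invertible (cols ?v1 ?v2 ?v3)"
      using that by (simp add: invertible_det_nz det_cols)
    have "?N q r s m = gl_act (cols ?v1 ?v2 ?v3) (T12 (s*q/m))"
      unfolding T12_nf using that
      by (intro gl_act_nf inv sym_alt_nf)
        (simp_all add: mult_of_nf bracket_of_nf cols_mult vec_eq_iff forall_3 field_simps)
    then show ?thesis
      using inv by (intro gl_spanI) auto
  qed
  have "\<forall>\<^sub>F t in at 0. ?N (q + t) (r + t) (s + t) (m + t) \<in> zariski closure_of gl_span K12"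
    using eventually_add_neq_0[of q] eventually_add_neq_0[of r] eventually_add_neq_0[of s]
      eventually_add_neq_0[of m]
    by eventually_elim (use gen closure_subset_zariski in blast)
  moreover have "continuous (at 0) (\<lambda>t. ?N (q + t) (r + t) (s + t) (m + t))"
    by (intro continuous_intros)
  ultimately show ?thesis
    using zariski_closure_limit[of "\<lambda>t. ?N (q + t) (r + t) (s + t) (m + t)"]
    by (simp add: pqrs)
qed

lemma nf_in_closure_T17:
  assumes "(l + b) * b = w2 * a"
  shows "nf 0 0 (vector [l,0,0]) (vector [0,a,0]) (vector [0,l+b,0]) (vector [w1,w2,l])
    0 (vector [m,0,0]) 0 \<in> zariski closure_of gl_span K17"
proof -
  obtain p q r s where pqrs: "l + b = p * q" "w2 = p * r" "a = s * q" "b = s * r"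
    using rank_one_2 assms by blast
  then have l: "l = p * q - s * r"
    by (simp add: algebra_simps)
  \<comment> \<open>The singular matrix has rows (l + b, w2) and (a, b), so \<open>l\<close> is the
    difference p q - s r rather than a product of factors.\<close>
  let ?N = "\<lambda>p q s m. nf 0 0 (vector [p*q-s*r,0,0]) (vector [0,s*q,0]) (vector [0,p*q,0])
     (vector [w1,p*r,p*q-s*r]) 0 (vector [m,0,0]) 0"
  have gen': "nf 0 0 (vector [l,0,0]) (vector [0,a,0]) (vector [0,l+b,0])
     (vector [w1,(l+b)*b/a,l]) 0 (vector [m,0,0]) 0 \<in> gl_span K17" (is "?M \<in> _")
    if "a \<noteq> 0" "l \<noteq> 0" "m \<noteq> 0" for a b l m
  proof -
    \<comment> \<open>\<open>?v2\<close> is an idempotent and \<open>?v1\<close> +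
      \<open>?v2\<close> is e_1, the eigenvector of the bracket. \<open>?v3\<close> absorbs
      \<open>w1\<close> and lowers the eigenvalue on e_2 from l + b to l, up to the factor
      1/m.\<close>
    let ?v1 = "vector [1, -1/a, 0] :: complex ^ 3" and ?v2 = "vector [0, 1/a, 0] :: complex ^ 3"
      and ?v3 = "vector [-w1/(l*m), -b/(a*m), 1/m] :: complex ^ 3"
    have inv: "invertible (cols ?v1 ?v2 ?v3)"
      using that by (simp add: invertible_det_nz det_cols)
    have "?M = gl_act (cols ?v1 ?v2 ?v3) (T17 (l/m))"
      unfolding T17_nf using that
      by (intro gl_act_nf inv sym_alt_nf)
        (simp_all add: mult_of_nf bracket_of_nf cols_mult vec_eq_iff forall_3 field_simps)
    then show ?thesis
      using inv by (intro gl_spanI) auto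
  qed
  have gen: "?N p q s m \<in> gl_span K17" if "q \<noteq> 0" "s \<noteq> 0" "m \<noteq> 0" "p * q - s * r \<noteq> 0" for p q s m
    using gen'[of "s * q" "p * q - s * r" m "s * r"] that by (simp add: mult.assoc)
  \<comment> \<open>The perturbed \<open>l\<close> is a monic quadratic polynomial in
    \<open>t\<close>, hence nonzero for all but finitely many \<open>t\<close>.\<close>
  have "poly [:p * q - s * r, p + q - r, 1:] t = (p + t) * (q + t) - (s + t) * r" for t
    by (simp add: algebra_simps)
  then have "\<forall>\<^sub>F t in at 0. (p + t) * (q + t) - (s + t) * r \<noteq> 0"
    using eventually_poly_neq_0[of "[:p * q - s * r, p + q - r, 1:]" 0] by simp
  then have "\<forall>\<^sub>F t in at 0. ?N (p + t) (q + t) (s + t) (m + t) \<in> zariski closure_of gl_span K17"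
    using eventually_add_neq_0[of q] eventually_add_neq_0[of s] eventually_add_neq_0[of m]
    by eventually_elim (use gen closure_subset_zariski in blast)
  moreover have "continuous (at 0) (\<lambda>t. ?N (p + t) (q + t) (s + t) (m + t))"
    by (intro continuous_intros)
  ultimately show ?thesis
    using zariski_closure_limit[of "\<lambda>t. ?N (p + t) (q + t) (s + t) (m + t)"]
    by (simp add: pqrs l)
qed

section \<open>Tables recognised as members of the closures\<close>

definition covered :: "3 structure_constants set" where
  "covered = zariski closure_of gl_span {T01} \<union> zariski closure_of gl_span {T20} \<union>
    zariski closure_of gl_span K09 \<union> zariski closure_of gl_span K12 \<union> zariski closure_of gl_span K17"

lemma gl_act_covered_iff: "invertible g \<Longrightarrow> gl_act g c \<in> covered \<longleftrightarrow> c \<in> covered"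
  unfolding covered_def by (simp add: gl_span_gl_act_iff)

lemma covered_T20I:
  assumes "sym_alt c" "invertible (cols v1 v2 v3)"
    "mult_of c v1 v1 = d1 *s v1" "mult_of c v1 v2 = 0" "mult_of c v1 v3 = 0"
    "mult_of c v2 v2 = d2 *s v2" "mult_of c v2 v3 = 0" "mult_of c v3 v3 = d3 *s v3"
    "bracket_of c v1 v2 = 0" "bracket_of c v1 v3 = 0" "bracket_of c v2 v3 = 0"
  shows "c \<in> covered"
proof -
  have "c = gl_act (cols v1 v2 v3) (nf (vector [d1,0,0]) 0 0 (vector [0,d2,0]) 0 (vector [0,0,d3]) 0 0 0)"
    using assms by (intro gl_act_nf) (simp_all add: cols_mult)
  moreover have "nf (vector [d1,0,0]) 0 0 (vector [0,d2,0]) 0 (vector [0,0,d3]) 0 0 0 \<in> covered"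
    unfolding covered_def using nf_in_closure_T20 by blast
  ultimately show ?thesis
    using gl_act_covered_iff assms(2) by simp
qed

lemma covered_T09I:
  assumes "sym_alt c" "invertible (cols v1 v2 v3)"
    "mult_of c v1 v1 = 0" "mult_of c v1 v2 = 0" "mult_of c v1 v3 = l *s v1"
    "mult_of c v2 v2 = 0" "mult_of c v2 v3 = l *s v2" "mult_of c v3 v3 = w1 *s v1 + w2 *s v2 + l *s v3"
    "bracket_of c v1 v2 = 0" "bracket_of c v1 v3 = m1 *s v1 + n *s v2" "bracket_of c v2 v3 = m2 *s v2"
  shows "c \<in> covered"
proof -
  let ?N = "nf 0 0 (vector [l,0,0]) 0 (vector [0,l,0]) (vector [w1,w2,l]) 0 (vector [m1,n,0]) (vector [0,m2,0])"
  have "c = gl_act (cols v1 v2 v3) ?N"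
    using assms by (intro gl_act_nf) (simp_all add: cols_mult)
  moreover have "?N \<in> covered"
    unfolding covered_def using nf_in_closure_T09 by blast
  ultimately show ?thesis
    using gl_act_covered_iff assms(2) by simp
qed

lemma covered_T12I:
  assumes "sym_alt c" "invertible (cols v1 v2 v3)"
    "mult_of c v1 v1 = a *s v2" "mult_of c v1 v2 = 0" "mult_of c v1 v3 = l *s v1 + b *s v2"
    "mult_of c v2 v2 = 0" "mult_of c v2 v3 = l *s v2" "mult_of c v3 v3 = w1 *s v1 + w2 *s v2 + l *s v3"
    "w1 * a = b * l"
    "bracket_of c v1 v2 = 0" "bracket_of c v1 v3 = m *s v1 + n *s v2" "bracket_of c v2 v3 = (2 * m) *s v2"
  shows "c \<in> covered"
proof -
  let ?N = "nf (vector [0,a,0]) 0 (vector [l,b,0]) 0 (vector [0,l,0]) (vector [w1,w2,l])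
    0 (vector [m,n,0]) (vector [0,2*m,0])"
  have "c = gl_act (cols v1 v2 v3) ?N"
    using assms by (intro gl_act_nf) (simp_all add: cols_mult)
  moreover have "?N \<in> covered"
    unfolding covered_def using nf_in_closure_T12[OF assms(9)] by blast
  ultimately show ?thesis
    using gl_act_covered_iff assms(2) by simp
qed

text \<open>\<open>k\<close> stands for the former l + b, which puts the quadric into the form in
  which associativity delivers it.\<close>

lemma covered_T17I:
  assumes "sym_alt c" "invertible (cols v1 v2 v3)"
    "mult_of c v1 v1 = 0" "mult_of c v1 v2 = 0" "mult_of c v1 v3 = l *s v1"
    "mult_of c v2 v2 = a *s v2" "mult_of c v2 v3 = k *s v2" "mult_of c v3 v3 = w1 *s v1 + w2 *s v2 + l *s v3"
    "k * (k - l) = w2 * a"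
    "bracket_of c v1 v2 = 0" "bracket_of c v1 v3 = m *s v1" "bracket_of c v2 v3 = 0"
  shows "c \<in> covered"
proof -
  let ?N = "nf 0 0 (vector [l,0,0]) (vector [0,a,0]) (vector [0,l+(k-l),0]) (vector [w1,w2,l])
    0 (vector [m,0,0]) 0"
  have "c = gl_act (cols v1 v2 v3) ?N"
    using assms by (intro gl_act_nf) (simp_all add: cols_mult)
  moreover have "?N \<in> covered"
    unfolding covered_def using nf_in_closure_T17[of l "k - l" w2 a w1 m] assms(9) by auto
  ultimately show ?thesis
    using gl_act_covered_iff assms(2) by simp
qed

section \<open>Commutative associative algebras\<close>

lemma cubic_roots:
  obtains r1 r2 r3 :: complex
  where "a = r1 + r2 + r3" "b = r1 * r2 + r1 * r3 + r2 * r3" "c = r1 * r2 * r3"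
proof -
  have "\<not> constant (poly [:- c, b, - a, 1:])"
    by (subst constant_degree) simp
  then obtain r1 where "poly [:- c, b, - a, 1:] r1 = 0"
    using fundamental_theorem_of_algebra by blast
  then have r1: "c = r1 * (b - r1 * (a - r1))"
    by (simp add: algebra_simps)
  let ?q = "b - r1 * (a - r1)"
  have "\<not> constant (poly [:?q, r1 - a, 1:])"
    by (subst constant_degree) simp
  then obtain r2 where "poly [:?q, r1 - a, 1:] r2 = 0"
    using fundamental_theorem_of_algebra by blast
  then have r2: "?q = r2 * (a - r1 - r2)"
    by (simp add: algebra_simps)
  show thesis
  proof (rule that)
    show "a = r1 + r2 + (a - r1 - r2)"
      by simp
    show "b = r1 * r2 + r1 * (a - r1 - r2) + r2 * (a - r1 - r2)"
      using r2 by algebra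
    show "c = r1 * r2 * (a - r1 - r2)"
      using r1 r2 by algebra
  qed
qed

text \<open>The linear coefficient of the characteristic polynomial, as a sum of principal 2 by 2
  minors.\<close>

definition minor_sum :: "complex ^ 3 ^ 3 \<Rightarrow> complex" where
  "minor_sum A = A$1$1 * A$2$2 - A$1$2 * A$2$1 + A$1$1 * A$3$3 - A$1$3 * A$3$1
     + A$2$2 * A$3$3 - A$2$3 * A$3$2"

lemma mat_mult_vec: "mat r *v x = r *s (x :: complex ^ 'n)"
  by (simp add: vec_eq_iff matrix_vector_mult_def mat_def if_distrib[where f="\<lambda>x. x * _"] cong: if_cong)

lemma cayley_hamilton_3:
  fixes A :: "complex ^ 3 ^ 3"
  assumes "trace A = r1 + r2 + r3" "minor_sum A = r1 * r2 + r1 * r3 + r2 * r3" "det A = r1 * r2 * r3"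
  shows "(A - mat r1) *v ((A - mat r2) *v ((A - mat r3) *v x)) = 0"
proof -
  have ch: "A *v (A *v (A *v x)) - trace A *s (A *v (A *v x)) + minor_sum A *s (A *v x) - det A *s x = 0"
    unfolding vec_eq_iff forall_3 matrix_vector_mult_def sum_3 trace_def minor_sum_def det_3
      vec_lambda_beta vector_minus_component vector_add_component vector_smult_component zero_index
    by (intro conjI; algebra)
  have "(A - mat r1) *v ((A - mat r2) *v ((A - mat r3) *v x)) =
    A *v (A *v (A *v x)) - (r1 + r2 + r3) *s (A *v (A *v x))
      + (r1 * r2 + r1 * r3 + r2 * r3) *s (A *v x) - (r1 * r2 * r3) *s x"
    unfolding matrix_vector_mult_diff_rdistrib mat_mult_vec matrix_vector_mult_diff_distrib
      vector_scalar_commute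
    by (simp add: vec_eq_iff algebra_simps)
  then show ?thesis
    using ch by (simp only: assms)
qed

text \<open>Apply the three linear factors of the characteristic polynomial to \<open>w\<close> in
  turn: the last nonzero vector obtained is an eigenvector, and every factor preserves
  \<open>W\<close>.\<close>

lemma eigenvector_in_invariant_subspace:
  fixes A :: "complex ^ 3 ^ 3"
  assumes W: "vec.subspace W" "\<And>x. x \<in> W \<Longrightarrow> A *v x \<in> W" and w: "w \<in> W" "w \<noteq> 0"
  obtains r u where "u \<in> W" "u \<noteq> 0" "A *v u = r *s u"
proof -
  obtain r1 r2 r3 where r: "trace A = r1 + r2 + r3" "minor_sum A = r1 * r2 + r1 * r3 + r2 * r3"
    "det A = r1 * r2 * r3"
    using cubic_roots by metis
  have in_W: "(A - mat r) *v x \<in> W" if "x \<in> W" for r x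
    using that W by (simp add: matrix_vector_mult_diff_rdistrib mat_mult_vec vec.subspace_diff vec.subspace_scale)
  have eig: "A *v x = r *s x" if "(A - mat r) *v x = 0" for r x
    using that by (simp add: matrix_vector_mult_diff_rdistrib mat_mult_vec)
  note ch = cayley_hamilton_3[OF r, of w]
  show thesis
  proof (cases "(A - mat r3) *v w = 0")
    case True
    then show ?thesis
      using that eig w by blast
  next
    case w1: False
    show ?thesis
    proof (cases "(A - mat r2) *v ((A - mat r3) *v w) = 0")
      case True
      then show ?thesis
        using that[OF _ w1] eig w in_W by blast
    next
      case w2: False
      then show ?thesis
        using that[OF _ w2] eig[OF ch] w in_W by blast
    qed
  qed
qed

text \<open>On a nonzero invariant subspace of least dimension each member of \<open>F\<close> is a
  scalar, since its eigenspace there is invariant by commutativity. Minimality replaces an induction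
  over \<open>F\<close>, which need not be finite.\<close>

lemma common_eigenvector:
  fixes F :: "(complex ^ 3 ^ 3) set"
  assumes comm: "\<And>A B x. A \<in> F \<Longrightarrow> B \<in> F \<Longrightarrow> A *v (B *v x) = B *v (A *v x)"
    and W: "vec.subspace W" "\<And>A x. A \<in> F \<Longrightarrow> x \<in> W \<Longrightarrow> A *v x \<in> W" "w \<in> W" "w \<noteq> 0"
  obtains v where "v \<in> W" "v \<noteq> 0" "\<And>A. A \<in> F \<Longrightarrow> \<exists>r. A *v v = r *s v"
proof -
  define P where "P U \<longleftrightarrow> vec.subspace U \<and> U \<subseteq> W \<and> (\<forall>A\<in>F. \<forall>x\<in>U. A *v x \<in> U) \<and> (\<exists>x\<in>U. x \<noteq> 0)" for U
  have "P W"
    using W unfolding P_def by auto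
  then have "\<exists>U. P U \<and> (\<forall>U'. P U' \<longrightarrow> vec.dim U \<le> vec.dim U')"
    by (rule ex_has_least_nat)
  then obtain U where U: "P U" and min: "\<And>U'. P U' \<Longrightarrow> vec.dim U \<le> vec.dim U'"
    by (elim exE conjE) (rule that, auto)
  have sU: "vec.subspace U" and UW: "U \<subseteq> W" and inv: "\<And>A x. A \<in> F \<Longrightarrow> x \<in> U \<Longrightarrow> A *v x \<in> U"
    and "\<exists>x\<in>U. x \<noteq> 0"
    using U unfolding P_def by simp_all
  then obtain x where x: "x \<in> U" "x \<noteq> 0"
    by blast
  have scalar: "\<exists>r. \<forall>x\<in>U. A *v x = r *s x" if A: "A \<in> F" for A
  proof -
    obtain r u where u: "u \<in> U" "u \<noteq> 0" "A *v u = r *s u"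
      using eigenvector_in_invariant_subspace[OF sU inv[OF A] x] .
    let ?E = "{x \<in> U. A *v x = r *s x}"
    have sE: "vec.subspace ?E"
    proof (rule vec.subspaceI)
      show "0 \<in> ?E"
        by (simp add: vec.subspace_0[OF sU])
      show "x + y \<in> ?E" if "x \<in> ?E" "y \<in> ?E" for x y
        using that by (simp add: vec.subspace_add[OF sU] matrix_vector_right_distrib vec.scale_right_distrib)
      show "s *s x \<in> ?E" if "x \<in> ?E" for s x
        using that by (simp add: vec.subspace_scale[OF sU] vector_scalar_commute mult.commute)
    qed
    have "B *v x \<in> ?E" if "B \<in> F" "x \<in> ?E" for B x
      using comm[OF A that(1), of x] that inv by (simp add: vector_scalar_commute)
    then have "P ?E"
      unfolding P_def using sE UW u by auto
    then have "?E = U"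
      using min sU sE by (intro vec.subspace_dim_equal) auto
    then show ?thesis
      by blast
  qed
  have "\<exists>r. A *v x = r *s x" if "A \<in> F" for A
    using scalar[OF that] x(1) by blast
  with x UW show thesis
    by (intro that[of x]) auto
qed

section \<open>Flags of ideals\<close>

definition mult_matrix :: "3 structure_constants \<Rightarrow> complex ^ 3 \<Rightarrow> complex ^ 3 ^ 3" where
  "mult_matrix c z = (\<chi> k j. mult_of c z (axis j 1) $ k)"

definition bracket_matrix :: "3 structure_constants \<Rightarrow> complex ^ 3 \<Rightarrow> complex ^ 3 ^ 3" where
  "bracket_matrix c z = (\<chi> k j. bracket_of c z (axis j 1) $ k)"

lemma mult_matrix_vec: "mult_matrix c z *v x = mult_of c z x"
proof -
  have "mult_of c z x = mult_of c z (x$1 *s axis 1 1 + x$2 *s axis 2 1 + x$3 *s axis 3 1)"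
    by (intro arg_cong[where f="mult_of c z"]) (simp add: vec_eq_iff forall_3 axis_component)
  then show ?thesis
    by (simp add: vec_eq_iff bilinear_simps matrix_vector_mult_def mult_matrix_def sum_3 mult.commute)
qed

lemma bracket_matrix_vec: "bracket_matrix c z *v x = bracket_of c z x"
proof -
  have "bracket_of c z x = bracket_of c z (x$1 *s axis 1 1 + x$2 *s axis 2 1 + x$3 *s axis 3 1)"
    by (intro arg_cong[where f="bracket_of c z"]) (simp add: vec_eq_iff forall_3 axis_component)
  then show ?thesis
    by (simp add: vec_eq_iff bilinear_simps matrix_vector_mult_def bracket_matrix_def sum_3 mult.commute)
qed

text \<open>Such a vector spans a one-dimensional ideal of the product.\<close>

definition eigvec :: "3 structure_constants \<Rightarrow> complex ^ 3 \<Rightarrow> bool" where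
  "eigvec c v \<longleftrightarrow> v \<noteq> 0 \<and> (\<forall>z. \<exists>r. mult_of c z v = r *s v)"

lemma mult_left_commute:
  assumes "c \<in> tpa_variety"
  shows "mult_of c x (mult_of c y z) = mult_of c y (mult_of c x z)"
proof -
  have "mult_of c x (mult_of c y z) = mult_of c (mult_of c x y) z"
    by (rule tpa_varietyD(2)[OF assms, symmetric])
  also have "\<dots> = mult_of c (mult_of c y x) z"
    by (subst tpa_varietyD(1)[OF assms, of x y]) (rule refl)
  also have "\<dots> = mult_of c y (mult_of c x z)"
    by (rule tpa_varietyD(2)[OF assms])
  finally show ?thesis .
qed

lemma eigvec_exists:
  assumes "c \<in> tpa_variety"
  obtains v where "eigvec c v"
proof (rule common_eigenvector[of "range (mult_matrix c)" UNIV "axis 1 1"])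
  show "A *v (B *v x) = B *v (A *v x)"
    if "A \<in> range (mult_matrix c)" "B \<in> range (mult_matrix c)" for A B x
    using that by (auto simp: mult_matrix_vec mult_left_commute[OF assms])
  show "thesis" if "v \<noteq> 0" "\<And>A. A \<in> range (mult_matrix c) \<Longrightarrow> \<exists>r. A *v v = r *s v" for v
    using that \<open>\<And>v. eigvec c v \<Longrightarrow> thesis\<close> unfolding eigvec_def by (metis mult_matrix_vec rangeI)
qed (auto simp: axis_eq_0_iff)

text \<open>Bilinear, without conjugation, so that it represents all complex linear functionals and
  makes the transpose the adjoint.\<close>

definition dot :: "complex ^ 3 \<Rightarrow> complex ^ 3 \<Rightarrow> complex" where
  "dot x y = x$1 * y$1 + x$2 * y$2 + x$3 * y$3"

lemma dot_simps: "dot x (y + z) = dot x y + dot x z" "dot x (r *s y) = r * dot x y"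
  "dot (x + z) y = dot x y + dot z y" "dot (r *s x) y = r * dot x y" "dot 0 x = 0" "dot x 0 = 0"
  "dot x (y - z) = dot x y - dot x z"
  by (simp_all add: dot_def algebra_simps)

lemma dot_transpose: "dot (transpose A *v x) y = dot x (A *v y)"
  by (simp add: dot_def transpose_def matrix_vector_mult_def sum_3 algebra_simps)

lemma dot_eqI: "(\<And>y. dot x y = dot x' y) \<Longrightarrow> x = x'"
proof -
  assume "\<And>y. dot x y = dot x' y"
  from this[of "axis 1 1"] this[of "axis 2 1"] this[of "axis 3 1"] show ?thesis
    by (simp add: dot_def axis_component vec_eq_iff forall_3)
qed

lemma cols_surj:
  assumes "invertible (cols u v w)"
  obtains a b c where "x = a *s u + b *s v + c *s w"
  using matrix_inv_vector(1)[OF assms, of x] by (metis cols_mult)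

lemma hyperplane_basis:
  assumes \<xi>: "\<xi> \<noteq> 0" "dot \<xi> v2 = 0" and v2: "v2 \<noteq> 0"
  obtains v1 v3 where "invertible (cols v1 v2 v3)" "dot \<xi> v1 = 0"
    "\<And>x. dot \<xi> x = 0 \<Longrightarrow> \<exists>a b. x = a *s v1 + b *s v2"
proof -
  obtain x where x: "dot \<xi> x \<noteq> 0"
    using dot_eqI[of \<xi> 0] \<xi>(1) by (auto simp: dot_simps)
  define v3 where "v3 = (1 / dot \<xi> x) *s x"
  have v3: "dot \<xi> v3 = 1"
    using x by (simp add: v3_def dot_simps)
  \<comment> \<open>The projection onto the kernel of \<xi> along \<open>v3\<close>. Its image is
    larger than the line of \<open>v2\<close>, since otherwise \<open>v2\<close> and
    \<open>v3\<close> would span the space.\<close>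
  define P where "P y = y - dot \<xi> y *s v3" for y
  have P: "dot \<xi> (P y) = 0" for y
    by (simp add: P_def dot_simps v3)
  have "\<exists>y. \<forall>r. P y \<noteq> r *s v2"
  proof (rule ccontr)
    assume "\<not> ?thesis"
    then obtain r where "\<And>y. P y = r y *s v2"
      by metis
    then have y: "y = r y *s v2 + dot \<xi> y *s v3" for y
      using P_def[of y] by (simp add: eq_diff_eq)
    have "det (cols (a *s v2 + a' *s v3) (b *s v2 + b' *s v3) (c *s v2 + c' *s v3)) = 0" for a a' b b' c c'
      by (simp add: det_cols algebra_simps)
    then have "det (cols (r y1 *s v2 + dot \<xi> y1 *s v3) (r y2 *s v2 + dot \<xi> y2 *s v3)
        (r y3 *s v2 + dot \<xi> y3 *s v3)) = 0" for y1 y2 y3 .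
    from this[of "axis 1 1" "axis 2 1" "axis 3 1"]
    have "det (cols (axis 1 1) (axis 2 1) (axis 3 1)) = 0"
      by (simp only: y[symmetric])
    then show False
      by (simp add: det_cols axis_component)
  qed
  then obtain y where y: "\<And>r. P y \<noteq> r *s v2"
    by blast
  have inv: "invertible (cols (P y) v2 v3)"
    unfolding invertible_cols_iff
  proof (intro allI impI)
    fix a b c assume 0: "a *s P y + b *s v2 + c *s v3 = 0"
    then have "dot \<xi> (a *s P y + b *s v2 + c *s v3) = 0"
      by (simp add: dot_simps)
    then have c: "c = 0"
      by (simp add: dot_simps P \<xi> v3)
    have a: "a = 0"
    proof (rule ccontr)
      assume "a \<noteq> 0"
      have "a *s P y = (- b) *s v2"
        using 0 c by (simp add: eq_neg_iff_add_eq_0)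
      then have "(1 / a) *s (a *s P y) = (1 / a) *s ((- b) *s v2)"
        by simp
      then have "P y = (- b / a) *s v2"
        using \<open>a \<noteq> 0\<close> by (simp only: vector_smult_assoc) (simp add: field_simps)
      then show False
        using y by blast
    qed
    then show "a = 0 \<and> b = 0 \<and> c = 0"
      using 0 c v2 by simp
  qed
  show thesis
  proof (rule that[OF inv P])
    fix x assume x: "dot \<xi> x = 0"
    obtain a b d where abd: "x = a *s P y + b *s v2 + d *s v3"
      using cols_surj[OF inv] by blast
    then have "d = 0"
      using x by (simp add: dot_simps P \<xi> v3)
    then show "\<exists>a b. x = a *s P y + b *s v2"
      using abd by auto
  qed
qed

text \<open>The two-dimensional ideal is the kernel of a common eigenvector of the transposed
  multiplications. Looking for it among the functionals that vanish on \<open>v2\<close> puts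
  \<open>v2\<close> into the ideal.\<close>

lemma flag_exists:
  assumes c: "c \<in> tpa_variety" and v2: "eigvec c v2"
  obtains v1 v3 where "invertible (cols v1 v2 v3)" "\<And>z. \<exists>a b. mult_of c z v1 = a *s v1 + b *s v2"
proof -
  have v20: "v2 \<noteq> 0" and eig: "\<And>z. \<exists>r. mult_of c z v2 = r *s v2"
    using v2 unfolding eigvec_def by auto
  obtain w where w: "dot w v2 = 0" "w \<noteq> 0"
  proof (cases "v2 $ 1 = 0")
    case True
    then show ?thesis
      using that[of "axis 1 1"] by (simp add: dot_def axis_component axis_eq_0_iff)
  next
    case False
    then show ?thesis
      using that[of "vector [- v2$2, v2$1, 0]"] by (simp add: dot_def vec_eq_iff forall_3)
  qed
  have tr: "transpose (mult_matrix c y) *v (transpose (mult_matrix c z) *v x) =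
      transpose (mult_matrix c z) *v (transpose (mult_matrix c y) *v x)" for x y z
    by (rule dot_eqI) (simp only: dot_transpose mult_matrix_vec mult_left_commute[OF c, of y z])
  obtain \<xi> where \<xi>: "\<xi> \<in> {x. dot x v2 = 0}" "\<xi> \<noteq> 0"
    "\<And>A. A \<in> (\<lambda>z. transpose (mult_matrix c z)) ` UNIV \<Longrightarrow> \<exists>r. A *v \<xi> = r *s \<xi>"
  proof (rule common_eigenvector[of "(\<lambda>z. transpose (mult_matrix c z)) ` UNIV" "{x. dot x v2 = 0}" w])
    show "A *v (B *v x) = B *v (A *v x)"
      if "A \<in> (\<lambda>z. transpose (mult_matrix c z)) ` UNIV" "B \<in> (\<lambda>z. transpose (mult_matrix c z)) ` UNIV" for A B x
      using that by (elim imageE) (simp only: tr)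
    show "vec.subspace {x. dot x v2 = 0}"
      by (simp add: vec.subspace_def dot_simps)
    show "A *v x \<in> {x. dot x v2 = 0}"
      if "A \<in> (\<lambda>z. transpose (mult_matrix c z)) ` UNIV" "x \<in> {x. dot x v2 = 0}" for A x
    proof -
      note A = that(1)
      obtain z where "A = transpose (mult_matrix c z)"
        using A by auto
      moreover obtain r where "mult_of c z v2 = r *s v2"
        using eig by blast
      ultimately show ?thesis
        using that(2) by (simp add: dot_transpose mult_matrix_vec dot_simps del: transpose_matrix_vector)
    qed
  qed (use w in auto)
  obtain v1 v3 where v: "invertible (cols v1 v2 v3)" "dot \<xi> v1 = 0"
    "\<And>x. dot \<xi> x = 0 \<Longrightarrow> \<exists>a b. x = a *s v1 + b *s v2"
    by (rule hyperplane_basis[OF \<xi>(2) _ v20]) (use \<xi>(1) in auto)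
  show thesis
  proof (rule that[OF v(1)])
    fix z
    obtain r where r: "transpose (mult_matrix c z) *v \<xi> = r *s \<xi>"
      using \<xi>(3) by blast
    have "dot \<xi> (mult_of c z v1) = dot (transpose (mult_matrix c z) *v \<xi>) v1"
      by (simp add: dot_transpose mult_matrix_vec del: transpose_matrix_vector)
    also have "\<dots> = 0"
      unfolding r by (simp add: dot_simps v(2))
    finally show "\<exists>a b. mult_of c z v1 = a *s v1 + b *s v2"
      by (rule v(3))
  qed
qed


text \<open>A basis adapted to the ideals span(e_2) and span(e_1, e_2). The diagonal entries are
  characters of the algebra: the \<open>l\<close> values on e_2, the \<open>x\<close> values on e_1
  modulo e_2, and \<open>k\<close> for e_3 on the last quotient.\<close>

abbreviation flag_nf where
  "flag_nf x1 a1 l1 x3 a3 l2 l3 w1 w2 k b12 b13 b23 \<equiv> nf (vector [x1,a1,0]) (vector [0,l1,0]) (vector [x3,a3,0])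
     (vector [0,l2,0]) (vector [0,l3,0]) (vector [w1,w2,k]) b12 b13 b23"

lemma flag_products:
  assumes c: "c \<in> tpa_variety" and v2: "eigvec c v2"
  obtains v1 v3 x1 a1 l1 x3 a3 l2 l3 w1 w2 k where "invertible (cols v1 v2 v3)"
    "mult_of c v1 v1 = x1 *s v1 + a1 *s v2" "mult_of c v1 v2 = l1 *s v2"
    "mult_of c v1 v3 = x3 *s v1 + a3 *s v2" "mult_of c v2 v2 = l2 *s v2" "mult_of c v2 v3 = l3 *s v2"
    "mult_of c v3 v3 = w1 *s v1 + w2 *s v2 + k *s v3"
proof -
  obtain v1 v3 where inv: "invertible (cols v1 v2 v3)" and v1: "\<And>z. \<exists>a b. mult_of c z v1 = a *s v1 + b *s v2"
    using flag_exists[OF c v2] by blast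
  have e: "\<exists>r. mult_of c z v2 = r *s v2" for z
    using v2 unfolding eigvec_def by blast
  obtain x1 a1 where 11: "mult_of c v1 v1 = x1 *s v1 + a1 *s v2"
    using v1 by blast
  obtain x3 a3 where "mult_of c v3 v1 = x3 *s v1 + a3 *s v2"
    using v1 by blast
  then have 13: "mult_of c v1 v3 = x3 *s v1 + a3 *s v2"
    by (simp only: tpa_varietyD(1)[OF c, of v1 v3])
  obtain l1 where 12: "mult_of c v1 v2 = l1 *s v2"
    using e by blast
  obtain l2 where 22: "mult_of c v2 v2 = l2 *s v2"
    using e by blast
  obtain l3 where "mult_of c v3 v2 = l3 *s v2"
    using e by blast
  then have 23: "mult_of c v2 v3 = l3 *s v2"
    by (simp only: tpa_varietyD(1)[OF c, of v2 v3])
  obtain w1 w2 k where 33: "mult_of c v3 v3 = w1 *s v1 + w2 *s v2 + k *s v3"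
    using cols_surj[OF inv] by blast
  show thesis
    by (rule that[OF inv 11 12 13 22 23 33])
qed

section \<open>Algebras with zero bracket\<close>

lemma flag_nf_exists:
  assumes c: "c \<in> tpa_variety" and b: "\<And>x y. bracket_of c x y = 0" and v2: "eigvec c v2"
  obtains v1 v3 x1 a1 l1 x3 a3 l2 l3 w1 w2 k where "invertible (cols v1 v2 v3)"
    "c = gl_act (cols v1 v2 v3) (flag_nf x1 a1 l1 x3 a3 l2 l3 w1 w2 k 0 0 0)" "mult_of c v2 v2 = l2 *s v2"
proof -
  obtain v1 v3 x1 a1 l1 x3 a3 l2 l3 w1 w2 k where inv: "invertible (cols v1 v2 v3)" and
    m: "mult_of c v1 v1 = x1 *s v1 + a1 *s v2" "mult_of c v1 v2 = l1 *s v2"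
    "mult_of c v1 v3 = x3 *s v1 + a3 *s v2" "mult_of c v2 v2 = l2 *s v2" "mult_of c v2 v3 = l3 *s v2"
    "mult_of c v3 v3 = w1 *s v1 + w2 *s v2 + k *s v3"
    by (rule flag_products[OF c v2])
  have "c = gl_act (cols v1 v2 v3) (flag_nf x1 a1 l1 x3 a3 l2 l3 w1 w2 k 0 0 0)"
    by (rule gl_act_nf[OF sym_alt_tpa[OF c] inv]) (simp_all add: m b cols_mult)
  then show thesis
    using that inv m(4) by blast
qed

text \<open>The first four equations express multiplicativity of the characters on e_2 and on e_1
  modulo e_2; the last two compare coefficients of e_2.\<close>

lemma flag_nf_assoc:
  assumes "flag_nf x1 a1 l1 x3 a3 l2 l3 w1 w2 k b12 b13 b23 \<in> tpa_variety"
  shows "x1 * l1 + a1 * l2 = l1 ^ 2" "x3 * l1 + a3 * l2 = l1 * l3" "k * l3 + w1 * l1 + w2 * l2 = l3 ^ 2"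
    "x3 ^ 2 = w1 * x1 + k * x3" "x1 * a3 + a1 * l3 = x3 * a1 + a3 * l1"
    "x3 * a3 + a3 * l3 = w1 * a1 + w2 * l1 + k * a3"
proof -
  note A = tpa_varietyD(2)[OF assms]
  let ?e1 = "vector [1,0,0] :: complex ^ 3" and ?e2 = "vector [0,1,0] :: complex ^ 3"
    and ?e3 = "vector [0,0,1] :: complex ^ 3"
  show "x1 * l1 + a1 * l2 = l1 ^ 2"
    using A[of ?e1 ?e1 ?e2] by (simp add: mult_of_nf vec_eq_iff forall_3 power2_eq_square)
  show "x3 * l1 + a3 * l2 = l1 * l3"
    using A[of ?e1 ?e3 ?e2] by (simp add: mult_of_nf vec_eq_iff forall_3 power2_eq_square algebra_simps)
  show "k * l3 + w1 * l1 + w2 * l2 = l3 ^ 2"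
    using A[of ?e3 ?e3 ?e2] by (simp add: mult_of_nf vec_eq_iff forall_3 power2_eq_square algebra_simps)
  show "x3 ^ 2 = w1 * x1 + k * x3" "x3 * a3 + a3 * l3 = w1 * a1 + w2 * l1 + k * a3"
    using A[of ?e1 ?e3 ?e3] by (simp_all add: mult_of_nf vec_eq_iff forall_3 power2_eq_square algebra_simps)
  show "x1 * a3 + a1 * l3 = x3 * a1 + a3 * l1"
    using A[of ?e1 ?e1 ?e3] by (simp add: mult_of_nf vec_eq_iff forall_3 power2_eq_square algebra_simps)
qed

text \<open>An eigenvector with nonzero square is a multiple of an idempotent which splits off as a direct
  summand; the complement is the kernel of its character.\<close>

lemma covered_if_idempotent:
  assumes c: "c \<in> tpa_variety" and b: "\<And>x y. bracket_of c x y = 0"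
    and v2: "eigvec c v2" "mult_of c v2 v2 \<noteq> 0"
  shows "c \<in> covered"
proof -
  obtain v1 v3 x1 a1 l1 x3 a3 l2 l3 w1 w2 k where inv: "invertible (cols v1 v2 v3)"
    and eq: "c = gl_act (cols v1 v2 v3) (flag_nf x1 a1 l1 x3 a3 l2 l3 w1 w2 k 0 0 0)" and "mult_of c v2 v2 = l2 *s v2"
    using flag_nf_exists[OF c b v2(1)] by blast
  then have l2: "l2 \<noteq> 0"
    using v2(2) by auto
  let ?N = "flag_nf x1 a1 l1 x3 a3 l2 l3 w1 w2 k 0 0 0"
  have "?N = gl_act (matrix_inv (cols v1 v2 v3)) c"
    unfolding eq by (simp add: gl_act_inverse inv)
  then have N: "?N \<in> tpa_variety"
    using tpa_variety_gl_act[OF invertible_matrix_inv[OF inv] c] by simp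
  note A = flag_nf_assoc[OF N]
  have a1: "a1 = (l1 ^ 2 - x1 * l1) / l2" and a3: "a3 = (l1 * l3 - x3 * l1) / l2"
    and w2: "w2 = (l3 ^ 2 - k * l3 - w1 * l1) / l2"
    using A(1-3) l2 by (simp_all add: field_simps)
  have "?N \<in> covered"
  proof (cases "x1 = 0")
    case False
    \<comment> \<open>Put f_i = e_i - (l_i/l2) e_2, which lies in the kernel of the character on
      e_2. Then \<open>?u3\<close> is f_3 - (x3/x1) f_1, which annihilates f_1.\<close>
    let ?u1 = "vector [1, -l1/l2, 0] :: complex ^ 3" and ?u2 = "vector [0,1,0] :: complex ^ 3"
      and ?u3 = "vector [-x3/x1, -l3/l2 + (x3/x1) * (l1/l2), 1] :: complex ^ 3"
    have w1: "w1 = (x3 ^ 2 - k * x3) / x1"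
      using A(4) False by (simp add: field_simps)
    show ?thesis
    proof (rule covered_T20I[of _ ?u1 ?u2 ?u3 x1 l2 k])
      show "invertible (cols ?u1 ?u2 ?u3)"
        by (simp add: invertible_det_nz det_cols)
    qed (use False l2 in \<open>simp_all add: mult_of_nf bracket_of_nf vec_eq_iff forall_3 a1 a3 w2 w1 field_simps power2_eq_square\<close>)
  next
    case x1: True
    then have "x3 = k \<or> x3 = 0 \<and> k \<noteq> 0"
      using A(4) by (auto simp: power2_eq_square)
    then show ?thesis
    proof (elim disjE conjE)
      assume x3: "x3 = k"
      let ?u1 = "vector [1, -l1/l2, 0] :: complex ^ 3" and ?u2 = "vector [0,1,0] :: complex ^ 3"
        and ?u3 = "vector [0, -l3/l2, 1] :: complex ^ 3"
      show ?thesis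
      proof (rule covered_T17I[of _ ?u1 ?u2 ?u3 k l2 0 w1 0 0])
        show "invertible (cols ?u1 ?u2 ?u3)"
          by (simp add: invertible_det_nz det_cols)
      qed (use l2 in \<open>simp_all add: mult_of_nf bracket_of_nf vec_eq_iff forall_3 a1 a3 w2 x3 x1 field_simps power2_eq_square\<close>)
    next
      assume x3: "x3 = 0" and k: "k \<noteq> 0"
      \<comment> \<open>Now f_1 has zero product with f_1 and f_3, and \<open>?u3\<close> is the
        square of f_3 divided by \<open>k\<close>.\<close>
      let ?u1 = "vector [1, -l1/l2, 0] :: complex ^ 3" and ?u2 = "vector [0,1,0] :: complex ^ 3"
        and ?u3 = "vector [w1/k, -l3/l2 - (w1/k) * (l1/l2), 1] :: complex ^ 3"
      show ?thesis
      proof (rule covered_T20I[of _ ?u1 ?u2 ?u3 0 l2 k])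
        show "invertible (cols ?u1 ?u2 ?u3)"
          by (simp add: invertible_det_nz det_cols)
      qed (use l2 k in \<open>simp_all add: mult_of_nf bracket_of_nf vec_eq_iff forall_3 a1 a3 w2 x3 x1 field_simps power2_eq_square\<close>)
    qed
  qed
  then show ?thesis
    unfolding eq using gl_act_covered_iff[OF inv] by blast
qed

lemma covered_if_bracket_zero:
  assumes c: "c \<in> tpa_variety" and b: "\<And>x y. bracket_of c x y = 0"
  shows "c \<in> covered"
proof -
  obtain v2 where v2: "eigvec c v2"
    using eigvec_exists[OF c] by blast
  show ?thesis
  proof (cases "mult_of c v2 v2 = 0")
    case False
    then show ?thesis
      using covered_if_idempotent[OF c b v2] by blast
  next
    case True
    obtain v1 v3 x1 a1 l1 x3 a3 l2 l3 w1 w2 k where inv: "invertible (cols v1 v2 v3)"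
      and eq: "c = gl_act (cols v1 v2 v3) (flag_nf x1 a1 l1 x3 a3 l2 l3 w1 w2 k 0 0 0)" and "mult_of c v2 v2 = l2 *s v2"
      using flag_nf_exists[OF c b v2(1)] by blast
    then have l2: "l2 = 0"
      using v2 True unfolding eigvec_def by auto
    define N where "N = flag_nf x1 a1 l1 x3 a3 0 l3 w1 w2 k 0 0 0"
    have "N = gl_act (matrix_inv (cols v1 v2 v3)) c"
      unfolding eq N_def l2 by (simp add: gl_act_inverse inv)
    then have N: "N \<in> tpa_variety"
      using tpa_variety_gl_act[OF invertible_matrix_inv[OF inv] c] by simp
    note A = flag_nf_assoc[OF N[unfolded N_def], simplified]
    have Nb: "bracket_of N x y = 0" for x y
      by (simp add: N_def bracket_of_nf)
    note simps = N_def mult_of_nf bracket_of_nf vec_eq_iff forall_3 field_simps power2_eq_square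
    have idem: "N \<in> covered" if "eigvec N v" "mult_of N v v \<noteq> 0" for v
      using covered_if_idempotent[OF N Nb that] .
    have "N \<in> covered"
    proof (cases "x1 = 0")
      case x1: False
      show ?thesis
      proof (cases "l1 = 0")
        case l1: True
        \<comment> \<open>The square of e_1 divided by \<open>x1\<close>. It is an eigenvector with
          nonzero square, so the idempotent case applies.\<close>
        let ?v = "vector [1, a1/x1, 0] :: complex ^ 3"
        have a3: "a3 = (x3 * a1 - a1 * l3) / x1"
          using A(5) x1 l1 by (simp add: field_simps)
        have "mult_of N z ?v = (z$1 * x1 + z$3 * x3) *s ?v" for z
          using x1 by (simp add: simps l1 a3)
        moreover have "?v \<noteq> 0"
          by (simp add: vec_eq_iff forall_3)
        ultimately have "eigvec N ?v"
          unfolding eigvec_def by blast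
        moreover have "mult_of N ?v ?v $ 1 \<noteq> 0"
          using x1 by (simp add: simps l1)
        ultimately show ?thesis
          by (intro idem[of ?v]) auto
      next
        case False
        then have l1: "l1 = x1"
          using A(1) by (simp add: power2_eq_square)
        then have l3: "l3 = x3"
          using A(2) x1 by simp
        have w1: "w1 = (x3 ^ 2 - k * x3) / x1"
          using A(4) x1 by (simp add: field_simps)
        have w2: "w2 = (2 * x3 * a3 - k * a3 - w1 * a1) / x1"
          using A(6) x1 by (simp add: field_simps l1 l3)
        \<comment> \<open>\<open>?u3\<close> divided by \<open>x1\<close> is a unit for the plane of
          e_1 and e_2, and \<open>?u2\<close> spans its annihilator: the algebra is a direct
          sum.\<close>
        let ?u1 = "vector [0,1,0] :: complex ^ 3"
          and ?u2 = "vector [-x3/x1, (x3/x1) * (a1/x1) - a3/x1, 1] :: complex ^ 3"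
          and ?u3 = "vector [1, -a1/x1, 0] :: complex ^ 3"
        show ?thesis
        proof (rule covered_T17I[of _ ?u1 ?u2 ?u3 x1 k 0 0 0 0])
          show "invertible (cols ?u1 ?u2 ?u3)"
            by (simp add: invertible_det_nz det_cols)
        qed (use x1 sym_alt_tpa[OF N] in \<open>simp_all add: simps w2 w1 l1 l3\<close>)
      qed
    next
      case x1: True
      then have l1: "l1 = 0"
        using A(1) by simp
      \<comment> \<open>Multiplicativity on the square of e_3 leaves each of the first two
        characters zero or equal to the third.\<close>
      have x3: "x3 = 0 \<or> x3 = k" and l3: "l3 = 0 \<or> l3 = k"
        using A(3,4) by (auto simp: x1 l1 power2_eq_square)
      have a1: "a1 * l3 = x3 * a1" and a3: "x3 * a3 + a3 * l3 = w1 * a1 + k * a3"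
        using A(5,6) by (simp_all add: x1 l1)
      consider "x3 = k" "l3 = k" | "x3 = 0" "l3 = 0" "k \<noteq> 0" | "x3 = k" "l3 = 0" "k \<noteq> 0"
        | "x3 = 0" "l3 = k" "k \<noteq> 0"
        using x3 l3 by blast
      then show ?thesis
      proof cases
        case 1
        let ?u1 = "vector [1,0,0] :: complex ^ 3" and ?u2 = "vector [0,1,0] :: complex ^ 3"
          and ?u3 = "vector [0,0,1] :: complex ^ 3"
        show ?thesis
        proof (rule covered_T12I[of _ ?u1 ?u2 ?u3 a1 k a3 w1 w2 0 0])
          show "invertible (cols ?u1 ?u2 ?u3)"
            by (simp add: invertible_det_nz det_cols)
          show "w1 * a1 = a3 * k"
            using a3 1 by (simp add: algebra_simps)
        qed (use sym_alt_tpa[OF N] in \<open>simp_all add: simps x1 l1 1\<close>)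
      next
        case 2
        \<comment> \<open>The cube of e_3 divided by the square of \<open>k\<close>.\<close>
        let ?v = "vector [w1/k, (w2 + (w1/k) * a3)/k, 1] :: complex ^ 3"
        have a3': "a3 = - (w1 * a1) / k"
          using a3 2 by (simp add: field_simps eq_neg_iff_add_eq_0)
        have "mult_of N z ?v = (z$3 * k) *s ?v" for z
          using 2(3) by (simp add: simps l1 x1 2(1,2) a3')
        moreover have "?v \<noteq> 0"
          by (simp add: vec_eq_iff forall_3)
        ultimately have "eigvec N ?v"
          unfolding eigvec_def by blast
        moreover have "mult_of N ?v ?v $ 3 \<noteq> 0"
          using 2(3) by (simp add: simps)
        ultimately show ?thesis
          by (intro idem[of ?v]) auto
      next
        case 3
        then have a1: "a1 = 0"
          using a1 by simp
        \<comment> \<open>Multiplication by e_3 has distinct eigenvalues on the plane, so e_1 can be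
          corrected to an eigenvector.\<close>
        let ?u1 = "vector [1, a3/k, 0] :: complex ^ 3" and ?u2 = "vector [0,1,0] :: complex ^ 3"
          and ?u3 = "vector [0,0,1] :: complex ^ 3"
        show ?thesis
        proof (rule covered_T17I[of _ ?u1 ?u2 ?u3 k 0 0 w1 "w2 - w1 * a3 / k" 0])
          show "invertible (cols ?u1 ?u2 ?u3)"
            by (simp add: invertible_det_nz det_cols)
        qed (use sym_alt_tpa[OF N] 3 in \<open>simp_all add: simps x1 l1 a1\<close>)
      next
        case 4
        then have a1: "a1 = 0"
          using a1 by simp
        \<comment> \<open>The eigenvalues are exchanged, and with them the roles of the first two
          basis vectors.\<close>
        let ?u1 = "vector [0,1,0] :: complex ^ 3" and ?u2 = "vector [1, -a3/k, 0] :: complex ^ 3"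
          and ?u3 = "vector [0,0,1] :: complex ^ 3"
        show ?thesis
        proof (rule covered_T17I[of _ ?u1 ?u2 ?u3 k 0 0 "w2 + w1 * a3 / k" w1 0])
          show "invertible (cols ?u1 ?u2 ?u3)"
            by (simp add: invertible_det_nz det_cols)
        qed (use sym_alt_tpa[OF N] 4 in \<open>simp_all add: simps x1 l1 a1\<close>)
      qed
    qed
    then show ?thesis
      unfolding eq l2 N_def using gl_act_covered_iff[OF inv] by blast
  qed
qed

section \<open>Degenerate brackets\<close>

text \<open>Prescribes the brackets only; the products stay unknown until the Leibniz rule
  determines them.\<close>

lemma gl_act_nf_bracket:
  assumes c: "sym_alt c" and inv: "invertible (cols v1 v2 v3)"
    and b: "bracket_of c v1 v2 = cols v1 v2 v3 *v b12" "bracket_of c v1 v3 = cols v1 v2 v3 *v b13"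
      "bracket_of c v2 v3 = cols v1 v2 v3 *v b23"
  obtains a11 a12 a13 a22 a23 a33 where "c = gl_act (cols v1 v2 v3) (nf a11 a12 a13 a22 a23 a33 b12 b13 b23)"
  by (rule that[OF gl_act_nf[OF c inv _ _ _ _ _ _ b]]; rule matrix_inv_vector(1)[OF inv, symmetric])

text \<open>The matrix of the bracket on bivectors in the basis e_2 ^ e_3, e_3 ^ e_1, e_1 ^ e_2, in
  which the wedge of two vectors is their cross product.\<close>

definition bracket_dual :: "3 structure_constants \<Rightarrow> complex ^ 3 ^ 3" where
  "bracket_dual c = cols (bracket_of c (axis 2 1) (axis 3 1)) (bracket_of c (axis 3 1) (axis 1 1))
     (bracket_of c (axis 1 1) (axis 2 1))"

text \<open>In dimension three every bivector is the wedge of two vectors; apply this to a nonzero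
  bivector in the kernel.\<close>

lemma commuting_pair_exists:
  assumes c: "sym_alt c" and d: "det (bracket_dual c) = 0"
  obtains u v w where "invertible (cols u v w)" "bracket_of c u v = 0"
proof -
  let ?e1 = "axis 1 1 :: complex ^ 3" and ?e2 = "axis 2 1 :: complex ^ 3" and ?e3 = "axis 3 1 :: complex ^ 3"
  have "\<not> invertible (bracket_dual c)"
    using d by (simp add: invertible_det_nz)
  then obtain x1 x2 x3 where x: "x1 *s bracket_of c ?e2 ?e3 + x2 *s bracket_of c ?e3 ?e1 + x3 *s bracket_of c ?e1 ?e2 = 0"
    "x1 \<noteq> 0 \<or> x2 \<noteq> 0 \<or> x3 \<noteq> 0"
    unfolding bracket_dual_def invertible_cols_iff by blast
  let ?S = "x1 *s bracket_of c ?e2 ?e3 + x2 *s bracket_of c ?e3 ?e1 + x3 *s bracket_of c ?e1 ?e2"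
  have s: "bracket_of c x y = - bracket_of c y x" for x y
    using c unfolding sym_alt_def by blast
  have s0: "bracket_of c x x = 0" for x
    using s[of x x] by (simp add: vec_eq_iff)
  note sw = s[of ?e3 ?e2] s[of ?e2 ?e1] s[of ?e1 ?e3]
  consider "x1 \<noteq> 0" | "x2 \<noteq> 0" | "x3 \<noteq> 0"
    using x(2) by blast
  then show thesis
  proof cases
    case 1
    \<comment> \<open>The two arguments are chosen to have cross product (x1, x2, x3); the other
      cases follow by cyclic rotation.\<close>
    have "bracket_of c (?e2 + (- x2/x1) *s ?e1) (x1 *s ?e3 + (- x3) *s ?e1) = ?S"
      unfolding bilinear_simps sw s0 using 1 by (simp add: vec_eq_iff algebra_simps)
    also have "?S = 0"
      by (rule x(1))
    finally have "bracket_of c (?e2 + (- x2/x1) *s ?e1) (x1 *s ?e3 + (- x3) *s ?e1) = 0" .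
    moreover have "invertible (cols (?e2 + (- x2/x1) *s ?e1) (x1 *s ?e3 + (- x3) *s ?e1) ?e1)"
      using 1 by (simp add: invertible_det_nz det_cols axis_component)
    ultimately show ?thesis
      using that by blast
  next
    case 2
    have "bracket_of c (?e3 + (- x3/x2) *s ?e2) (x2 *s ?e1 + (- x1) *s ?e2) = ?S"
      unfolding bilinear_simps sw s0 using 2 by (simp add: vec_eq_iff algebra_simps)
    also have "?S = 0"
      by (rule x(1))
    finally have "bracket_of c (?e3 + (- x3/x2) *s ?e2) (x2 *s ?e1 + (- x1) *s ?e2) = 0" .
    moreover have "invertible (cols (?e3 + (- x3/x2) *s ?e2) (x2 *s ?e1 + (- x1) *s ?e2) ?e2)"
      using 2 by (simp add: invertible_det_nz det_cols axis_component)
    ultimately show ?thesis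
      using that by blast
  next
    case 3
    have "bracket_of c (?e1 + (- x1/x3) *s ?e3) (x3 *s ?e2 + (- x2) *s ?e3) = ?S"
      unfolding bilinear_simps sw s0 using 3 by (simp add: vec_eq_iff algebra_simps)
    also have "?S = 0"
      by (rule x(1))
    finally have "bracket_of c (?e1 + (- x1/x3) *s ?e3) (x3 *s ?e2 + (- x2) *s ?e3) = 0" .
    moreover have "invertible (cols (?e1 + (- x1/x3) *s ?e3) (x3 *s ?e2 + (- x2) *s ?e3) ?e3)"
      using 3 by (simp add: invertible_det_nz det_cols axis_component)
    ultimately show ?thesis
      using that by blast
  qed
qed

lemma vector_3_zero: "vector [0,0,0] = (0 :: complex ^ 3)"
  by (simp add: vec_eq_iff forall_3)

abbreviation tri_nf where
  "tri_nf a11 a12 a13 a22 a23 a33 m1 n m2 \<equiv>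
     nf a11 a12 a13 a22 a23 a33 0 (vector [m1,n,0]) (vector [0,m2,0])"

lemma tri_nf_exists:
  assumes N: "nf a11 a12 a13 a22 a23 a33 0 b13 b23 \<in> tpa_variety"
  obtains v1 v2 v3 m1 n m2 a11' a12' a13' a22' a23' a33' where "invertible (cols v1 v2 v3)"
    "nf a11 a12 a13 a22 a23 a33 0 b13 b23 = gl_act (cols v1 v2 v3) (tri_nf a11' a12' a13' a22' a23' a33' m1 n m2)"
proof -
  note res = that
  define N where "N = nf a11 a12 a13 a22 a23 a33 0 b13 b23"
  have sa: "sym_alt N"
    by (simp add: N_def)
  have br: "bracket_of N x y = (x$1 * y$3 - x$3 * y$1) *s b13 + (x$2 * y$3 - x$3 * y$2) *s b23" for x y
    by (simp add: N_def bracket_of_nf)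
  let ?e1 = "vector [1,0,0] :: complex ^ 3" and ?e2 = "vector [0,1,0] :: complex ^ 3"
    and ?e3 = "vector [0,0,1] :: complex ^ 3"
  have goal: thesis if "invertible (cols v1 v2 v3)" "bracket_of N v1 v2 = 0"
    "bracket_of N v1 v3 = m1 *s v1 + n *s v2" "bracket_of N v2 v3 = m2 *s v2" for v1 v2 v3 m1 n m2
  proof -
    note h = that
    obtain a11' a12' a13' a22' a23' a33' where
      "N = gl_act (cols v1 v2 v3) (tri_nf a11' a12' a13' a22' a23' a33' m1 n m2)"
      by (rule gl_act_nf_bracket[OF sa h(1), of 0 "vector [m1,n,0]" "vector [0,m2,0]"])
        (simp_all add: cols_mult h)
    then show thesis
      unfolding N_def by (rule res[OF h(1)])
  qed
  \<comment> \<open>In the Jacobi identity for e_1, e_2, e_3 only two terms survive. If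
    \<open>b13\<close> or \<open>b23\<close> leaves the plane of e_1 and e_2, the identity makes
    them linearly dependent.\<close>
  have jac: "b23 $ 3 *s b13 = b13 $ 3 *s b23"
    using tpa_varietyD(4)[OF N, of ?e1 ?e2 ?e3]
    by (simp add: bracket_of_nf vec_eq_iff forall_3 algebra_simps)
  consider "b13 $ 3 = 0" "b23 $ 3 = 0" | "b23 $ 3 \<noteq> 0" | "b13 $ 3 \<noteq> 0" "b23 $ 3 = 0"
    by blast
  then show thesis
  proof cases
    case 1
    let ?W = "{x :: complex ^ 3. x $ 3 = 0}"
    obtain r u where u: "u \<in> ?W" "u \<noteq> 0" "bracket_matrix N ?e3 *v u = r *s u"
    proof (rule eigenvector_in_invariant_subspace[of ?W "bracket_matrix N ?e3" ?e1])
      show "vec.subspace ?W"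
        by (simp add: vec.subspace_def)
    qed (use 1 in \<open>auto simp: bracket_matrix_vec br vec_eq_iff forall_3\<close>)
    then have u3: "u $ 3 = 0" and "bracket_of N ?e3 u = r *s u"
      by (simp_all add: bracket_matrix_vec)
    moreover have "bracket_of N u ?e3 = - bracket_of N ?e3 u"
      using sa unfolding sym_alt_def by blast
    ultimately have eig: "bracket_of N u ?e3 = (- r) *s u"
      by (simp add: vec_eq_iff)
    show thesis
    proof (cases "u $ 2 = 0")
      case False
      show thesis
      proof (rule goal[of ?e1 u ?e3 "b13$1 - b13$2 / u$2 * u$1" "b13$2 / u$2" "-r"])
        show "invertible (cols ?e1 u ?e3)"
          using False by (simp add: invertible_det_nz det_cols)
      qed (use False 1 u3 eig in \<open>simp_all add: br vec_eq_iff forall_3\<close>)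
    next
      case True
      then have u1: "u $ 1 \<noteq> 0"
        using u u3 by (auto simp: vec_eq_iff forall_3)
      show thesis
      proof (rule goal[of ?e2 u ?e3 "b23$2" "b23$1 / u$1" "-r"])
        show "invertible (cols ?e2 u ?e3)"
          using u1 by (simp add: invertible_det_nz det_cols)
      qed (use u1 True 1 u3 eig in \<open>simp_all add: br vec_eq_iff forall_3\<close>)
    qed
  next
    case 2
    \<comment> \<open>\<open>?w\<close> is central, and \<open>b23\<close> spans the derived
      algebra.\<close>
    let ?w = "vector [b23$3, - b13$3, 0] :: complex ^ 3"
    show thesis
    proof (rule goal[of ?w b23 ?e2 0 0 "- b23$3"])
      show "invertible (cols ?w b23 ?e2)"
        using 2 by (simp add: invertible_det_nz det_cols)
    qed (use jac 2 in \<open>simp_all add: br vec_eq_iff forall_3 algebra_simps\<close>)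
  next
    case 3
    then have b23: "b23 = 0"
      using jac by simp
    show thesis
    proof (rule goal[of ?e2 b13 ?e1 0 0 "- b13$3"])
      show "invertible (cols ?e2 b13 ?e1)"
        using 3 by (simp add: invertible_det_nz det_cols)
    qed (use 3 b23 in \<open>simp_all add: br vec_eq_iff forall_3\<close>)
  qed
qed

lemma tpa_if_gl_act: "c = gl_act g d \<Longrightarrow> invertible g \<Longrightarrow> c \<in> tpa_variety \<Longrightarrow> d \<in> tpa_variety"
  using tpa_variety_gl_act[of "matrix_inv g" c] by (simp add: gl_act_inverse invertible_matrix_inv)

text \<open>\<open>A z\<close>, \<open>B z\<close>, \<open>C z\<close> are the columns of
  multiplication by \<open>z\<close>; the equations are the coordinates of the Leibniz rule on the
  pairs (e_1, e_3), (e_2, e_3), (e_1, e_2).\<close>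

lemma tri_nf_leibniz:
  assumes N: "N = tri_nf a11 a12 a13 a22 a23 a33 m1 n m2" "N \<in> tpa_variety"
  defines "A z \<equiv> mult_of N z (vector [1,0,0])" and "B z \<equiv> mult_of N z (vector [0,1,0])"
    and "C z \<equiv> mult_of N z (vector [0,0,1])"
  shows "2 * (m1 * A z $ 1 + n * B z $ 1) = A z $ 1 * m1 + C z $ 3 * m1"
    "2 * (m1 * A z $ 2 + n * B z $ 2) = A z $ 1 * n + A z $ 2 * m2 + C z $ 3 * n"
    "2 * m1 * A z $ 3 + 2 * n * B z $ 3 = 0"
    "2 * (m2 * B z $ 1) = B z $ 1 * m1"
    "2 * (m2 * B z $ 2) = B z $ 1 * n + B z $ 2 * m2 + C z $ 3 * m2"
    "m2 * B z $ 3 = 0" "B z $ 3 * m1 = 0" "A z $ 3 * m2 = B z $ 3 * n"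
proof -
  let ?e1 = "vector [1,0,0] :: complex ^ 3" and ?e2 = "vector [0,1,0] :: complex ^ 3"
    and ?e3 = "vector [0,0,1] :: complex ^ 3"
  have b: "bracket_of N x y = (x$1 * y$3 - x$3 * y$1) *s (m1 *s ?e1 + n *s ?e2)
      + (x$2 * y$3 - x$3 * y$2) *s (m2 *s ?e2)" for x y
    by (simp add: N(1) bracket_of_nf vec_eq_iff forall_3 algebra_simps)
  note L = tpa_varietyD(5)[OF N(2), of z]
  have "2 *s (m1 *s A z + n *s B z) = bracket_of N (A z) ?e3 + bracket_of N ?e1 (C z)"
    using L[of ?e1 ?e3] unfolding A_def B_def C_def b[of ?e1 ?e3] by (simp add: bilinear_simps)
  then have "m1 * A z $ 1 + 2 * n * B z $ 1 = C z $ 3 * m1 \<and>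
     2 * m1 * A z $ 2 + 2 * n * B z $ 2 = A z $ 1 * n + A z $ 2 * m2 + C z $ 3 * n \<and>
     2 * m1 * A z $ 3 + 2 * n * B z $ 3 = 0"
    by (simp add: b vec_eq_iff forall_3)
  then show "2 * (m1 * A z $ 1 + n * B z $ 1) = A z $ 1 * m1 + C z $ 3 * m1"
    "2 * (m1 * A z $ 2 + n * B z $ 2) = A z $ 1 * n + A z $ 2 * m2 + C z $ 3 * n"
    "2 * m1 * A z $ 3 + 2 * n * B z $ 3 = 0"
    by (auto simp: algebra_simps)
  have "2 *s (m2 *s B z) = bracket_of N (B z) ?e3 + bracket_of N ?e2 (C z)"
    using L[of ?e2 ?e3] unfolding A_def B_def C_def b[of ?e2 ?e3] by (simp add: bilinear_simps)
  then show "2 * (m2 * B z $ 1) = B z $ 1 * m1"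
    "2 * (m2 * B z $ 2) = B z $ 1 * n + B z $ 2 * m2 + C z $ 3 * m2" "m2 * B z $ 3 = 0"
    by (simp_all add: b vec_eq_iff forall_3 algebra_simps)
  have "0 = bracket_of N (A z) ?e2 + bracket_of N ?e1 (B z)"
    using L[of ?e1 ?e2] unfolding A_def B_def C_def b[of ?e1 ?e2] by (simp add: bilinear_simps mult_of_scale_right[of N z 0, simplified])
  then show "B z $ 3 * m1 = 0" "A z $ 3 * m2 = B z $ 3 * n"
    by (simp_all add: b vec_eq_iff forall_3)
qed


text \<open>The factors 2 m2 - m1 and 2 m1 - m2 are nonzero, so every multiplication acts on the
  plane of e_1 and e_2 as a scalar, namely its (3,3) entry.\<close>

lemma covered_tri_nf_generic:
  assumes N: "N = tri_nf a11 a12 a13 a22 a23 a33 m1 n m2" "N \<in> tpa_variety"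
    and m: "m1 \<noteq> 0" "m2 \<noteq> 0" "m1 \<noteq> 2 * m2" "m2 \<noteq> 2 * m1"
  shows "N \<in> covered"
proof -
  let ?e1 = "vector [1,0,0] :: complex ^ 3" and ?e2 = "vector [0,1,0] :: complex ^ 3"
    and ?e3 = "vector [0,0,1] :: complex ^ 3"
  note L = tri_nf_leibniz[OF N]
  have e: "mult_of N z ?e1 = mult_of N z ?e3 $ 3 *s ?e1 \<and> mult_of N z ?e2 = mult_of N z ?e3 $ 3 *s ?e2" for z
  proof -
    have B3: "mult_of N z ?e2 $ 3 = 0"
      using L(6)[of z] m by simp
    then have A3: "mult_of N z ?e1 $ 3 = 0"
      using L(3)[of z] m by simp
    have "(2 * m2 - m1) * mult_of N z ?e2 $ 1 = 0"
      using L(4)[of z] by (simp add: algebra_simps)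
    then have B1: "mult_of N z ?e2 $ 1 = 0"
      using m by auto
    have "m2 * (mult_of N z ?e2 $ 2 - mult_of N z ?e3 $ 3) = 0"
      using L(5)[of z] B1 by (simp add: algebra_simps)
    then have B2: "mult_of N z ?e2 $ 2 = mult_of N z ?e3 $ 3"
      using m by simp
    have "m1 * (mult_of N z ?e1 $ 1 - mult_of N z ?e3 $ 3) = 0"
      using L(1)[of z] B1 by (simp add: algebra_simps)
    then have A1: "mult_of N z ?e1 $ 1 = mult_of N z ?e3 $ 3"
      using m by simp
    have "(2 * m1 - m2) * mult_of N z ?e1 $ 2 = 0"
      using L(2)[of z] B2 A1 by (simp add: algebra_simps)
    then have "mult_of N z ?e1 $ 2 = 0"
      using m by auto
    then show ?thesis
      using A1 A3 B1 B2 B3 by (simp add: vec_eq_iff forall_3)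
  qed
  define l where "l = mult_of N ?e3 ?e3 $ 3"
  note com = tpa_varietyD(1)[OF N(2)]
  have l3: "mult_of N ?e3 ?e1 = l *s ?e1" "mult_of N ?e3 ?e2 = l *s ?e2"
    using e[of ?e3] unfolding l_def by auto
  \<comment> \<open>By commutativity these products lie in the plane, so the scalars belonging to
    e_1 and e_2 are zero.\<close>
  have "mult_of N ?e1 ?e3 $ 3 = 0" "mult_of N ?e2 ?e3 $ 3 = 0"
    by (simp_all add: com[of _ ?e3] l3)
  then have z: "mult_of N ?e1 ?e1 = 0" "mult_of N ?e1 ?e2 = 0" "mult_of N ?e2 ?e2 = 0"
    using e[of ?e1] e[of ?e2] by auto
  have br: "bracket_of N ?e1 ?e2 = 0" "bracket_of N ?e1 ?e3 = m1 *s ?e1 + n *s ?e2"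
    "bracket_of N ?e2 ?e3 = m2 *s ?e2"
    by (simp_all add: N(1) bracket_of_nf vec_eq_iff forall_3)
  show ?thesis
  proof (rule covered_T09I[of _ ?e1 ?e2 ?e3 l "mult_of N ?e3 ?e3 $ 1" "mult_of N ?e3 ?e3 $ 2" m1 n m2])
    show "invertible (cols ?e1 ?e2 ?e3)"
      by (simp add: invertible_det_nz det_cols)
    show "mult_of N ?e1 ?e3 = l *s ?e1" "mult_of N ?e2 ?e3 = l *s ?e2"
      using l3 com by simp_all
    show "mult_of N ?e3 ?e3 = mult_of N ?e3 ?e3 $ 1 *s ?e1 + mult_of N ?e3 ?e3 $ 2 *s ?e2 + l *s ?e3"
      by (simp add: vec_eq_iff forall_3 l_def)
  qed (use br z in \<open>simp_all add: sym_alt_tpa N(2)\<close>)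
qed

text \<open>At ratio 2 the Leibniz rule leaves the coefficient of e_2 in z e_1 free. Associativity
  on e_1, e_3, e_3 then yields the quadric.\<close>

lemma covered_tri_nf_ratio_2:
  assumes N: "N = tri_nf a11 a12 a13 a22 a23 a33 m1 0 (2 * m1)" "N \<in> tpa_variety"
    and m: "m1 \<noteq> 0"
  shows "N \<in> covered"
proof -
  let ?e1 = "vector [1,0,0] :: complex ^ 3" and ?e2 = "vector [0,1,0] :: complex ^ 3"
    and ?e3 = "vector [0,0,1] :: complex ^ 3"
  note L = tri_nf_leibniz[OF N]
  have e: "mult_of N z ?e1 = mult_of N z ?e3 $ 3 *s ?e1 + mult_of N z ?e1 $ 2 *s ?e2 \<and>
      mult_of N z ?e2 = mult_of N z ?e3 $ 3 *s ?e2" for z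
  proof -
    have B3: "mult_of N z ?e2 $ 3 = 0" and A3: "mult_of N z ?e1 $ 3 = 0"
      using L(3,6)[of z] m by simp_all
    have B1: "mult_of N z ?e2 $ 1 = 0"
      using L(4)[of z] m by simp
    then have B2: "mult_of N z ?e2 $ 2 = mult_of N z ?e3 $ 3"
      using L(5)[of z] m by simp
    have "m1 * (mult_of N z ?e1 $ 1 - mult_of N z ?e3 $ 3) = 0"
      using L(1)[of z] B1 by (simp add: algebra_simps)
    then have A1: "mult_of N z ?e1 $ 1 = mult_of N z ?e3 $ 3"
      using m by simp
    then show ?thesis
      using A1 A3 B1 B2 B3 by (simp add: vec_eq_iff forall_3)
  qed
  define l where "l = mult_of N ?e3 ?e3 $ 3"
  define a where "a = mult_of N ?e1 ?e1 $ 2"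
  define b where "b = mult_of N ?e3 ?e1 $ 2"
  define w1 where "w1 = mult_of N ?e3 ?e3 $ 1"
  define w2 where "w2 = mult_of N ?e3 ?e3 $ 2"
  note com = tpa_varietyD(1)[OF N(2)]
  have 3: "mult_of N ?e3 ?e1 = l *s ?e1 + b *s ?e2" "mult_of N ?e3 ?e2 = l *s ?e2"
    using e[of ?e3] unfolding l_def b_def by blast+
  then have q3: "mult_of N ?e1 ?e3 = l *s ?e1 + b *s ?e2" "mult_of N ?e2 ?e3 = l *s ?e2"
    using com by simp_all
  have "mult_of N ?e1 ?e3 $ 3 = 0" "mult_of N ?e2 ?e3 $ 3 = 0"
    by (simp_all add: com[of _ ?e3] 3)
  then have z: "mult_of N ?e1 ?e1 = a *s ?e2" "mult_of N ?e1 ?e2 = 0" "mult_of N ?e2 ?e2 = 0"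
    using e[of ?e1] e[of ?e2] unfolding a_def by auto
  have 33: "mult_of N ?e3 ?e3 = w1 *s ?e1 + w2 *s ?e2 + l *s ?e3"
    by (simp add: vec_eq_iff forall_3 l_def w1_def w2_def)
  have "mult_of N (mult_of N ?e1 ?e3) ?e3 = mult_of N ?e1 (mult_of N ?e3 ?e3)"
    by (rule tpa_varietyD(2)[OF N(2)])
  then have "w1 * a = b * l"
    unfolding 33 q3 bilinear_simps z by (simp add: vec_eq_iff forall_3 algebra_simps)
  then show ?thesis
    using z q3 33 N
    by (intro covered_T12I[of _ ?e1 ?e2 ?e3 a l b w1 w2 m1 0])
      (simp_all add: invertible_det_nz det_cols sym_alt_tpa bracket_of_nf vec_eq_iff[of "vector _"] vec_eq_iff[of "_ *s _"] forall_3)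
qed

text \<open>When the second eigenvalue is 0, the action on e_2 is decoupled from the (3,3) entry of
  a multiplication. Associativity on e_2, e_3, e_3 yields the quadric.\<close>

lemma covered_tri_nf_rank_1:
  assumes N: "N = tri_nf a11 a12 a13 a22 a23 a33 m1 0 0" "N \<in> tpa_variety"
    and m: "m1 \<noteq> 0"
  shows "N \<in> covered"
proof -
  let ?e1 = "vector [1,0,0] :: complex ^ 3" and ?e2 = "vector [0,1,0] :: complex ^ 3"
    and ?e3 = "vector [0,0,1] :: complex ^ 3"
  note L = tri_nf_leibniz[OF N]
  have e: "mult_of N z ?e1 = mult_of N z ?e3 $ 3 *s ?e1 \<and>
      mult_of N z ?e2 = mult_of N z ?e2 $ 2 *s ?e2" for z
  proof -
    have "mult_of N z ?e2 $ 3 = 0" "mult_of N z ?e1 $ 3 = 0" "mult_of N z ?e1 $ 2 = 0"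
      "mult_of N z ?e2 $ 1 = 0"
      using L(2,3,4,7)[of z] m by simp_all
    moreover have "m1 * (mult_of N z ?e1 $ 1 - mult_of N z ?e3 $ 3) = 0"
      using L(1)[of z] by (simp add: algebra_simps)
    ultimately show ?thesis
      using m by (simp add: vec_eq_iff forall_3)
  qed
  define l where "l = mult_of N ?e3 ?e3 $ 3"
  define a where "a = mult_of N ?e2 ?e2 $ 2"
  define k where "k = mult_of N ?e3 ?e2 $ 2"
  define w1 where "w1 = mult_of N ?e3 ?e3 $ 1"
  define w2 where "w2 = mult_of N ?e3 ?e3 $ 2"
  note com = tpa_varietyD(1)[OF N(2)]
  have 3: "mult_of N ?e3 ?e1 = l *s ?e1" "mult_of N ?e3 ?e2 = k *s ?e2"
    using e[of ?e3] unfolding l_def k_def by blast+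
  then have q3: "mult_of N ?e1 ?e3 = l *s ?e1" "mult_of N ?e2 ?e3 = k *s ?e2"
    using com by simp_all
  have "mult_of N ?e1 ?e3 $ 3 = 0" "mult_of N ?e2 ?e3 $ 3 = 0"
    by (simp_all add: com[of _ ?e3] 3)
  then have z: "mult_of N ?e1 ?e1 = 0" "mult_of N ?e1 ?e2 = 0" "mult_of N ?e2 ?e2 = a *s ?e2"
    using e[of ?e1] e[of ?e2] com[of ?e1 ?e2] unfolding a_def by auto
  have 33: "mult_of N ?e3 ?e3 = w1 *s ?e1 + w2 *s ?e2 + l *s ?e3"
    by (simp add: vec_eq_iff forall_3 l_def w1_def w2_def)
  have "mult_of N (mult_of N ?e2 ?e3) ?e3 = mult_of N ?e2 (mult_of N ?e3 ?e3)"
    by (rule tpa_varietyD(2)[OF N(2)])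
  then have "k * (k - l) = w2 * a"
    unfolding 33 q3 bilinear_simps z com[of ?e2 ?e1] by (simp add: vec_eq_iff forall_3 algebra_simps)
  then show ?thesis
    using z q3 33 N
    by (intro covered_T17I[of _ ?e1 ?e2 ?e3 l a k w1 w2 m1])
      (simp_all add: invertible_det_nz det_cols sym_alt_tpa bracket_of_nf vec_eq_iff[of "vector _"] vec_eq_iff[of "_ *s _"] forall_3)
qed

text \<open>Here the Leibniz rule yields only that e_2 is an eigenvector and that \<open>tr\<close>
  holds. Both survive a change to a flag through e_2, which merely rescales the bracket, so
  associativity can finish in flag form.\<close>

lemma covered_tri_nf_heisenberg:
  assumes N: "N = tri_nf a11 a12 a13 a22 a23 a33 0 n 0" "N \<in> tpa_variety" and n: "n \<noteq> 0"
  shows "N \<in> covered"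
proof -
  let ?e2 = "vector [0,1,0] :: complex ^ 3"
  note L = tri_nf_leibniz[OF N]
  have b: "bracket_of N x y = ((x$1 * y$3 - x$3 * y$1) * n) *s ?e2" for x y
    by (simp add: N(1) bracket_of_nf vec_eq_iff forall_3 algebra_simps)
  have e: "mult_of N z ?e2 = mult_of N z ?e2 $ 2 *s ?e2" for z
    using L(1,8)[of z] n by (simp add: vec_eq_iff forall_3)
  then have "eigvec N ?e2"
    unfolding eigvec_def by (metis vector_3(2) zero_index zero_neq_one)
  then obtain v1 v3 x1 a1 l1 x3 a3 l2 l3 w1 w2 k where inv: "invertible (cols v1 ?e2 v3)" and
    mu: "mult_of N v1 v1 = x1 *s v1 + a1 *s ?e2" "mult_of N v1 ?e2 = l1 *s ?e2"
    "mult_of N v1 v3 = x3 *s v1 + a3 *s ?e2" "mult_of N ?e2 ?e2 = l2 *s ?e2" "mult_of N ?e2 v3 = l3 *s ?e2"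
    "mult_of N v3 v3 = w1 *s v1 + w2 *s ?e2 + k *s v3"
    using flag_products[OF N(2)] by blast
  define n' where "n' = (v1$1 * v3$3 - v1$3 * v3$1) * n"
  have n': "n' \<noteq> 0"
    using inv n by (auto simp: n'_def invertible_det_nz det_cols algebra_simps)
  define M where "M = flag_nf x1 a1 l1 x3 a3 l2 l3 w1 w2 k 0 (vector [0,n',0]) 0"
  have eq: "N = gl_act (cols v1 ?e2 v3) M"
    unfolding M_def by (rule gl_act_nf[OF sym_alt_tpa[OF N(2)] inv]) (simp_all add: mu b cols_mult n'_def)
  have M: "M \<in> tpa_variety"
    using tpa_if_gl_act[OF eq inv N(2)] .
  have M': "M = tri_nf (vector [x1,a1,0]) (vector [0,l1,0]) (vector [x3,a3,0])
     (vector [0,l2,0]) (vector [0,l3,0]) (vector [w1,w2,k]) 0 n' 0"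
    by (simp add: M_def vector_3_zero)
  note A = flag_nf_assoc[OF M[unfolded M_def]]
  \<comment> \<open>On e_2 the eigenvalue is the mean of the other two diagonal entries; together
    with multiplicativity this makes all three characters equal.\<close>
  have tr: "2 * mult_of M z ?e2 $ 2 = mult_of M z (vector [1,0,0]) $ 1 + mult_of M z (vector [0,0,1]) $ 3" for z
  proof -
    have "n' * (2 * mult_of M z ?e2 $ 2 - (mult_of M z (vector [1,0,0]) $ 1 + mult_of M z (vector [0,0,1]) $ 3)) = 0"
      using tri_nf_leibniz(2)[OF M' M, of z] by (simp add: algebra_simps)
    then show ?thesis
      using n' by simp
  qed
  have tr': "2 * l1 = x1" "l2 = 0" "2 * l3 = x3 + k"
    using tr[of "vector [1,0,0]"] tr[of ?e2] tr[of "vector [0,0,1]"] by (simp_all add: M_def mult_of_nf)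
  have l1: "l1 = 0"
    using A(1) tr' by (auto simp: power2_eq_square)
  then have x1: "x1 = 0"
    using tr' by simp
  have "k * l3 = l3 ^ 2" "x3 ^ 2 = k * x3"
    using A(3,4) unfolding l1 x1 tr' by simp_all
  then have "(x3 - k) ^ 2 = 0"
    using tr'(3) by algebra
  then have x3k: "x3 = k" "l3 = k"
    using tr'(3) by auto
  have "w1 * a1 = a3 * k"
    using A(6) by (simp add: x3k l1 algebra_simps)
  then show ?thesis
    using mu
    by (intro covered_T12I[of N v1 ?e2 v3 a1 k a3 w1 w2 0 n'])
      (simp_all add: inv sym_alt_tpa N(2) x1 l1 x3k tr' b n'_def)
qed

lemma covered_tri_nf:
  assumes N: "N = tri_nf a11 a12 a13 a22 a23 a33 m1 n m2" "N \<in> tpa_variety"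
  shows "N \<in> covered"
proof (cases "m1 = m2")
  case True
  show ?thesis
  proof (cases "m1 = 0")
    case False
    then show ?thesis
      using covered_tri_nf_generic[OF N] True by simp
  next
    case m1: True
    show ?thesis
    proof (cases "n = 0")
      case n: False
      have "N = tri_nf a11 a12 a13 a22 a23 a33 0 n 0"
        using N(1) True m1 by simp
      then show ?thesis
        by (rule covered_tri_nf_heisenberg[OF _ N(2) n])
    next
      case n: True
      then show ?thesis
        using covered_if_bracket_zero[OF N(2)] True m1 by (simp add: N(1) bracket_of_nf vec_eq_iff forall_3)
    qed
  qed
next
  case False
  \<comment> \<open>An eigenvector for \<open>m1\<close>, so the bracket becomes diagonal. Both
    orders of the basis are prepared because either eigenvalue may be the exceptional one.\<close>
  let ?v = "vector [1, n / (m1 - m2), 0] :: complex ^ 3" and ?e2 = "vector [0,1,0] :: complex ^ 3"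
    and ?e3 = "vector [0,0,1] :: complex ^ 3"
  have inv: "invertible (cols ?v ?e2 ?e3)" "invertible (cols ?e2 ?v ?e3)"
    by (simp_all add: invertible_det_nz det_cols)
  have b: "bracket_of N ?v ?e2 = 0" "bracket_of N ?e2 ?v = 0" "bracket_of N ?v ?e3 = m1 *s ?v"
    "bracket_of N ?e2 ?e3 = m2 *s ?e2"
    using False by (simp_all add: N(1) bracket_of_nf vec_eq_iff forall_3 field_simps)
  obtain a11' a12' a13' a22' a23' a33' where
    1: "N = gl_act (cols ?v ?e2 ?e3) (tri_nf a11' a12' a13' a22' a23' a33' m1 0 m2)"
    by (rule gl_act_nf_bracket[OF sym_alt_tpa[OF N(2)] inv(1), of 0 "vector [m1,0,0]" "vector [0,m2,0]"])
      (simp_all add: cols_mult b)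
  obtain b11' b12' b13' b22' b23' b33' where
    2: "N = gl_act (cols ?e2 ?v ?e3) (tri_nf b11' b12' b13' b22' b23' b33' m2 0 m1)"
    by (rule gl_act_nf_bracket[OF sym_alt_tpa[OF N(2)] inv(2), of 0 "vector [m2,0,0]" "vector [0,m1,0]"])
      (simp_all add: cols_mult b)
  have i1: "N \<in> covered \<longleftrightarrow> tri_nf a11' a12' a13' a22' a23' a33' m1 0 m2 \<in> covered"
    unfolding 1 by (rule gl_act_covered_iff[OF inv(1)])
  have i2: "N \<in> covered \<longleftrightarrow> tri_nf b11' b12' b13' b22' b23' b33' m2 0 m1 \<in> covered"
    unfolding 2 by (rule gl_act_covered_iff[OF inv(2)])
  note t1 = tpa_if_gl_act[OF 1 inv(1) N(2)] and t2 = tpa_if_gl_act[OF 2 inv(2) N(2)]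
  have nz: "m1 \<noteq> 0 \<or> m2 \<noteq> 0"
    using False by auto
  consider "m1 \<noteq> 0" "m2 \<noteq> 0" "m1 \<noteq> 2 * m2" "m2 \<noteq> 2 * m1" | "m1 \<noteq> 0" "m2 = 2 * m1"
    | "m2 \<noteq> 0" "m1 = 2 * m2" | "m1 \<noteq> 0" "m2 = 0" | "m2 \<noteq> 0" "m1 = 0"
    using nz by blast
  then show ?thesis
  proof cases
    case 1
    then show ?thesis
      by (rule covered_tri_nf_generic[OF N])
  next
    case 2
    show ?thesis
      unfolding i1 by (rule covered_tri_nf_ratio_2[OF _ t1]) (use 2 in auto)
  next
    case 3
    show ?thesis
      unfolding i2 by (rule covered_tri_nf_ratio_2[OF _ t2]) (use 3 in auto)
  next
    case 4
    show ?thesis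
      unfolding i1 by (rule covered_tri_nf_rank_1[OF _ t1]) (use 4 in auto)
  next
    case 5
    show ?thesis
      unfolding i2 by (rule covered_tri_nf_rank_1[OF _ t2]) (use 5 in auto)
  qed
qed

lemma covered_if_dual_singular:
  assumes c: "c \<in> tpa_variety" and d: "det (bracket_dual c) = 0"
  shows "c \<in> covered"
proof -
  obtain u v w where inv: "invertible (cols u v w)" and "bracket_of c u v = 0"
    using commuting_pair_exists[OF sym_alt_tpa[OF c] d] by blast
  then have b0: "bracket_of c u v = cols u v w *v 0"
    by simp
  note b = matrix_inv_vector(1)[OF inv, of "bracket_of c u w", symmetric]
    matrix_inv_vector(1)[OF inv, of "bracket_of c v w", symmetric]
  define b13 b23 where "b13 = matrix_inv (cols u v w) *v bracket_of c u w"
    and "b23 = matrix_inv (cols u v w) *v bracket_of c v w"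
  obtain a11 a12 a13 a22 a23 a33 where eq: "c = gl_act (cols u v w) (nf a11 a12 a13 a22 a23 a33 0 b13 b23)"
    by (rule gl_act_nf_bracket[OF sym_alt_tpa[OF c] inv b0 b[folded b13_def b23_def]])
  define M where "M = nf a11 a12 a13 a22 a23 a33 0 b13 b23"
  have M: "M \<in> tpa_variety"
    using tpa_if_gl_act[OF eq inv c] unfolding M_def .
  obtain v1 v2 v3 m1 n m2 a11' a12' a13' a22' a23' a33' where inv': "invertible (cols v1 v2 v3)"
    and eq': "M = gl_act (cols v1 v2 v3) (tri_nf a11' a12' a13' a22' a23' a33' m1 n m2)"
    unfolding M_def by (rule tri_nf_exists[OF M[unfolded M_def]])
  have "M \<in> covered"
    unfolding eq' gl_act_covered_iff[OF inv'] by (rule covered_tri_nf[OF refl tpa_if_gl_act[OF eq' inv' M]])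
  then show ?thesis
    unfolding eq gl_act_covered_iff[OF inv] M_def .
qed

section \<open>Rigid algebras\<close>

definition cross :: "complex ^ 3 \<Rightarrow> complex ^ 3 \<Rightarrow> complex ^ 3" where
  "cross x y = vector [x$2 * y$3 - x$3 * y$2, x$3 * y$1 - x$1 * y$3, x$1 * y$2 - x$2 * y$1]"

lemma bracket_of_cross:
  assumes c: "sym_alt c"
  shows "bracket_of c x y = bracket_dual c *v cross x y"
proof -
  have s: "bracket_of c x y = - bracket_of c y x" for x y
    using c unfolding sym_alt_def by blast
  have s0: "bracket_of c x x = 0" for x
    using s[of x x] by (simp add: vec_eq_iff)
  have x: "x = x$1 *s axis 1 1 + x$2 *s axis 2 1 + x$3 *s axis 3 1" for x :: "complex ^ 3"
    by (simp add: vec_eq_iff forall_3 axis_component)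
  have "bracket_of c x y = bracket_of c (x$1 *s axis 1 1 + x$2 *s axis 2 1 + x$3 *s axis 3 1)
      (y$1 *s axis 1 1 + y$2 *s axis 2 1 + y$3 *s axis 3 1)"
    by (simp flip: x)
  also have "\<dots> = bracket_dual c *v cross x y"
    unfolding bilinear_simps s0 s[of "axis 2 1" "axis 1 1"] s[of "axis 3 1" "axis 2 1"] s[of "axis 1 1" "axis 3 1"]
    by (simp add: bracket_dual_def cols_mult cross_def vec_eq_iff algebra_simps)
  finally show ?thesis .
qed

text \<open>Gram-Schmidt without positivity: polarisation provides a vector that is not isotropic,
  and a complex square root normalises it. The third vector of the basis will be the bracket of
  these two.\<close>

lemma orthonormal_pair:
  fixes B :: "complex ^ 3 \<Rightarrow> complex ^ 3 \<Rightarrow> complex"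
  assumes sym: "\<And>x y. B x y = B y x" and add: "\<And>x y z. B x (y + z) = B x y + B x z"
    and scale: "\<And>x y r. B x (r *s y) = r * B x y" and nondeg: "\<And>x. (\<And>y. B x y = 0) \<Longrightarrow> x = 0"
  obtains v1 v2 where "B v1 v1 = 1" "B v2 v2 = 1" "B v1 v2 = 0"
proof -
  have add': "B (x + y) z = B x z + B y z" for x y z
    by (simp add: sym[of _ z] add)
  have scale': "B (r *s x) y = r * B x y" for x y r
    by (simp add: sym[of _ y] scale)
  have norm: "\<exists>v. B v v = 1 \<and> (\<exists>k. v = k *s x)" if "B x x \<noteq> 0" for x
    using that by (intro exI[of _ "(1 / csqrt (B x x)) *s x"]) (auto simp: scale scale' power2_eq_square[symmetric])
  have polar: "B x y = 0" if "B x x = 0" "B y y = 0" "B (x + y) (x + y) = 0" for x y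
    using that by (simp add: add add' sym[of y x])
  have "\<exists>x. B x x \<noteq> 0"
  proof (rule ccontr)
    assume "\<nexists>x. B x x \<noteq> 0"
    then have BB: "B x x = 0" for x
      by blast
    have "B (axis 1 1) y = 0" for y
      by (rule polar[OF BB BB BB])
    then have "axis 1 1 = (0 :: complex ^ 3)"
      by (rule nondeg)
    then show False
      by (simp add: axis_eq_0_iff)
  qed
  then obtain v1 where v1: "B v1 v1 = 1"
    using norm by blast
  define P where "P y = y + (- B v1 y) *s v1" for y
  have P1: "B v1 (P y) = 0" for y
    unfolding P_def add scale by (simp add: v1)
  have P_add: "P (y + z) = P y + P z" for y z
    by (simp add: P_def add vec.scale_left_distrib vec_eq_iff algebra_simps)
  have "\<exists>y. B (P y) (P y) \<noteq> 0"
  proof (rule ccontr)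
    assume "\<nexists>y. B (P y) (P y) \<noteq> 0"
    then have PP: "B (P y) (P z) = 0" for y z
      using polar[of "P y" "P z"] by (simp flip: P_add)
    \<comment> \<open>If the form vanished on the complement of \<open>v1\<close>, that complement
      would lie in the radical, so \<open>P\<close> would be zero and \<open>v1\<close> would span
      the space.\<close>
    have "B (P y) z = 0" for y z
      using PP[of y z] P1[of y] unfolding P_def[of z] add scale sym[of "P y" v1] by simp
    then have P0: "P y = 0" for y
      by (rule nondeg)
    have y: "y = B v1 y *s v1" for y
    proof -
      have "y - B v1 y *s v1 = 0"
        using P0[of y] unfolding P_def by simp
      then show ?thesis
        by (simp only: right_minus_eq)
    qed
    have "det (cols (a *s v1) (b *s v1) (c *s v1)) = 0" for a b c
      by (simp add: det_cols algebra_simps)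
    from this[of "B v1 (axis 1 1)" "B v1 (axis 2 1)" "B v1 (axis 3 1)"]
    have "det (cols (axis 1 1) (axis 2 1) (axis 3 1)) = 0"
      by (simp only: y[symmetric])
    then show False
      by (simp add: det_cols axis_component)
  qed
  then obtain y v2 k where "B v2 v2 = 1" "v2 = k *s P y"
    using norm by blast
  then show thesis
    using that[of v1 v2] v1 P1[of y] by (simp add: scale)
qed

text \<open>The form \<open>B x y = x\<^sup>T adj(M) y\<close> satisfies \<open>[x, [y, z]] = B(x, z) y - B(x, y) z\<close>, where \<open>[x, y] = M (x \<times> y)\<close>.\<close>

definition adj_form :: "complex ^ 3 ^ 3 \<Rightarrow> complex ^ 3 \<Rightarrow> complex ^ 3 \<Rightarrow> complex" where
  "adj_form M x y =
     (M$2$2 * M$3$3 - M$2$3^2) * (x$1 * y$1) + (M$1$1 * M$3$3 - M$1$3^2) * (x$2 * y$2)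
     + (M$1$1 * M$2$2 - M$1$2^2) * (x$3 * y$3)
     + (M$1$3 * M$2$3 - M$1$2 * M$3$3) * (x$1 * y$2 + x$2 * y$1)
     + (M$1$2 * M$2$3 - M$1$3 * M$2$2) * (x$1 * y$3 + x$3 * y$1)
     + (M$1$2 * M$1$3 - M$1$1 * M$2$3) * (x$2 * y$3 + x$3 * y$2)"

lemma gl_orbit_T01_if_dual_regular:
  assumes c: "c \<in> tpa_variety" and d: "det (bracket_dual c) \<noteq> 0"
  shows "c \<in> gl_orbit T01"
proof -
  define M where "M = bracket_dual c"
  define B where "B = adj_form M"
  have br: "bracket_of c x y = M *v cross x y" for x y
    unfolding M_def by (rule bracket_of_cross[OF sym_alt_tpa[OF c]])
  have inv: "invertible M"
    using d by (simp add: M_def invertible_det_nz)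
  \<comment> \<open>The sum of the e_i x M e_i records the antisymmetric part of \<open>M\<close>.
    The Jacobi identity says that \<open>M\<close> kills it, so an invertible \<open>M\<close> is
    symmetric.\<close>
  have "M *v (cross (axis 1 1) (M *v axis 1 1) + cross (axis 2 1) (M *v axis 2 1) + cross (axis 3 1) (M *v axis 3 1)) = 0"
  proof -
    have ax: "cross (axis 2 1) (axis 3 1) = axis 1 1" "cross (axis 3 1) (axis 1 1) = axis 2 1"
      "cross (axis 1 1) (axis 2 1) = axis 3 1"
      by (simp_all add: cross_def vec_eq_iff forall_3 axis_component)
    show ?thesis
      using tpa_varietyD(4)[OF c, of "axis 1 1" "axis 2 1" "axis 3 1"]
      by (simp add: br ax matrix_vector_right_distrib)
  qed
  then have "cross (axis 1 1) (M *v axis 1 1) + cross (axis 2 1) (M *v axis 2 1) + cross (axis 3 1) (M *v axis 3 1) = 0"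
    using matrix_inv_vector(2)[OF inv] by (metis matrix_vector_mult_0_right)
  then have sym: "M$2$1 = M$1$2" "M$3$1 = M$1$3" "M$3$2 = M$2$3"
    by (simp_all add: cross_def vec_eq_iff forall_3 axis_component matrix_vector_mult_def sum_3)
  have det: "det M = M$1$1 * M$2$2 * M$3$3 + 2 * M$1$2 * M$1$3 * M$2$3 - M$1$1 * M$2$3^2
      - M$2$2 * M$1$3^2 - M$3$3 * M$1$2^2"
    by (simp add: det_3 sym power2_eq_square algebra_simps)
  have triple: "bracket_of c x (bracket_of c y z) = B x z *s y - B x y *s z" for x y z
    unfolding br B_def adj_form_def cross_def vec_eq_iff forall_3 matrix_vector_mult_def sum_3 sym
    by (simp add: sym, intro conjI; algebra)
  obtain v1 v2 where v: "B v1 v1 = 1" "B v2 v2 = 1" "B v1 v2 = 0"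
  proof (rule orthonormal_pair[of B])
    show "B x y = B y x" "B x (y + z) = B x y + B x z" "B x (r *s y) = r * B x y" for x y z r
      by (simp_all add: B_def adj_form_def algebra_simps)
    show "x = 0" if 0: "\<And>y. B x y = 0" for x
    proof -
      \<comment> \<open>These are the rows of \<open>M\<close> times its adjugate.\<close>
      have "det M * x$1 = M$1$1 * B x (axis 1 1) + M$1$2 * B x (axis 2 1) + M$1$3 * B x (axis 3 1)"
        "det M * x$2 = M$1$2 * B x (axis 1 1) + M$2$2 * B x (axis 2 1) + M$2$3 * B x (axis 3 1)"
        "det M * x$3 = M$1$3 * B x (axis 1 1) + M$2$3 * B x (axis 2 1) + M$3$3 * B x (axis 3 1)"
        by (simp_all add: det B_def adj_form_def axis_component power2_eq_square algebra_simps)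
      then show ?thesis
        using inv by (simp add: 0 vec_eq_iff forall_3 invertible_det_nz)
    qed
  qed
  have Bsym: "B x y = B y x" and Badd: "B x (y + z) = B x y + B x z" and Bscale: "B x (r *s y) = r * B x y"
    and Bdiff: "B x (y - z) = B x y - B x z" for x y z r
    by (simp_all add: B_def adj_form_def algebra_simps)
  have B0: "B x 0 = 0" for x
    by (simp add: B_def adj_form_def)
  have Bneg: "B x (- y) = - B x y" for x y
    using Bscale[of x "-1" y] by (simp flip: vector_sneg_minus1)
  define v3 where "v3 = bracket_of c v1 v2"
  have 12: "bracket_of c v1 v2 = v3" and 13: "bracket_of c v1 v3 = - v2" and 23: "bracket_of c v2 v3 = v1"
    unfolding v3_def triple by (simp_all add: v Bsym[of v2 v1])
  \<comment> \<open>[v3, v3] = 0 expanded by \<open>triple\<close>; pairing with \<open>v1\<close>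
    and \<open>v2\<close> shows that \<open>v3\<close> is orthogonal to both.\<close>
  have "B v3 v2 *s v1 - B v3 v1 *s v2 = 0"
    using triple[of v3 v1 v2] tpa_varietyD(3)[OF c, of v3] by (simp add: 12)
  then have "B v1 (B v3 v2 *s v1 - B v3 v1 *s v2) = 0" "B v2 (B v3 v2 *s v1 - B v3 v1 *s v2) = 0"
    by (simp_all add: B0)
  then have v3o: "B v1 v3 = 0" "B v2 v3 = 0"
    by (simp_all add: Bdiff Bneg Bscale v Bsym[of v2 v1] Bsym[of v3 v1] Bsym[of v3 v2])
  \<comment> \<open>Evaluating this double bracket a second time by \<open>triple\<close> gives the
    norm of \<open>v3\<close>.\<close>
  have "bracket_of c v3 (bracket_of c v1 v3) = v1"
    using tpa_bracket_swap[OF c, of v3 v2] tpa_bracket_swap[OF c, of "v2" v3] 23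
    unfolding 13 by (simp add: bracket_of_scale_right[of c v3 "-1" v2, simplified])
  then have "B v3 v3 *s v1 - B v3 v1 *s v3 = v1"
    using triple[of v3 v1 v3] by simp
  then have "B v1 (B v3 v3 *s v1 - B v3 v1 *s v3) = B v1 v1"
    by simp
  then have v33: "B v3 v3 = 1"
    by (simp add: Bdiff Bscale v v3o)
  have invv: "invertible (cols v1 v2 v3)"
    unfolding invertible_cols_iff
  proof (intro allI impI)
    fix x y z assume "x *s v1 + y *s v2 + z *s v3 = 0"
    then have "B w (x *s v1 + y *s v2 + z *s v3) = 0" for w
      by (simp add: B0)
    from this[of v1] this[of v2] this[of v3] show "x = 0 \<and> y = 0 \<and> z = 0"
      by (simp add: Badd Bscale v v3o v33 Bsym[of v2 v1] Bsym[of v3 v1] Bsym[of v3 v2])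
  qed
  obtain a11 a12 a13 a22 a23 a33 where
    eq: "c = gl_act (cols v1 v2 v3) (nf a11 a12 a13 a22 a23 a33 (vector [0,0,1]) (vector [0,-1,0]) (vector [1,0,0]))"
    by (rule gl_act_nf_bracket[OF sym_alt_tpa[OF c] invv, of "vector [0,0,1]" "vector [0,-1,0]" "vector [1,0,0]"])
      (simp_all add: 12 13 23 cols_mult)
  define N where "N = nf a11 a12 a13 a22 a23 a33 (vector [0,0,1]) (vector [0,-1,0]) (vector [1,0,0])"
  have N: "N \<in> tpa_variety"
    using tpa_if_gl_act[OF eq invv c] unfolding N_def .
  let ?e1 = "vector [1,0,0] :: complex ^ 3" and ?e2 = "vector [0,1,0] :: complex ^ 3"
    and ?e3 = "vector [0,0,1] :: complex ^ 3"
  have b: "bracket_of N x y = (x$1 * y$2 - x$2 * y$1) *s ?e3 - (x$1 * y$3 - x$3 * y$1) *s ?e2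
      + (x$2 * y$3 - x$3 * y$2) *s ?e1" for x y
    by (simp add: N_def bracket_of_nf vec_eq_iff forall_3)
  have e: "mult_of N z ?e1 = mult_of N z ?e3 $ 3 *s ?e1 \<and> mult_of N z ?e2 = mult_of N z ?e3 $ 3 *s ?e2 \<and>
      mult_of N z ?e3 = mult_of N z ?e3 $ 3 *s ?e3" for z
  proof -
    have neg: "mult_of N z (- x) = - mult_of N z x" for x
      using mult_of_scale_right[of N z "-1" x] by (simp add: vec_eq_iff)
    have z: "2 *s mult_of N z ?e3 = bracket_of N (mult_of N z ?e1) ?e2 + bracket_of N ?e1 (mult_of N z ?e2)"
      "- (2 *s mult_of N z ?e2) = bracket_of N (mult_of N z ?e1) ?e3 + bracket_of N ?e1 (mult_of N z ?e3)"
      "2 *s mult_of N z ?e1 = bracket_of N (mult_of N z ?e2) ?e3 + bracket_of N ?e2 (mult_of N z ?e3)"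
      using tpa_varietyD(5)[OF N, of z ?e1 ?e2] tpa_varietyD(5)[OF N, of z ?e1 ?e3]
        tpa_varietyD(5)[OF N, of z ?e2 ?e3] b[of ?e1 ?e2] b[of ?e1 ?e3] b[of ?e2 ?e3]
      by (simp_all add: neg vec_eq_iff)
    define A where "A = mult_of N z ?e1"
    define B where "B = mult_of N z ?e2"
    define C where "C = mult_of N z ?e3"
    have *: "2 * C$1 = - A$3" "2 * C$2 = - B$3" "2 * C$3 = A$1 + B$2"
      "2 * B$1 = - A$2" "2 * B$2 = A$1 + C$3" "2 * B$3 = - C$2"
      "2 * A$1 = B$2 + C$3" "2 * A$2 = - B$1" "2 * A$3 = - C$1"
      using z unfolding A_def[symmetric] B_def[symmetric] C_def[symmetric] b vec_eq_iff forall_3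
      by (auto simp: algebra_simps minus_equation_iff)
    \<comment> \<open>Off the diagonal, paired entries are -1/2 times each other, so they vanish; on
      the diagonal each entry is the mean of the other two.\<close>
    have "3 * C$1 = 0" "3 * C$2 = 0" "3 * A$3 = 0" "3 * B$3 = 0" "3 * A$2 = 0" "3 * B$1 = 0" "3 * (A$1 - C$3) = 0" "3 * (B$2 - C$3) = 0"
      using * by algebra+
    then show ?thesis
      unfolding A_def[symmetric] B_def[symmetric] C_def[symmetric] by (simp add: vec_eq_iff forall_3)
  qed
  note com = tpa_varietyD(1)[OF N]
  note ez = e[THEN conjunct1] e[THEN conjunct2, THEN conjunct1] e[THEN conjunct2, THEN conjunct2]
  \<comment> \<open>Multiplication by z is a scalar s(z), and commutativity reads s(e_1) e_2 =
    s(e_2) e_1.\<close>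
  have "mult_of N ?e1 ?e3 $ 3 *s ?e2 = mult_of N ?e2 ?e3 $ 3 *s ?e1"
    unfolding ez(2)[of ?e1, symmetric] ez(1)[of ?e2, symmetric] by (rule com)
  then have l12: "mult_of N ?e1 ?e3 $ 3 = 0" "mult_of N ?e2 ?e3 $ 3 = 0"
    by (simp_all add: vec_eq_iff forall_3)
  moreover have "mult_of N ?e1 ?e3 $ 3 *s ?e3 = mult_of N ?e3 ?e3 $ 3 *s ?e1"
    unfolding ez(3)[of ?e1, symmetric] ez(1)[of ?e3, symmetric] by (rule com)
  ultimately have "mult_of N ?e3 ?e3 $ 3 = 0"
    by (simp add: vec_eq_iff forall_3)
  then have "mult_of N ?e1 ?e1 = 0" "mult_of N ?e1 ?e2 = 0" "mult_of N ?e1 ?e3 = 0"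
    "mult_of N ?e2 ?e2 = 0" "mult_of N ?e2 ?e3 = 0" "mult_of N ?e3 ?e3 = 0"
    using e[of ?e1] e[of ?e2] e[of ?e3] l12 by simp_all
  then have "N = T01"
    by (simp add: N_def mult_of_nf T01_nf)
  then have "c = gl_act (cols v1 v2 v3) T01"
    using eq unfolding N_def by simp
  then show ?thesis
    unfolding gl_orbit_def using invv by blast
qed

text \<open>The translates of the open set where \<open>f\<close> is nonzero form an open set whose
  intersection with the variety is the orbit. Thus \<open>f\<close> may be any polynomial, invariant
  or not.\<close>

lemma tpa_rigidI:
  assumes c: "c \<in> tpa_variety" and f: "complex_polynomial_fun f" "f c \<noteq> 0"
    and U: "\<And>d. d \<in> tpa_variety \<Longrightarrow> f d \<noteq> 0 \<Longrightarrow> d \<in> gl_orbit c"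
  shows "tpa_rigid c"
proof -
  let ?O = "\<lambda>g. {d. f (gl_act g d) \<noteq> 0}"
  have "zariski_closed (- ?O g)" for g
    using zariski_closed_poly_eq[OF poly_fun_compose[OF f(1) poly_fun_gl_act[of g]] complex_polynomial_fun.const[of 0]]
    by (simp add: Compl_eq)
  then have "openin zariski (\<Union>g\<in>{g. invertible g}. ?O g)"
    by (intro openin_Union) (auto simp: openin_zariski)
  moreover have "gl_orbit c = (\<Union>g\<in>{g. invertible g}. ?O g) \<inter> tpa_variety"
  proof (intro set_eqI iffI)
    fix d assume d: "d \<in> gl_orbit c"
    then obtain g where g: "invertible g" "d = gl_act g c"
      unfolding gl_orbit_def by blast
    then have "d \<in> ?O (matrix_inv g)" "invertible (matrix_inv g)"
      using f(2) by (simp_all add: gl_act_inverse invertible_matrix_inv)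
    then show "d \<in> (\<Union>g\<in>{g. invertible g}. ?O g) \<inter> tpa_variety"
      using d gl_orbit_subset_tpa[OF c] by blast
  next
    fix d assume "d \<in> (\<Union>g\<in>{g. invertible g}. ?O g) \<inter> tpa_variety"
    then obtain g where g: "invertible g" "f (gl_act g d) \<noteq> 0" "d \<in> tpa_variety"
      by blast
    then have "gl_act g d \<in> gl_orbit c"
      using U tpa_variety_gl_act by blast
    then have "gl_act (matrix_inv g) (gl_act g d) \<in> gl_orbit c"
      by (rule gl_act_gl_orbit[OF invertible_matrix_inv[OF g(1)]])
    then show "d \<in> gl_orbit c"
      by (simp add: gl_act_inverse g)
  qed
  ultimately show ?thesis
    unfolding tpa_rigid_def openin_subtopology by blast
qed

lemma poly_fun_det_3:
  fixes A :: "complex ^ 'm \<Rightarrow> complex ^ 3 ^ 3"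
  assumes "\<And>i j. complex_polynomial_fun (\<lambda>c. A c $ i $ j)"
  shows "complex_polynomial_fun (\<lambda>c. det (A c))"
  unfolding det_3 by (intro poly_fun_intros assms)

lemma tpa_rigid_T01: "tpa_rigid T01"
proof (rule tpa_rigidI[where f="\<lambda>c. det (bracket_dual c)"])
  show "complex_polynomial_fun (\<lambda>c. det (bracket_dual c))"
  proof (rule poly_fun_det_3)
    fix i j :: 3
    show "complex_polynomial_fun (\<lambda>c. bracket_dual c $ i $ j)"
      using exhaust_3[of j] unfolding bracket_dual_def cols_def
      by (auto simp: bracket_of_axis intro: poly_fun_intros)
  qed
  show "det (bracket_dual T01) \<noteq> 0"
    by (simp add: bracket_dual_def det_cols T01_nf bracket_of_nf axis_component)
qed (use T01_tpa gl_orbit_T01_if_dual_regular in auto)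

section \<open>Three distinct eigenvalues and \<open>T20\<close>\<close>

lemma det_cols_scale: "det (cols (a *s u) (b *s v) (c *s w)) = a * b * c * det (cols u v w)"
  by (simp add: det_cols algebra_simps)

text \<open>The discriminant of the characteristic polynomial, expressed in its
  coefficients.\<close>

definition disc :: "complex ^ 3 ^ 3 \<Rightarrow> complex" where
  "disc A = trace A ^ 2 * minor_sum A ^ 2 - 4 * minor_sum A ^ 3 - 4 * trace A ^ 3 * det A
     + 18 * trace A * minor_sum A * det A - 27 * det A ^ 2"

lemma distinct_eigenvectors:
  assumes d: "disc A \<noteq> 0"
  obtains r1 r2 r3 v1 v2 v3 where "invertible (cols v1 v2 v3)" "det A = r1 * r2 * r3"
    "r1 \<noteq> r2" "r1 \<noteq> r3" "r2 \<noteq> r3" "A *v v1 = r1 *s v1" "A *v v2 = r2 *s v2" "A *v v3 = r3 *s v3"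
proof -
  obtain r1 r2 r3 where r: "trace A = r1 + r2 + r3" "minor_sum A = r1 * r2 + r1 * r3 + r2 * r3"
    "det A = r1 * r2 * r3"
    using cubic_roots by metis
  have "disc A = ((r1 - r2) * (r1 - r3) * (r2 - r3)) ^ 2"
    unfolding disc_def r by algebra
  then have ne: "r1 \<noteq> r2" "r1 \<noteq> r3" "r2 \<noteq> r3"
    using d by auto
  have "det (A - mat r) = (r1 - r) * (r2 - r) * (r3 - r)" for r
  proof -
    have "det (A - mat r) = det A - r * minor_sum A + r ^ 2 * trace A - r ^ 3"
      by (simp add: det_3 mat_def minor_sum_def trace_def sum_3 power2_eq_square power3_eq_cube algebra_simps)
    then show ?thesis
      unfolding r by (simp add: power2_eq_square power3_eq_cube algebra_simps)
  qed
  then have "\<not> invertible (A - mat r)" if "r = r1 \<or> r = r2 \<or> r = r3" for r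
    using that by (auto simp: invertible_det_nz)
  then have ev: "\<exists>v. v \<noteq> 0 \<and> A *v v = r *s v" if "r = r1 \<or> r = r2 \<or> r = r3" for r
    using that by (auto simp: invertible_left_inverse matrix_left_invertible_ker
        matrix_vector_mult_diff_rdistrib mat_mult_vec)
  obtain v1 where v1: "v1 \<noteq> 0" "A *v v1 = r1 *s v1"
    using ev by blast
  obtain v2 where v2: "v2 \<noteq> 0" "A *v v2 = r2 *s v2"
    using ev by blast
  obtain v3 where v3: "v3 \<noteq> 0" "A *v v3 = r3 *s v3"
    using ev by blast
  have "invertible (cols v1 v2 v3)"
    unfolding invertible_cols_iff
  proof (intro allI impI)
    fix a b c assume 0: "a *s v1 + b *s v2 + c *s v3 = 0"
    \<comment> \<open>Applying \<open>?D\<close> for two of the eigenvalues removes two of the three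
      summands.\<close>
    let ?D = "\<lambda>r x. A *v x - r *s x"
    have D: "?D r (a *s v1 + b *s v2 + c *s v3) =
        (a * (r1 - r)) *s v1 + (b * (r2 - r)) *s v2 + (c * (r3 - r)) *s v3" for a b c r
      by (simp add: matrix_vector_right_distrib vector_scalar_commute v1 v2 v3 vec_eq_iff algebra_simps)
    have "?D s (?D r (a *s v1 + b *s v2 + c *s v3)) = 0" for r s
      unfolding 0 by simp
    then have DD: "(a * (r1 - r) * (r1 - s)) *s v1 + (b * (r2 - r) * (r2 - s)) *s v2
        + (c * (r3 - r) * (r3 - s)) *s v3 = 0" for r s
      unfolding D .
    show "a = 0 \<and> b = 0 \<and> c = 0"
      using DD[of r2 r3] DD[of r1 r3] DD[of r1 r2] ne v1 v2 v3 by simp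
  qed
  then show thesis
    using that r(3) ne v1 v2 v3 by blast
qed

text \<open>Eigenvectors of multiplication by \<open>z\<close> for distinct eigenvalues annihilate
  each other, and the square of each stays on its line. Nonzero eigenvalues make the squares
  nonzero, which yields three orthogonal idempotents.\<close>

lemma gl_orbit_T20_if_disc:
  assumes c: "c \<in> tpa_variety" and d: "det (mult_matrix c z) * disc (mult_matrix c z) \<noteq> 0"
  shows "c \<in> gl_orbit T20"
proof -
  obtain r1 r2 r3 v1 v2 v3 where inv: "invertible (cols v1 v2 v3)" and "det (mult_matrix c z) = r1 * r2 * r3"
    and ne: "r1 \<noteq> r2" "r1 \<noteq> r3" "r2 \<noteq> r3" and v: "mult_of c z v1 = r1 *s v1" "mult_of c z v2 = r2 *s v2"
    "mult_of c z v3 = r3 *s v3"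
    using distinct_eigenvectors[of "mult_matrix c z"] d unfolding mult_matrix_vec by (metis mult_eq_0_iff)
  then have r: "r1 \<noteq> 0" "r2 \<noteq> 0" "r3 \<noteq> 0"
    using d by auto
  have ind: "a = 0 \<and> b = 0 \<and> c = 0" if "a *s v1 + b *s v2 + c *s v3 = 0" for a b c
    using inv that unfolding invertible_cols_iff by blast
  have vnz: "v1 \<noteq> 0" "v2 \<noteq> 0" "v3 \<noteq> 0"
    using ind[of 1 0 0] ind[of 0 1 0] ind[of 0 0 1] by auto
  have orth: "mult_of c x y = 0" if "mult_of c z x = s *s x" "mult_of c z y = t *s y" "s \<noteq> t" for x y s t
  proof -
    have "s *s mult_of c x y = mult_of c (mult_of c z x) y"
      unfolding that(1) bilinear_simps ..
    also have "\<dots> = mult_of c x (mult_of c z y)"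
      unfolding tpa_varietyD(2)[OF c] by (rule mult_left_commute[OF c])
    also have "\<dots> = t *s mult_of c x y"
      unfolding that(2) bilinear_simps ..
    finally have "(s - t) *s mult_of c x y = 0"
      by (simp add: vec.scale_left_diff_distrib)
    then show ?thesis
      using that(3) by simp
  qed
  note o = orth[OF v(1,2) ne(1)] orth[OF v(1,3) ne(2)] orth[OF v(2,3) ne(3)]
  have zsq: "mult_of c z (mult_of c x x) = s *s mult_of c x x" if "mult_of c z x = s *s x" for x s
    using tpa_varietyD(2)[OF c, of z x x] unfolding that bilinear_simps by simp
  have dec: "(a * r1) *s v1 + (b * r2) *s v2 + (d * r3) *s v3 = mult_of c z (a *s v1 + b *s v2 + d *s v3)" for a b d
    by (simp add: bilinear_simps v mult.commute)
  have eig: "x = a *s v1 + b *s v2 + d *s v3 \<Longrightarrow> mult_of c z x = s *s x \<Longrightarrow>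
      a * (r1 - s) = 0 \<and> b * (r2 - s) = 0 \<and> d * (r3 - s) = 0" for x s a b d
  proof -
    assume x: "x = a *s v1 + b *s v2 + d *s v3" "mult_of c z x = s *s x"
    have "(a * (r1 - s)) *s v1 + (b * (r2 - s)) *s v2 + (d * (r3 - s)) *s v3 = mult_of c z x - s *s x"
      unfolding x(1) dec[symmetric] by (simp add: vec_eq_iff algebra_simps)
    also have "\<dots> = 0"
      using x(2) by simp
    finally show ?thesis
      by (rule ind)
  qed
  have sq: "\<exists>k1. mult_of c v1 v1 = k1 *s v1" "\<exists>k2. mult_of c v2 v2 = k2 *s v2" "\<exists>k3. mult_of c v3 v3 = k3 *s v3"
  proof -
    obtain a b d where x: "mult_of c v1 v1 = a *s v1 + b *s v2 + d *s v3"
      using cols_surj[OF inv] by blast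
    with eig[OF x zsq[OF v(1)]] ne show "\<exists>k1. mult_of c v1 v1 = k1 *s v1"
      by (intro exI[of _ a]) auto
    obtain a b d where x: "mult_of c v2 v2 = a *s v1 + b *s v2 + d *s v3"
      using cols_surj[OF inv] by blast
    with eig[OF x zsq[OF v(2)]] ne show "\<exists>k1. mult_of c v2 v2 = k1 *s v2"
      by (intro exI[of _ b]) auto
    obtain a b d where x: "mult_of c v3 v3 = a *s v1 + b *s v2 + d *s v3"
      using cols_surj[OF inv] by blast
    with eig[OF x zsq[OF v(3)]] ne show "\<exists>k1. mult_of c v3 v3 = k1 *s v3"
      by (intro exI[of _ d]) auto
  qed
  then obtain k1 k2 k3 where k: "mult_of c v1 v1 = k1 *s v1" "mult_of c v2 v2 = k2 *s v2" "mult_of c v3 v3 = k3 *s v3"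
    by blast
  note com = tpa_varietyD(1)[OF c]
  obtain z1 z2 z3 where zz: "z = z1 *s v1 + z2 *s v2 + z3 *s v3"
    using cols_surj[OF inv] by blast
  have "(z1 * k1) *s v1 = r1 *s v1" "(z2 * k2) *s v2 = r2 *s v2" "(z3 * k3) *s v3 = r3 *s v3"
    using v unfolding zz by (simp_all add: bilinear_simps k o com[of v2 v1] com[of v3 v1] com[of v3 v2])
  then have knz: "k1 \<noteq> 0" "k2 \<noteq> 0" "k3 \<noteq> 0"
    using r vnz by auto
  define u1 u2 u3 where "u1 = (1/k1) *s v1" and "u2 = (1/k2) *s v2" and "u3 = (1/k3) *s v3"
  have u: "mult_of c u1 u1 = u1" "mult_of c u2 u2 = u2" "mult_of c u3 u3 = u3"
    "mult_of c u1 u2 = 0" "mult_of c u1 u3 = 0" "mult_of c u2 u3 = 0"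
    using knz by (simp_all add: u1_def u2_def u3_def bilinear_simps k o)
  let ?H = "cols u1 u2 u3"
  have invH: "invertible ?H"
    using inv knz by (simp add: u1_def u2_def u3_def invertible_det_nz det_cols_scale)
  let ?e1 = "vector [1,0,0] :: complex ^ 3" and ?e2 = "vector [0,1,0] :: complex ^ 3"
    and ?e3 = "vector [0,0,1] :: complex ^ 3"
  define b12 b13 b23 where "b12 = matrix_inv ?H *v bracket_of c u1 u2"
    and "b13 = matrix_inv ?H *v bracket_of c u1 u3" and "b23 = matrix_inv ?H *v bracket_of c u2 u3"
  let ?N = "nf ?e1 0 0 ?e2 0 ?e3 b12 b13 b23"
  have eq: "c = gl_act ?H ?N"
  proof (rule gl_act_nf[OF sym_alt_tpa[OF c] invH])
    show "bracket_of c u1 u2 = ?H *v b12" "bracket_of c u1 u3 = ?H *v b13" "bracket_of c u2 u3 = ?H *v b23"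
      unfolding b12_def b13_def b23_def by (simp_all only: matrix_inv_vector[OF invH])
  qed (simp_all add: u cols_mult)
  have N: "?N \<in> tpa_variety"
    using tpa_if_gl_act[OF eq invH c] .
  \<comment> \<open>For an idempotent e with e y = 0 the Leibniz rule gives 2 e [e, y] = [e, y], but
    1/2 is not an eigenvalue of multiplication by e.\<close>
  have "b12 = 0" "b13 = 0" "b23 = 0"
    using tpa_varietyD(5)[OF N, of ?e1 ?e1 ?e2] tpa_varietyD(5)[OF N, of ?e1 ?e1 ?e3] tpa_varietyD(5)[OF N, of ?e2 ?e2 ?e3]
    by (simp_all add: mult_of_nf bracket_of_nf vec_eq_iff forall_3)
  then have "c = gl_act ?H T20"
    using eq by (simp add: T20_nf)
  then show ?thesis
    unfolding gl_orbit_def using invH by blast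
qed

lemma tpa_rigid_T20: "tpa_rigid T20"
\<comment> \<open>In \<open>T20\<close> multiplication by (1, 2, 3) is diagonal with these distinct
  nonzero eigenvalues.\<close>
proof (rule tpa_rigidI[where f="\<lambda>c. det (mult_matrix c (vector [1,2,3])) * disc (mult_matrix c (vector [1,2,3]))"])
  have *: "complex_polynomial_fun (\<lambda>c. mult_matrix c z $ i $ j)" for z i j
    unfolding mult_matrix_def vec_lambda_beta by (intro poly_fun_intros)
  have **: "complex_polynomial_fun (\<lambda>c. det (mult_matrix c z))" for z
    by (intro poly_fun_det_3 *)
  show "complex_polynomial_fun (\<lambda>c. det (mult_matrix c (vector [1,2,3])) * disc (mult_matrix c (vector [1,2,3])))"
    unfolding disc_def trace_def minor_sum_def by (intro poly_fun_intros * **)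
  show "det (mult_matrix T20 (vector [1,2,3])) * disc (mult_matrix T20 (vector [1,2,3])) \<noteq> 0"
    by (simp add: disc_def trace_def minor_sum_def sum_3 det_3 mult_matrix_def T20_nf mult_of_nf axis_component)
qed (use T20_tpa gl_orbit_T20_if_disc in auto)

section \<open>Separating the components\<close>

lemma mult_of_affine: "mult_of (r *s c + s *s d) x y = r *s mult_of c x y + s *s mult_of d x y"
  by (simp add: mult_of_def vec_eq_iff algebra_simps sum.distrib sum_distrib_left)

lemma bracket_of_affine: "bracket_of (r *s c + s *s d) x y = r *s bracket_of c x y + s *s bracket_of d x y"
  by (simp add: bracket_of_def vec_eq_iff algebra_simps sum.distrib sum_distrib_left)

lemma T09_affine: "(1 - t) *s T09 \<alpha> \<beta> + t *s T09 \<alpha>' \<beta>' = T09 ((1 - t) * \<alpha> + t * \<alpha>') ((1 - t) * \<beta> + t * \<beta>')"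
  unfolding T09_nf
  by (intro structure_constants_eqI; unfold mult_of_affine bracket_of_affine mult_of_nf bracket_of_nf)
    (simp_all add: vec_eq_iff forall_3 algebra_simps)

lemma T12_affine: "(1 - t) *s T12 \<beta> + t *s T12 \<beta>' = T12 ((1 - t) * \<beta> + t * \<beta>')"
  unfolding T12_nf
  by (intro structure_constants_eqI; unfold mult_of_affine bracket_of_affine mult_of_nf bracket_of_nf)
    (simp_all add: vec_eq_iff forall_3 algebra_simps)

lemma T17_affine: "(1 - t) *s T17 \<beta> + t *s T17 \<beta>' = T17 ((1 - t) * \<beta> + t * \<beta>')"
  unfolding T17_nf
  by (intro structure_constants_eqI; unfold mult_of_affine bracket_of_affine mult_of_nf bracket_of_nf)
    (simp_all add: vec_eq_iff forall_3 algebra_simps)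

text \<open>A single algebra counts as a family without parameters, so one irreducibility lemma
  serves all five closures.\<close>

lemma singleton_affine: "a \<in> {c :: 3 structure_constants} \<Longrightarrow> b \<in> {c} \<Longrightarrow> (1 - t) *s a + t *s b \<in> {c}"
  by (simp add: vec.scale_left_diff_distrib)

lemma K09_affine: "a \<in> K09 \<Longrightarrow> b \<in> K09 \<Longrightarrow> (1 - t) *s a + t *s b \<in> K09"
  using T09_affine by blast

lemma K12_affine: "a \<in> K12 \<Longrightarrow> b \<in> K12 \<Longrightarrow> (1 - t) *s a + t *s b \<in> K12"
  using T12_affine by auto

lemma K17_affine: "a \<in> K17 \<Longrightarrow> b \<in> K17 \<Longrightarrow> (1 - t) *s a + t *s b \<in> K17"
  using T17_affine by auto

text \<open>A closed condition that is invariant under change of basis passes from \<open>K\<close>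
  to its orbits and on to their closure.\<close>

lemma closure_gl_span_subset:
  assumes "zariski_closed {c. P c}" "\<And>c. c \<in> K \<Longrightarrow> P c"
    and "\<And>g c. invertible g \<Longrightarrow> P c \<Longrightarrow> P (gl_act g c)"
  shows "c \<in> zariski closure_of gl_span K \<Longrightarrow> P c"
proof -
  have "gl_span K \<subseteq> {c. P c}"
    using assms(2,3) unfolding gl_span_def gl_orbit_def by auto
  then have "zariski closure_of gl_span K \<subseteq> {c. P c}"
    using assms(1) by (intro closure_of_minimal) (simp_all add: closedin_zariski)
  then show "c \<in> zariski closure_of gl_span K \<Longrightarrow> P c"
    by blast
qed

lemma closure_gl_span_tpa: "K \<subseteq> tpa_variety \<Longrightarrow> zariski closure_of gl_span K \<subseteq> tpa_variety"
  by (rule subsetI, rule closure_gl_span_subset[of "\<lambda>c. c \<in> tpa_variety" K])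
    (auto simp: zariski_closed_tpa_variety intro: tpa_variety_gl_act)

definition metabelian :: "3 structure_constants \<Rightarrow> bool" where
  "metabelian c \<longleftrightarrow> (\<forall>x y z w. bracket_of c (bracket_of c x y) (bracket_of c z w) = 0)"

definition mult_zero :: "3 structure_constants \<Rightarrow> bool" where
  "mult_zero c \<longleftrightarrow> (\<forall>x y. mult_of c x y = 0)"

definition bracket_zero :: "3 structure_constants \<Rightarrow> bool" where
  "bracket_zero c \<longleftrightarrow> (\<forall>x y. bracket_of c x y = 0)"

text \<open>Fixes the proportion of the eigenvalues of ad x: they are 0, t, 2t in
  \<open>T12\<close>, giving 9 * 5 = 5 * 9, and 0, 0, t in \<open>T17\<close>, giving 1 : 1.
  Cross-multiplied, the condition is polynomial.\<close>

definition trace_ratio :: "complex \<Rightarrow> complex \<Rightarrow> 3 structure_constants \<Rightarrow> bool" where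
  "trace_ratio p q c \<longleftrightarrow>
    (\<forall>x. p * trace (bracket_matrix c x ** bracket_matrix c x) = q * trace (bracket_matrix c x) ^ 2)"

text \<open>This says \<open>(L\<^sub>x - t)\<^sup>2 = 0\<close> for multiplication by \<open>x\<close>, where \<open>3t\<close> is its trace.\<close>

definition almost_scalar :: "3 structure_constants \<Rightarrow> bool" where
  "almost_scalar c \<longleftrightarrow> (\<forall>x y. 9 *s mult_of c x (mult_of c x y) + trace (mult_matrix c x) ^ 2 *s y
     = (6 * trace (mult_matrix c x)) *s mult_of c x y)"

lemma mult_matrix_gl_act:
  assumes "invertible g"
  shows "mult_matrix (gl_act g c) x = g ** mult_matrix c (matrix_inv g *v x) ** matrix_inv g"
  unfolding matrix_eq matrix_vector_mul_assoc[symmetric] mult_matrix_vec mult_of_gl_act by simp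

lemma bracket_matrix_gl_act:
  assumes "invertible g"
  shows "bracket_matrix (gl_act g c) x = g ** bracket_matrix c (matrix_inv g *v x) ** matrix_inv g"
  unfolding matrix_eq matrix_vector_mul_assoc[symmetric] bracket_matrix_vec bracket_of_gl_act by simp

lemma trace_conj:
  fixes g A :: "complex ^ 3 ^ 3"
  assumes "invertible g"
  shows "trace (g ** A ** matrix_inv g) = trace A"
proof -
  have "trace (g ** A ** matrix_inv g) = trace (matrix_inv g ** (g ** A))"
    by (rule trace_mul_sym)
  also have "\<dots> = trace A"
    by (simp add: matrix_mul_assoc matrix_inv_left[OF assms])
  finally show ?thesis .
qed

lemma conj_square:
  fixes g A :: "complex ^ 3 ^ 3"
  assumes "invertible g"
  shows "(g ** A ** matrix_inv g) ** (g ** A ** matrix_inv g) = g ** (A ** A) ** matrix_inv g"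
proof -
  have "(g ** A ** matrix_inv g) ** (g ** A ** matrix_inv g) = g ** A ** (matrix_inv g ** g) ** A ** matrix_inv g"
    by (simp only: matrix_mul_assoc)
  then show ?thesis
    by (simp add: matrix_inv_left[OF assms] matrix_mul_assoc)
qed

lemma gl_act_invariants:
  assumes g: "invertible g"
  shows "metabelian c \<Longrightarrow> metabelian (gl_act g c)" "mult_zero c \<Longrightarrow> mult_zero (gl_act g c)"
    "bracket_zero c \<Longrightarrow> bracket_zero (gl_act g c)" "trace_ratio p q c \<Longrightarrow> trace_ratio p q (gl_act g c)"
    "almost_scalar c \<Longrightarrow> almost_scalar (gl_act g c)"
proof -
  show "metabelian c \<Longrightarrow> metabelian (gl_act g c)" "mult_zero c \<Longrightarrow> mult_zero (gl_act g c)"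
    "bracket_zero c \<Longrightarrow> bracket_zero (gl_act g c)"
    by (simp_all add: metabelian_def mult_zero_def bracket_zero_def mult_of_gl_act bracket_of_gl_act
        matrix_inv_vector[OF g])
  show "trace_ratio p q c \<Longrightarrow> trace_ratio p q (gl_act g c)"
    by (simp add: trace_ratio_def bracket_matrix_gl_act[OF g] conj_square[OF g] trace_conj[OF g])
  assume c: "almost_scalar c"
  show "almost_scalar (gl_act g c)"
    unfolding almost_scalar_def mult_matrix_gl_act[OF g] trace_conj[OF g] mult_of_gl_act matrix_inv_vector[OF g]
  proof (intro allI)
    fix x y
    let ?x = "matrix_inv g *v x" and ?y = "matrix_inv g *v y"
    have "g *v (9 *s mult_of c ?x (mult_of c ?x ?y) + trace (mult_matrix c ?x) ^ 2 *s ?y) =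
        g *v ((6 * trace (mult_matrix c ?x)) *s mult_of c ?x ?y)"
      using c unfolding almost_scalar_def by simp
    then show "9 *s (g *v mult_of c ?x (mult_of c ?x ?y)) + trace (mult_matrix c ?x) ^ 2 *s y =
        (6 * trace (mult_matrix c ?x)) *s (g *v mult_of c ?x ?y)"
      by (simp only: matrix_vector_right_distrib vector_scalar_commute matrix_inv_vector[OF g])
  qed
qed

lemma zariski_closed_invariants:
  "zariski_closed {c. metabelian c}" "zariski_closed {c. mult_zero c}" "zariski_closed {c. bracket_zero c}"
  "zariski_closed {c. trace_ratio p q c}" "zariski_closed {c. almost_scalar c}"
proof -
  show "zariski_closed {c. metabelian c}" "zariski_closed {c. mult_zero c}" "zariski_closed {c. bracket_zero c}"
    unfolding metabelian_def mult_zero_def bracket_zero_def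
    by (intro zariski_closed_all zariski_closed_vec_eq poly_fun_mult_of poly_fun_bracket_of;
        simp add: poly_fun_intros)+
  show "zariski_closed {c. trace_ratio p q c}"
    unfolding trace_ratio_def trace_def matrix_matrix_mult_def bracket_matrix_def vec_lambda_beta
    by (intro zariski_closed_all zariski_closed_poly_eq poly_fun_intros)
  have "complex_polynomial_fun (\<lambda>c. trace (mult_matrix c x))" for x
    unfolding trace_def mult_matrix_def vec_lambda_beta by (intro poly_fun_intros)
  then show "zariski_closed {c. almost_scalar c}"
    unfolding almost_scalar_def
    by (intro zariski_closed_all zariski_closed_vec_eq poly_fun_vec_arith poly_fun_mult_of; simp add: poly_fun_intros)
qed

lemmas closure_invariant =
  closure_gl_span_subset[OF zariski_closed_invariants(1) _ gl_act_invariants(1)]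
  closure_gl_span_subset[OF zariski_closed_invariants(2) _ gl_act_invariants(2)]
  closure_gl_span_subset[OF zariski_closed_invariants(3) _ gl_act_invariants(3)]
  closure_gl_span_subset[OF zariski_closed_invariants(4) _ gl_act_invariants(4)]
  closure_gl_span_subset[OF zariski_closed_invariants(5) _ gl_act_invariants(5)]

lemma metabelian_families:
  "metabelian T20" "metabelian (T09 \<alpha> \<beta>)" "metabelian (T12 \<beta>)" "metabelian (T17 \<beta>)" "\<not> metabelian T01"
proof -
  show "\<not> metabelian T01"
    unfolding metabelian_def T01_nf not_all
    by (intro exI[of _ "vector [1,0,0]"] exI[of _ "vector [0,1,0]"] exI[of _ "vector [0,0,1]"])
      (auto simp: bracket_of_nf vec_eq_iff forall_3 intro!: exI[of _ "vector [1,0,0]"] exI[of _ "vector [0,1,0]"] exI[of _ "vector [0,0,1]"])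
qed (simp_all add: metabelian_def T20_nf T09_nf T12_nf T17_nf bracket_of_nf vec_eq_iff forall_3)

text \<open>The parameter 1 is needed for the second claim because \<open>T09 \<alpha> 0\<close> has
  zero product.\<close>

lemma mult_zero_families:
  "mult_zero T01" "\<not> mult_zero (T09 \<alpha> 1)" "\<not> mult_zero (T12 \<beta>)" "\<not> mult_zero (T17 \<beta>)"
proof -
  show "mult_zero T01"
    by (simp add: mult_zero_def T01_nf mult_of_nf vec_eq_iff)
  have "mult_of (T09 \<alpha> 1) (axis 3 1) (axis 3 1) \<noteq> 0" "mult_of (T12 \<beta>) (axis 1 1) (axis 1 1) \<noteq> 0"
    "mult_of (T17 \<beta>) (axis 1 1) (axis 1 1) \<noteq> 0"
    by (simp_all add: T09_nf T12_nf T17_nf mult_of_nf vec_eq_iff forall_3 axis_component)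
  then show "\<not> mult_zero (T09 \<alpha> 1)" "\<not> mult_zero (T12 \<beta>)" "\<not> mult_zero (T17 \<beta>)"
    unfolding mult_zero_def by blast+
qed

lemma bracket_zero_families:
  "bracket_zero T20" "\<not> bracket_zero T01" "\<not> bracket_zero (T09 \<alpha> \<beta>)" "\<not> bracket_zero (T12 \<beta>)"
  "\<not> bracket_zero (T17 \<beta>)"
proof -
  show "bracket_zero T20"
    by (simp add: bracket_zero_def T20_nf bracket_of_nf vec_eq_iff)
  have "bracket_of T01 (axis 1 1) (axis 3 1) \<noteq> 0" "bracket_of (T09 \<alpha> \<beta>) (axis 1 1) (axis 3 1) \<noteq> 0"
    "bracket_of (T12 \<beta>) (axis 1 1) (axis 3 1) \<noteq> 0" "bracket_of (T17 \<beta>) (axis 1 1) (axis 3 1) \<noteq> 0"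
    by (simp_all add: T01_nf T09_nf T12_nf T17_nf bracket_of_nf vec_eq_iff forall_3 axis_component)
  then show "\<not> bracket_zero T01" "\<not> bracket_zero (T09 \<alpha> \<beta>)" "\<not> bracket_zero (T12 \<beta>)" "\<not> bracket_zero (T17 \<beta>)"
    unfolding bracket_zero_def by blast+
qed

lemma trace_bracket_T09:
  "trace (bracket_matrix (T09 \<alpha> \<beta>) x) = - (1 + \<alpha>) * x$3"
  "trace (bracket_matrix (T09 \<alpha> \<beta>) x ** bracket_matrix (T09 \<alpha> \<beta>) x) = (1 + \<alpha>^2) * x$3^2"
  by (simp_all add: trace_def matrix_matrix_mult_def bracket_matrix_def sum_3 T09_nf bracket_of_nf
      axis_component algebra_simps power2_eq_square)

lemma trace_bracket_T12:
  "trace (bracket_matrix (T12 \<beta>) x) = - 3 * x$3"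
  "trace (bracket_matrix (T12 \<beta>) x ** bracket_matrix (T12 \<beta>) x) = 5 * x$3^2"
  by (simp_all add: trace_def matrix_matrix_mult_def bracket_matrix_def sum_3 T12_nf bracket_of_nf
      axis_component algebra_simps power2_eq_square)

lemma trace_bracket_T17:
  "trace (bracket_matrix (T17 \<beta>) x) = - x$3"
  "trace (bracket_matrix (T17 \<beta>) x ** bracket_matrix (T17 \<beta>) x) = x$3^2"
  by (simp_all add: trace_def matrix_matrix_mult_def bracket_matrix_def sum_3 T17_nf bracket_of_nf
      axis_component algebra_simps power2_eq_square)

lemma trace_ratio_families:
  "trace_ratio 9 5 (T12 \<beta>)" "\<not> trace_ratio 9 5 (T17 \<beta>)" "\<not> trace_ratio 9 5 (T09 1 \<beta>)"
  "trace_ratio 1 1 (T17 \<beta>)" "\<not> trace_ratio 1 1 (T12 \<beta>)" "\<not> trace_ratio 1 1 (T09 1 \<beta>)"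
  unfolding trace_ratio_def trace_bracket_T09 trace_bracket_T12 trace_bracket_T17 not_all
  by (auto simp: power_mult_distrib intro!: exI[of _ "axis 3 1"] simp: axis_component)

lemma almost_scalar_families:
  "almost_scalar (T09 \<alpha> \<beta>)" "\<not> almost_scalar (T12 1)" "\<not> almost_scalar (T17 \<beta>)"
proof -
  have tr: "trace (mult_matrix (T09 \<alpha> \<beta>) x) = 3 * \<beta> * x$3"
    "trace (mult_matrix (T12 \<beta>) x) = 3 * \<beta> * x$3"
    "trace (mult_matrix (T17 \<beta>) x) = 3 * \<beta> * x$3 - x$1 + x$2" for x
    by (simp_all add: trace_def mult_matrix_def sum_3 T09_nf T12_nf T17_nf mult_of_nf axis_component algebra_simps)
  show "almost_scalar (T09 \<alpha> \<beta>)"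
    unfolding almost_scalar_def tr
    by (simp add: T09_nf mult_of_nf vec_eq_iff forall_3 algebra_simps power2_eq_square)
  have tr12: "trace (mult_matrix (T12 1) x) = 3 * x$3" for x
    by (simp add: trace_def mult_matrix_def sum_3 T12_nf mult_of_nf axis_component algebra_simps)
  \<comment> \<open>Multiplication by e_1 has trace 0 and sends e_3 to e_1 and e_1 to e_2, so its
    square is not zero. For \<open>T12 0\<close> the condition would hold.\<close>
  have "9 *s mult_of (T12 1) (axis 1 1) (mult_of (T12 1) (axis 1 1) (axis 3 1)) +
      trace (mult_matrix (T12 1) (axis 1 1)) ^ 2 *s axis 3 1 \<noteq>
      (6 * trace (mult_matrix (T12 1) (axis 1 1))) *s mult_of (T12 1) (axis 1 1) (axis 3 1)"
    unfolding tr12 by (simp add: T12_nf mult_of_nf vec_eq_iff forall_3 axis_component)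
  then show "\<not> almost_scalar (T12 1)"
    unfolding almost_scalar_def by blast
  have "9 *s mult_of (T17 \<beta>) (axis 1 1) (mult_of (T17 \<beta>) (axis 1 1) (axis 1 1)) +
      trace (mult_matrix (T17 \<beta>) (axis 1 1)) ^ 2 *s axis 1 1 \<noteq>
      (6 * trace (mult_matrix (T17 \<beta>) (axis 1 1))) *s mult_of (T17 \<beta>) (axis 1 1) (axis 1 1)"
    unfolding tr by (simp add: T17_nf mult_of_nf vec_eq_iff forall_3 axis_component)
  then show "\<not> almost_scalar (T17 \<beta>)"
    unfolding almost_scalar_def by blast
qed

text \<open>The orbit is a neighbourhood of \<open>c\<close> in the variety, so it meets the dense
  part \<open>gl_span K\<close> of the closure; moving within the orbit reaches \<open>K\<close>
  itself.\<close>

lemma rigid_orbit_meets_family: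
  assumes "tpa_rigid c" "c \<in> zariski closure_of gl_span K" "K \<subseteq> tpa_variety"
  shows "\<exists>d\<in>K. d \<in> gl_orbit c"
proof -
  obtain U where U: "openin zariski U" "gl_orbit c = U \<inter> tpa_variety"
    using assms(1) unfolding tpa_rigid_def openin_subtopology by blast
  then have "c \<in> U"
    using gl_orbit_refl by blast
  then obtain d where d: "d \<in> gl_span K" "d \<in> U"
    using assms(2) U(1) unfolding in_closure_of by blast
  then obtain k g where k: "k \<in> K" "invertible g" "d = gl_act g k"
    unfolding gl_span_def gl_orbit_def by blast
  then have "d \<in> tpa_variety"
    using assms(3) tpa_variety_gl_act by blast
  then have "d \<in> gl_orbit c"
    using d U(2) by blast
  then have "gl_act (matrix_inv g) d \<in> gl_orbit c"
    by (rule gl_act_gl_orbit[OF invertible_matrix_inv[OF k(2)]])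
  then show ?thesis
    using k by (auto simp: gl_act_inverse)
qed

text \<open>A zero bracket can arise as a limit of nonzero ones, so vanishing of the bracket does
  not by itself exclude \<open>T20\<close>. Rigidity does: its orbit would contain an algebra of
  \<open>K\<close>, whose bracket is nonzero.\<close>

lemma T20_not_in_closure:
  assumes "K \<subseteq> tpa_variety" "\<And>d. d \<in> K \<Longrightarrow> \<not> bracket_zero d"
  shows "T20 \<notin> zariski closure_of gl_span K"
  using rigid_orbit_meets_family[OF tpa_rigid_T20 _ assms(1)] assms(2) gl_act_invariants(3)[OF _ bracket_zero_families(1)]
  unfolding gl_orbit_def by blast

lemma in_closure: "c \<in> K \<Longrightarrow> c \<in> zariski closure_of gl_span K"
  using closure_subset_zariski[of "gl_span K"] gl_orbit_refl unfolding gl_span_def by blast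

theorem theoremC:
  shows "card (irreducible_components (subtopology zariski (tpa_variety :: 3 structure_constants set))) = 5
    \<and> irreducible_components (subtopology zariski (tpa_variety :: 3 structure_constants set)) =
      {zariski closure_of gl_orbit T01,
       zariski closure_of gl_orbit T20,
       zariski closure_of (\<Union>\<alpha>. \<Union>\<beta>. gl_orbit (T09 \<alpha> \<beta>)),
       zariski closure_of (\<Union>\<beta>. gl_orbit (T12 \<beta>)),
       zariski closure_of (\<Union>\<beta>. gl_orbit (T17 \<beta>))}
    \<and> tpa_rigid T01 \<and> tpa_rigid T20"
proof -
  let ?cl = "\<lambda>K. zariski closure_of gl_span K"
  define A B C D E where "A = ?cl {T01}" and "B = ?cl {T20}" and "C = ?cl K09" and "D = ?cl K12" and "E = ?cl K17"
  note defs = A_def B_def C_def D_def E_def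
  have eqs: "zariski closure_of gl_orbit T01 = A" "zariski closure_of gl_orbit T20 = B"
    "zariski closure_of (\<Union>\<alpha>. \<Union>\<beta>. gl_orbit (T09 \<alpha> \<beta>)) = C"
    "zariski closure_of (\<Union>\<beta>. gl_orbit (T12 \<beta>)) = D" "zariski closure_of (\<Union>\<beta>. gl_orbit (T17 \<beta>)) = E"
    unfolding defs gl_span_def by (auto intro!: arg_cong[where f="\<lambda>S. zariski closure_of S"])
  have tpa: "{T01} \<subseteq> tpa_variety" "{T20} \<subseteq> tpa_variety" "K09 \<subseteq> tpa_variety" "K12 \<subseteq> tpa_variety" "K17 \<subseteq> tpa_variety"
    using T01_tpa T20_tpa T09_tpa T12_tpa T17_tpa by auto
  have in_tpa: "A \<subseteq> tpa_variety" "B \<subseteq> tpa_variety" "C \<subseteq> tpa_variety" "D \<subseteq> tpa_variety" "E \<subseteq> tpa_variety"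
    unfolding defs by (intro closure_gl_span_tpa tpa)+
  have irr: "irreducible_space (subtopology zariski A)" "irreducible_space (subtopology zariski B)"
    "irreducible_space (subtopology zariski C)" "irreducible_space (subtopology zariski D)"
    "irreducible_space (subtopology zariski E)"
    unfolding defs
    by (rule irreducible_gl_span[OF _ singleton_affine], simp, assumption, assumption,
        rule irreducible_gl_span[OF _ singleton_affine], simp, assumption, assumption,
        rule irreducible_gl_span[OF _ K09_affine], blast, assumption, assumption,
        rule irreducible_gl_span[OF _ K12_affine], blast, assumption, assumption,
        rule irreducible_gl_span[OF _ K17_affine], blast, assumption, assumption)
  \<comment> \<open>One witness for each closure, lying in none of the other four. In
    \<open>T09 1 1\<close> the equal eigenvalues violate both trace ratios and the parameter 1 gives
    a nonzero product.\<close>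
  have in_A: "T01 \<in> A" and in_B: "T20 \<in> B" and in_C: "T09 1 1 \<in> C" and in_D: "T12 1 \<in> D" and in_E: "T17 1 \<in> E"
    unfolding defs by (rule in_closure; blast)+
  have mb: "metabelian c" if "c \<in> B \<union> C \<union> D \<union> E" for c
    using that closure_invariant(1)[of "{T20}" c] closure_invariant(1)[of K09 c] closure_invariant(1)[of K12 c]
      closure_invariant(1)[of K17 c] metabelian_families
    unfolding defs by auto
  have not_A: "T01 \<notin> B \<union> C \<union> D \<union> E"
    using mb[of T01] metabelian_families(5) by (rule_tac notI) simp
  have not_B: "T20 \<notin> A" "T20 \<notin> C" "T20 \<notin> D" "T20 \<notin> E"
    using T20_not_in_closure[OF tpa(1)] T20_not_in_closure[OF tpa(3)] T20_not_in_closure[OF tpa(4)]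
      T20_not_in_closure[OF tpa(5)] bracket_zero_families(2-5)
    unfolding defs by blast+
  have zA: "mult_zero c" if "c \<in> A" for c
    using that closure_invariant(2)[of "{T01}" c] mult_zero_families(1) unfolding defs by simp
  have zB: "bracket_zero c" if "c \<in> B" for c
    using that closure_invariant(3)[of "{T20}" c] bracket_zero_families(1) unfolding defs by simp
  have zC: "almost_scalar c" if "c \<in> C" for c
    using that closure_invariant(5)[of K09 c] almost_scalar_families(1) unfolding defs by auto
  have zD: "trace_ratio 9 5 c" if "c \<in> D" for c
    using that closure_invariant(4)[of K12 9 5 c] trace_ratio_families(1) unfolding defs by auto
  have zE: "trace_ratio 1 1 c" if "c \<in> E" for c
    using that closure_invariant(4)[of K17 1 1 c] trace_ratio_families(4) unfolding defs by auto
  have not_C: "T09 1 1 \<notin> A" "T09 1 1 \<notin> B" "T09 1 1 \<notin> D" "T09 1 1 \<notin> E"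
    using zA[of "T09 1 1"] zB[of "T09 1 1"] zD[of "T09 1 1"] zE[of "T09 1 1"]
      mult_zero_families(2) bracket_zero_families(3) trace_ratio_families(3,6) by auto
  have not_D: "T12 1 \<notin> A" "T12 1 \<notin> B" "T12 1 \<notin> C" "T12 1 \<notin> E"
    using zA[of "T12 1"] zB[of "T12 1"] zC[of "T12 1"] zE[of "T12 1"]
      mult_zero_families(3) bracket_zero_families(4) trace_ratio_families(5) almost_scalar_families(2) by auto
  have not_E: "T17 1 \<notin> A" "T17 1 \<notin> B" "T17 1 \<notin> C" "T17 1 \<notin> D"
    using zA[of "T17 1"] zB[of "T17 1"] zC[of "T17 1"] zD[of "T17 1"]
      mult_zero_families(4) bracket_zero_families(5) trace_ratio_families(2) almost_scalar_families(3) by auto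
  have anti: "Z = Z'" if "Z \<in> {A, B, C, D, E}" "Z' \<in> {A, B, C, D, E}" "Z \<subseteq> Z'" for Z Z'
    using that in_A in_B in_C in_D in_E not_A not_B not_C not_D not_E by (elim insertE emptyE) auto
  let ?X = "subtopology zariski (tpa_variety :: 3 structure_constants set)"
  have cover: "tpa_variety = A \<union> B \<union> C \<union> D \<union> E"
  proof
    show "tpa_variety \<subseteq> A \<union> B \<union> C \<union> D \<union> E"
    proof
      fix c :: "3 structure_constants" assume c: "c \<in> tpa_variety"
      show "c \<in> A \<union> B \<union> C \<union> D \<union> E"
      proof (cases "det (bracket_dual c) = 0")
        case True
        then show ?thesis
          using covered_if_dual_singular[OF c] unfolding covered_def defs by blast
      next
        case False
        then have "c \<in> gl_orbit T01"
          by (rule gl_orbit_T01_if_dual_regular[OF c])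
        then show ?thesis
          using closure_subset_zariski[of "gl_orbit T01"] unfolding eqs by blast
      qed
    qed
  qed (use in_tpa in blast)
  have sub: "subtopology ?X Z = subtopology zariski Z" if "Z \<in> {A, B, C, D, E}" for Z
    using that in_tpa by (auto simp: subtopology_subtopology Int_absorb1)
  have "irreducible_components ?X = {A, B, C, D, E}"
  proof (rule irreducible_components_eqI)
    show "topspace ?X = \<Union>{A, B, C, D, E}"
      using cover by (simp add: Un_assoc)
    show "closedin ?X Z" if "Z \<in> {A, B, C, D, E}" for Z
    proof -
      have "closedin zariski Z" "Z \<subseteq> tpa_variety"
        using that in_tpa unfolding defs by auto
      then show ?thesis
        by (rule closedin_subset_topspace)
    qed
    show "irreducible_space (subtopology ?X Z)" if "Z \<in> {A, B, C, D, E}" for Z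
      unfolding sub[OF that] using that irr by (elim insertE emptyE) simp_all
    show "finite {A, B, C, D, E}"
      by simp
  qed (rule anti)
  moreover have "card {A, B, C, D, E} = 5"
  proof -
    have "A \<noteq> B" "A \<noteq> C" "A \<noteq> D" "A \<noteq> E" "B \<noteq> C" "B \<noteq> D" "B \<noteq> E" "C \<noteq> D" "C \<noteq> E" "D \<noteq> E"
      using in_A in_B in_C in_D not_A not_B not_C not_D by auto
    then show ?thesis
      by simp
  qed
  ultimately show ?thesis
    unfolding eqs using tpa_rigid_T01 tpa_rigid_T20 by simp
qed

end
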